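(* $J(n,\mathfrak e)$ is a maximal Poisson commutative subalgebra of $\mathcal O(M_\Omega(n,\mathfrak e))$. In particular $[r_i,r_j]=0$ for any $i,j\in I_{d(n)}$. Furthermore if $f\in J(n,\mathfrak e)$ and $\nu\in\mathfrak e_{\Omega(n)}$, then $f|M_\nu(n,\mathfrak e)$ is a constant function and $\xi_f|M_\nu(n,\mathfrak e)$ is tangent to $M_\nu(n,\mathfrak e)$. Moreover, if we write $$\xi_f=\sum_{i\in I_{d(n-1)}}f_i\,\xi_{\widehat{p_i}}$$ on $M_\nu(n,\mathfrak e)$, where $f_i\in\mathcal O(M_\nu(n,\mathfrak e))$, then all the $f_i$ are constant on $M_\nu(n,\mathfrak e)$. Finally, for any $z\in M_\nu(n,\mathfrak e)$, the vectors $(\xi_{r_i})_z$, $i\in I_{d(n-1)}$, form a basis of $T_z(M_\nu(n,\mathfrak e))$, and $(\xi_{r_i})_z=0$ for $i\in I_{d(n)}\setminus I_{d(n-1)}$.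
   Context: Fix a positive integer $n$. For $k\ge 0$ put $d(k)=k(k+1)/2$ and $I_k=\{1,\dots,k\}$. $M(n)$ is the space of complex $n\times n$ matrices; for $x\in M(n)$ and $m\in I_n$, $x_m$ is the upper left $m\times m$ block of $x$. $M_\Omega(n)$ is the Zariski open set of all $x\in M(n)$ such that $x_m$ has $m$ distinct eigenvalues for every $m\in I_n$, and $x_m,x_{m+1}$ have no common eigenvalue for every $m\in I_{n-1}$. $\mathfrak e_{\Omega(n)}$ is the set of all $\nu=(\nu(1),\dots,\nu(n))$, $\nu(m)=\mathrm{diag}(\nu_{1\,m},\dots,\nu_{m\,m})$, such that for each $m\in I_n$ the numbers $\nu_{1\,m},\dots,\nu_{m\,m}$ are distinct and $\nu_{i\,m}\ne\nu_{j\,m+1}$ for all $m\in I_{n-1}$, $i\in I_m$, $j\in I_{m+1}$; it is a Zariski open subset of $\mathbb C^{d(n)}$ and an affine variety. Let $$M_\Omega(n,\mathfrak e)=\{(\nu,x)\in\mathfrak e_{\Omega(n)}\times M_\Omega(n)\mid \nu(m)\text{ is } Gl(m)\text{-conjugate to }x_m\ \forall m\in I_n\},$$ with projections $\pi_n(\nu,x)=x$, $\kappa_n(\nu,x)=\nu$; it is a nonsingular affine variety of dimension $n^2$. For $\nu\in\mathfrak e_{\Omega(n)}$, $M_\nu(n,\mathfrak e)=\kappa_n^{-1}(\nu)$, a nonsingular closed subvariety. For $m\in I_n$, $k\in I_m$ let $r_{d(m-1)+k}(\nu,x)=\nu_{k\,m}$. Put $J(n,\mathfrak e)=\{q\circ\kappa_n\mid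 q\in\mathcal O(\mathfrak e_{\Omega(n)})\}$. For $m\in I_n$, $k\in I_m$, $p_{d(m-1)+k}\in\mathcal O(M(n))$ is defined by $\det(\lambda-x_m)=\lambda^m+\sum_{k=1}^m(-1)^{m-k+1}p_{d(m-1)+k}(x)\lambda^{k-1}$, and $\widehat{p_i}=p_i\circ\pi_n$. Poisson structure: on $M(n)$, $[f,g](x)=\mathrm{tr}(x[\nabla f(x),\nabla g(x)])$, where $\mathrm{tr}(\nabla f(x)v)=df_x(v)$. Since $\pi_n$ is a local analytic isomorphism onto $M_\Omega(n)$, the structure lifts to $M_\Omega(n,\mathfrak e)$ and makes $\mathcal O(M_\Omega(n,\mathfrak e))$ a Poisson algebra. For a function $\varphi$, $\xi_\varphi$ is the vector field with $\xi_\varphi\psi=[\varphi,\psi]$. For every $z\in M_\nu(n,\mathfrak e)$ the vectors $(\xi_{\widehat{p_i}})_z$, $i\in I_{d(n-1)}$, form a basis of $T_z(M_\nu(n,\mathfrak e))$. *)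

theory Defs
  imports
    "HOL-Analysis.Derivative"
    "HOL-Analysis.Function_Topology"
    "Jordan_Normal_Form.Char_Poly"
    "Jordan_Normal_Form.Spectral_Radius"
begin

subsection \<open>Regular functions\<close>

text \<open>The polynomial functions generated by a set \<open>X\<close> of coordinate functions.\<close>

inductive_set polynomial_funs :: "('p \<Rightarrow> complex) set \<Rightarrow> ('p \<Rightarrow> complex) set"
  for X :: "('p \<Rightarrow> complex) set" where
  const: "(\<lambda>_. c) \<in> polynomial_funs X"
| coord: "q \<in> X \<Longrightarrow> q \<in> polynomial_funs X"
| add: "P \<in> polynomial_funs X \<Longrightarrow> Q \<in> polynomial_funs X \<Longrightarrow> (\<lambda>z. P z + Q z) \<in> polynomial_funs X"
| mult: "P \<in> polynomial_funs X \<Longrightarrow> Q \<in> polynomial_funs X \<Longrightarrow> (\<lambda>z. P z * Q z) \<in> polynomial_funs X"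

text \<open>The regular functions \<open>\<O>(V)\<close> on a locally closed subset \<open>V\<close> of the affine space with
  coordinates \<open>X\<close>: those which near every point of \<open>V\<close> are quotients of polynomials.  The Zariski
  neighbourhood of \<open>z\<close> in \<open>V\<close> may be taken to be the nonvanishing set of the denominator (if it is
  smaller, multiply numerator and denominator by a polynomial that vanishes off it but not at
  \<open>z\<close>).  Functions on \<open>V\<close> are represented by their extensional representatives.\<close>

definition regular_funs :: "('p \<Rightarrow> complex) set \<Rightarrow> 'p set \<Rightarrow> ('p \<Rightarrow> complex) set" where
  "regular_funs X V = {f \<in> extensional V.
     \<forall>z\<in>V. \<exists>P\<in>polynomial_funs X. \<exists>Q\<in>polynomial_funs X.
       Q z \<noteq> 0 \<and> (\<forall>w\<in>V. Q w \<noteq> 0 \<longrightarrow> f w = P w / Q w)}"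

definition subalgebra_of :: "'p set \<Rightarrow> ('p \<Rightarrow> complex) set \<Rightarrow> ('p \<Rightarrow> complex) set \<Rightarrow> bool" where
  "subalgebra_of V R A \<longleftrightarrow> A \<subseteq> R \<and> (\<forall>c. (\<lambda>_\<in>V. c) \<in> A) \<and>
     (\<forall>f\<in>A. \<forall>g\<in>A. (\<lambda>z\<in>V. f z + g z) \<in> A \<and> (\<lambda>z\<in>V. f z * g z) \<in> A)"


subsection \<open>Tangent vectors as point derivations\<close>

text \<open>For an affine variety \<open>V\<close> with coordinate ring \<open>R\<close>, the tangent space at \<open>z\<close> is the space
  of \<open>\<complex>\<close>-linear point derivations \<open>R \<rightarrow> \<complex>\<close> at \<open>z\<close>.\<close>

definition tangent_space ::
  "'p set \<Rightarrow> ('p \<Rightarrow> complex) set \<Rightarrow> 'p \<Rightarrow> (('p \<Rightarrow> complex) \<Rightarrow> complex) set" where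
  "tangent_space V R z = {D \<in> extensional R.
     (\<forall>f\<in>R. \<forall>g\<in>R. D (\<lambda>w\<in>V. f w + g w) = D f + D g) \<and>
     (\<forall>c. \<forall>f\<in>R. D (\<lambda>w\<in>V. c * f w) = c * D f) \<and>
     (\<forall>f\<in>R. \<forall>g\<in>R. D (\<lambda>w\<in>V. f w * g w) = f z * D g + g z * D f)}"

text \<open>The tangent space at \<open>z\<close> of a closed subvariety \<open>W\<close> of \<open>V\<close>, as a subspace of the tangent
  space of \<open>V\<close>: the tangent vectors that annihilate the ideal of \<open>W\<close>.\<close>

definition sub_tangent_space ::
  "'p set \<Rightarrow> ('p \<Rightarrow> complex) set \<Rightarrow> 'p set \<Rightarrow> 'p \<Rightarrow> (('p \<Rightarrow> complex) \<Rightarrow> complex) set" where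
  "sub_tangent_space V R W z =
     {D \<in> tangent_space V R z. \<forall>f\<in>R. (\<forall>w\<in>W. f w = 0) \<longrightarrow> D f = 0}"

text \<open>The family \<open>b\<close> indexed by the finite set \<open>I\<close> is a basis of the space \<open>T\<close> of functionals
  on \<open>R\<close>.\<close>

definition basis_of_functionals :: "'f set \<Rightarrow> ('f \<Rightarrow> complex) set \<Rightarrow> 'i set \<Rightarrow> ('i \<Rightarrow> 'f \<Rightarrow> complex) \<Rightarrow> bool" where
  "basis_of_functionals R T I b \<longleftrightarrow> (\<forall>i\<in>I. b i \<in> T) \<and>
     (\<forall>c. (\<forall>\<psi>\<in>R. (\<Sum>i\<in>I. c i * b i \<psi>) = 0) \<longrightarrow> (\<forall>i\<in>I. c i = 0)) \<and>
     (\<forall>D\<in>T. \<exists>c. \<forall>\<psi>\<in>R. D \<psi> = (\<Sum>i\<in>I. c i * b i \<psi>))"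


subsection \<open>The varieties\<close>

definition tri :: "nat \<Rightarrow> nat" where
  "tri k = k * (k + 1) div 2"

definition block :: "nat \<Rightarrow> complex mat \<Rightarrow> complex mat" where
  "block m x = Matrix.mat m m (\<lambda>ij. x $$ ij)"

definition M_Omega :: "nat \<Rightarrow> complex mat set" where
  "M_Omega n = {x \<in> carrier_mat n n.
     (\<forall>m\<in>{1..n}. card (spectrum (block m x)) = m) \<and>
     (\<forall>m\<in>{1..<n}. spectrum (block m x) \<inter> spectrum (block (m + 1) x) = {})}"

text \<open>A point \<open>\<nu>\<close> of \<open>\<complex>\<^sup>d\<^sup>(\<^sup>n\<^sup>)\<close> is an extensional function on the index pairs; its value at
  \<open>(k, m)\<close> is \<open>\<nu>\<^sub>k\<^sub>m\<close>.\<close>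

definition eig_index :: "nat \<Rightarrow> (nat \<times> nat) set" where
  "eig_index n = {(k, m). 1 \<le> k \<and> k \<le> m \<and> m \<le> n}"

definition e_Omega :: "nat \<Rightarrow> (nat \<times> nat \<Rightarrow> complex) set" where
  "e_Omega n = {\<nu> \<in> extensional (eig_index n).
     (\<forall>m\<in>{1..n}. inj_on (\<lambda>k. \<nu> (k, m)) {1..m}) \<and>
     (\<forall>m\<in>{1..<n}. \<forall>i\<in>{1..m}. \<forall>j\<in>{1..m + 1}. \<nu> (i, m) \<noteq> \<nu> (j, m + 1))}"

definition eig_diag :: "nat \<Rightarrow> (nat \<times> nat \<Rightarrow> complex) \<Rightarrow> complex mat" where
  "eig_diag m \<nu> = mat_diag m (\<lambda>k. \<nu> (k + 1, m))"

type_synonym point = "(nat \<times> nat \<Rightarrow> complex) \<times> complex mat"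

definition M_Omega_e :: "nat \<Rightarrow> point set" where
  "M_Omega_e n = {(\<nu>, x). \<nu> \<in> e_Omega n \<and> x \<in> M_Omega n \<and>
     (\<forall>m\<in>{1..n}. similar_mat (eig_diag m \<nu>) (block m x))}"

text \<open>The projections \<open>\<kappa>\<^sub>n\<close> and \<open>\<pi>\<^sub>n\<close> are \<^const>\<open>fst\<close> and \<^const>\<open>snd\<close>.\<close>

definition M_fibre :: "nat \<Rightarrow> (nat \<times> nat \<Rightarrow> complex) \<Rightarrow> point set" where
  "M_fibre n \<nu> = {z \<in> M_Omega_e n. fst z = \<nu>}"

definition coords_e :: "nat \<Rightarrow> ((nat \<times> nat \<Rightarrow> complex) \<Rightarrow> complex) set" where
  "coords_e n = (\<lambda>p \<nu>. \<nu> p) ` eig_index n"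

definition coords_M_e :: "nat \<Rightarrow> (point \<Rightarrow> complex) set" where
  "coords_M_e n = (\<lambda>p z. fst z p) ` eig_index n \<union> (\<lambda>ij z. snd z $$ ij) ` ({..<n} \<times> {..<n})"

definition O_e :: "nat \<Rightarrow> ((nat \<times> nat \<Rightarrow> complex) \<Rightarrow> complex) set" where
  "O_e n = regular_funs (coords_e n) (e_Omega n)"

definition O_M_e :: "nat \<Rightarrow> (point \<Rightarrow> complex) set" where
  "O_M_e n = regular_funs (coords_M_e n) (M_Omega_e n)"

definition O_fibre :: "nat \<Rightarrow> (nat \<times> nat \<Rightarrow> complex) \<Rightarrow> (point \<Rightarrow> complex) set" where
  "O_fibre n \<nu> = regular_funs (coords_M_e n) (M_fibre n \<nu>)"

definition J_e :: "nat \<Rightarrow> (point \<Rightarrow> complex) set" where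
  "J_e n = {(\<lambda>z\<in>M_Omega_e n. q (fst z)) | q. q \<in> O_e n}"


subsection \<open>The functions \<open>r\<^sub>i\<close> and \<open>p\<^sub>i\<close>\<close>

text \<open>Every \<open>i \<ge> 1\<close> is uniquely of the form \<open>d(m-1)+k\<close> with \<open>1 \<le> k \<le> m\<close>; \<open>level i\<close> and \<open>position i\<close>
  are this \<open>m\<close> and this \<open>k\<close>.\<close>

definition level :: "nat \<Rightarrow> nat" where
  "level i = (LEAST m. i \<le> tri m)"

definition position :: "nat \<Rightarrow> nat" where
  "position i = i - tri (level i - 1)"

lemma tri_Suc: "tri (Suc m) = tri m + Suc m"
  unfolding tri_def by simp

lemma tri_mono: "a \<le> b \<Longrightarrow> tri a \<le> tri b"
  unfolding tri_def by (intro div_le_mono mult_le_mono) auto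

lemma level_position:
  assumes "1 \<le> k" "k \<le> m"
  shows "level (tri (m - 1) + k) = m" and "position (tri (m - 1) + k) = k"
proof -
  obtain l where m: "m = Suc l" using assms by (cases m) auto
  show 1: "level (tri (m - 1) + k) = m"
    unfolding level_def
  proof (rule Least_equality)
    show "tri (m - 1) + k \<le> tri m" using assms by (simp add: m tri_Suc)
    fix y assume y: "tri (m - 1) + k \<le> tri y"
    show "m \<le> y"
    proof (rule ccontr)
      assume "\<not> m \<le> y"
      then have "tri y \<le> tri l" by (intro tri_mono) (simp add: m)
      with y assms show False by (simp add: m)
    qed
  qed
  show "position (tri (m - 1) + k) = k" unfolding position_def 1 by simp
qed

definition gz_r :: "nat \<Rightarrow> nat \<Rightarrow> point \<Rightarrow> complex" where
  "gz_r n i = (\<lambda>z\<in>M_Omega_e n. fst z (position i, level i))"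

definition gz_p :: "nat \<Rightarrow> complex mat \<Rightarrow> complex" where
  "gz_p i x = (-1) ^ (level i - position i + 1) *
     poly.coeff (char_poly (block (level i) x)) (position i - 1)"

lemma gz_p_char_poly:
  assumes "1 \<le> m"
  shows "poly (char_poly (block m x)) t =
    t ^ m + (\<Sum>k\<in>{1..m}. (-1) ^ (m - k + 1) * gz_p (tri (m - 1) + k) x * t ^ (k - 1))"
proof -
  let ?c = "char_poly (block m x)"
  have B: "block m x \<in> carrier_mat m m" unfolding block_def by simp
  have dg: "degree ?c = m" and lc: "poly.coeff ?c m = 1"
    using degree_monic_char_poly[OF B] by auto
  have "(-1) ^ (m - k + 1) * gz_p (tri (m - 1) + k) x = poly.coeff ?c (k - 1)"
    if "k \<in> {1..m}" for k
  proof -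
    have "1 \<le> k" "k \<le> m" using that by auto
    from level_position[OF this] show ?thesis
      unfolding gz_p_def by (simp only: mult.assoc[symmetric] power_mult_distrib[symmetric]) simp
  qed
  then have "(\<Sum>k\<in>{1..m}. (-1) ^ (m - k + 1) * gz_p (tri (m - 1) + k) x * t ^ (k - 1))
      = (\<Sum>k\<in>{1..m}. poly.coeff ?c (k - 1) * t ^ (k - 1))"
    by (intro sum.cong) auto
  also have "\<dots> = (\<Sum>i<m. poly.coeff ?c i * t ^ i)"
    by (rule sum.reindex_bij_witness[of _ Suc "\<lambda>k. k - 1"]) auto
  finally show ?thesis
    unfolding poly_altdef dg by (simp add: lc lessThan_Suc_atMost[symmetric])
qed

definition gz_p_hat :: "nat \<Rightarrow> nat \<Rightarrow> point \<Rightarrow> complex" where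
  "gz_p_hat n i = (\<lambda>z\<in>M_Omega_e n. gz_p i (snd z))"


subsection \<open>The Poisson structure\<close>

definition trace_mat :: "complex mat \<Rightarrow> complex" where
  "trace_mat A = (\<Sum>i<dim_row A. A $$ (i, i))"

text \<open>The differential \<open>df\<^sub>x(v)\<close> of a holomorphic \<open>f\<close>, as a complex directional derivative.\<close>

definition mat_differential :: "(complex mat \<Rightarrow> complex) \<Rightarrow> complex mat \<Rightarrow> complex mat \<Rightarrow> complex" where
  "mat_differential f x v = deriv (\<lambda>t. f (x + t \<cdot>\<^sub>m v)) 0"

definition mat_gradient :: "nat \<Rightarrow> (complex mat \<Rightarrow> complex) \<Rightarrow> complex mat \<Rightarrow> complex mat" where
  "mat_gradient n f x = (THE A. A \<in> carrier_mat n n \<and>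
     (\<forall>v\<in>carrier_mat n n. trace_mat (A * v) = mat_differential f x v))"

definition mat_bracket ::
  "nat \<Rightarrow> (complex mat \<Rightarrow> complex) \<Rightarrow> (complex mat \<Rightarrow> complex) \<Rightarrow> complex mat \<Rightarrow> complex" where
  "mat_bracket n f g x = (let A = mat_gradient n f x; B = mat_gradient n g x
     in trace_mat (x * (A * B - B * A)))"

text \<open>The Euclidean topology of \<open>M(n)\<close>, with matrices viewed as functions on the index pairs.\<close>

definition mat_topology :: "nat \<Rightarrow> complex mat topology" where
  "mat_topology n = pullback_topology (carrier_mat n n)
     (\<lambda>x. \<lambda>ij\<in>{..<n} \<times> {..<n}. x $$ ij) euclidean"

text \<open>A continuous section \<open>s\<close> of \<open>\<pi>\<^sub>n\<close> over a neighbourhood \<open>U\<close> of \<open>\<pi>\<^sub>n(z)\<close> with \<open>s(\<pi>\<^sub>n(z)) = z\<close>.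
  As \<open>\<pi>\<^sub>n\<close> is a local analytic isomorphism, such an \<open>s\<close> exists, its germ is unique, and \<open>s\<close> is,
  near \<open>\<pi>\<^sub>n(z)\<close>, the analytic local inverse of \<open>\<pi>\<^sub>n\<close>.\<close>

definition local_section :: "nat \<Rightarrow> point \<Rightarrow> complex mat set \<Rightarrow> (complex mat \<Rightarrow> point) \<Rightarrow> bool" where
  "local_section n z U s \<longleftrightarrow> openin (mat_topology n) U \<and> snd z \<in> U \<and> s (snd z) = z \<and>
     (\<forall>y\<in>U. s y \<in> M_Omega_e n \<and> snd (s y) = y) \<and>
     continuous_map (subtopology (mat_topology n) U) euclidean (\<lambda>y. fst (s y))"

text \<open>The Poisson bracket lifted along \<open>\<pi>\<^sub>n\<close>.  It depends only on the germ of the section, hence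
  not on the choice of the section.\<close>

definition lifted_bracket :: "nat \<Rightarrow> (point \<Rightarrow> complex) \<Rightarrow> (point \<Rightarrow> complex) \<Rightarrow> point \<Rightarrow> complex" where
  "lifted_bracket n f g = (\<lambda>z\<in>M_Omega_e n.
     let s = (SOME s. \<exists>U. local_section n z U s) in mat_bracket n (f \<circ> s) (g \<circ> s) (snd z))"

text \<open>The value at \<open>z\<close> of the Hamiltonian vector field \<open>\<xi>\<^sub>\<phi>\<close>, given by \<open>\<xi>\<^sub>\<phi> \<psi> = [\<phi>, \<psi>]\<close>, as a
  functional on \<open>\<O>(M\<^sub>\<Omega>(n, \<ee>))\<close>.\<close>

definition ham_vec :: "nat \<Rightarrow> (point \<Rightarrow> complex) \<Rightarrow> point \<Rightarrow> (point \<Rightarrow> complex) \<Rightarrow> complex" where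
  "ham_vec n \<phi> z = (\<lambda>\<psi>\<in>O_M_e n. lifted_bracket n \<phi> \<psi> z)"

definition T_fibre :: "nat \<Rightarrow> (nat \<times> nat \<Rightarrow> complex) \<Rightarrow> point \<Rightarrow> ((point \<Rightarrow> complex) \<Rightarrow> complex) set" where
  "T_fibre n \<nu> z = sub_tangent_space (M_Omega_e n) (O_M_e n) (M_fibre n \<nu>) z"

definition poisson_commutative_subalgebra :: "nat \<Rightarrow> (point \<Rightarrow> complex) set \<Rightarrow> bool" where
  "poisson_commutative_subalgebra n A \<longleftrightarrow> subalgebra_of (M_Omega_e n) (O_M_e n) A \<and>
     (\<forall>f\<in>A. \<forall>g\<in>A. \<forall>z\<in>M_Omega_e n. lifted_bracket n f g z = 0)"

definition maximal_poisson_commutative_subalgebra :: "nat \<Rightarrow> (point \<Rightarrow> complex) set \<Rightarrow> bool" where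
  "maximal_poisson_commutative_subalgebra n A \<longleftrightarrow> poisson_commutative_subalgebra n A \<and>
     (\<forall>B. poisson_commutative_subalgebra n B \<and> A \<subseteq> B \<longrightarrow> B = A)"

text \<open>\<open>\<xi>\<^sub>f = \<Sum>\<^sub>i f\<^sub>i \<xi>\<^sub>p\<^sub>i\<close> on \<open>M\<^sub>\<nu>(n, \<ee>)\<close>, with \<open>i\<close> running from \<open>1\<close> to \<open>d(n-1)\<close>, with \<open>f\<^sub>i = F i\<close>
  regular on \<open>M\<^sub>\<nu>(n, \<ee>)\<close>, and with \<open>p\<^sub>i\<close> lifted along \<open>\<pi>\<^sub>n\<close>.\<close>

definition ham_expansion ::
  "nat \<Rightarrow> (nat \<times> nat \<Rightarrow> complex) \<Rightarrow> (point \<Rightarrow> complex) \<Rightarrow> (nat \<Rightarrow> point \<Rightarrow> complex) \<Rightarrow> bool" where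
  "ham_expansion n \<nu> f F \<longleftrightarrow> (\<forall>i\<in>{1..tri (n - 1)}. F i \<in> O_fibre n \<nu>) \<and>
     (\<forall>z\<in>M_fibre n \<nu>. \<forall>\<psi>\<in>O_M_e n.
        ham_vec n f z \<psi> = (\<Sum>i\<in>{1..tri (n - 1)}. F i z * ham_vec n (gz_p_hat n i) z \<psi>))"

end

theory Submission
  imports Defs "HOL-Analysis.Complex_Transcendental"
begin

text \<open>
  If \<open>w\<close> and \<open>u\<close> are right and left eigenvectors of \<open>x\<^sub>m\<close> for \<open>\<nu>\<^sub>k\<^sub>m\<close> with \<open>u w = 1\<close>, padded by zeros, then
  the gradient of \<open>r = \<nu>\<^sub>k\<^sub>m\<close> at \<open>x\<close> is the spectral projection \<open>w u\<close>, so \<open>\<xi>\<^sub>r\<close> is the direction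
  \<open>[x, w u]\<close>.  Its \<open>m\<close>-th block vanishes and it annihilates every \<open>d \<nu>\<^sub>i\<^sub>j\<close>, which gives commutativity.
  Moreover \<open>\<xi>\<^sub>r\<close> integrates to the conjugation by \<open>exp (s w u) = 1 + (exp s - 1) w u\<close>, which preserves
  the fibres of \<open>\<kappa>\<^sub>n\<close>.

  Since \<open>x\<^sub>m\<close> and \<open>x\<^sub>m\<^sub>+\<^sub>1\<close> have no common eigenvalue, the last column of \<open>x\<^sub>m\<^sub>+\<^sub>1\<close> has a nonzero
  component along each eigenvector of \<open>x\<^sub>m\<close>, and the eigenvectors of \<open>x\<^sub>m\<^sub>+\<^sub>1\<close> have nonzero last entries.
  Hence, passing from \<open>x\<^sub>m\<close> to \<open>x\<^sub>m\<^sub>+\<^sub>1\<close>, the level-\<open>m\<close> directions account exactly for the last column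
  and the level-\<open>(m+1)\<close> eigenvalues then determine the last row.  In its infinitesimal form this gives
  the basis of the tangent space; in its global form it shows that the flows act transitively on each
  fibre.  So a function commuting with all \<open>r\<^sub>i\<close> is constant on the fibres, and restricting it to
  a polynomial section of \<open>\<kappa>\<^sub>n\<close> shows that it lies in \<open>J(n, \<ee>)\<close>.
\<close>

subsection \<open>Regular functions, curves and point derivations\<close>

text \<open>Two notions of derivative have to be reconciled: brackets are complex derivatives along
  lines of M(n), lifted by a chosen section that is only known to be continuous, while tangent
  vectors are abstract derivations of the ring. At each point a regular function therefore gets one
  list of coefficients that serves both curves and derivations, and everything reduces to the
  eigenvalue and entry coordinates. Differentiability of the eigenvalues is read off from the
  characteristic polynomial. The tangent space of a fibre asks a derivation to kill every regular
  function vanishing on the fibre. Deducing this from d \<nu> = 0 would require generators of that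
  ideal; the explicit flow, which stays in the fibre, settles it directly. For transitivity, the
  ratio of two nonzero column components is a value of exp, so the required flow time exists. The
  f_i are constant because the partial derivatives of q and the Jacobian from \<nu> to the p_i
  depend on \<nu> alone.\<close>

lemma polynomial_funs_mono: "P \<in> polynomial_funs X \<Longrightarrow> X \<subseteq> Y \<Longrightarrow> P \<in> polynomial_funs Y"
  by (induction rule: polynomial_funs.induct) (auto intro: polynomial_funs.intros)

lemma polynomial_funs_pullback:
  assumes "P \<in> polynomial_funs X" and "\<And>q. q \<in> X \<Longrightarrow> (\<lambda>w. q (h w)) \<in> polynomial_funs Y"
  shows "(\<lambda>w. P (h w)) \<in> polynomial_funs Y"
  using assms by (induction rule: polynomial_funs.induct) (auto intro: polynomial_funs.intros)

lemma polynomial_funs_uminus: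
  "P \<in> polynomial_funs X \<Longrightarrow> (\<lambda>z. - P z) \<in> polynomial_funs X"
  using polynomial_funs.mult[OF polynomial_funs.const[of "-1"], of P X] by simp

lemma polynomial_funs_diff:
  "P \<in> polynomial_funs X \<Longrightarrow> Q \<in> polynomial_funs X \<Longrightarrow> (\<lambda>z. P z - Q z) \<in> polynomial_funs X"
  using polynomial_funs.add[OF _ polynomial_funs_uminus, of P X Q] by simp

lemma polynomial_funs_sum:
  "(\<And>i. i \<in> I \<Longrightarrow> P i \<in> polynomial_funs X) \<Longrightarrow> (\<lambda>z. \<Sum>i\<in>I. P i z) \<in> polynomial_funs X"
proof (induction I rule: infinite_finite_induct)
  case (insert i I)
  then show ?case
    using polynomial_funs.add[of "P i" X "\<lambda>z. \<Sum>i\<in>I. P i z"] by simp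
qed (auto intro: polynomial_funs.const)

lemma polynomial_funs_prod:
  "(\<And>i. i \<in> I \<Longrightarrow> P i \<in> polynomial_funs X) \<Longrightarrow> (\<lambda>z. \<Prod>i\<in>I. P i z) \<in> polynomial_funs X"
proof (induction I rule: infinite_finite_induct)
  case (insert i I)
  then show ?case
    using polynomial_funs.mult[of "P i" X "\<lambda>z. \<Prod>i\<in>I. P i z"] by simp
qed (auto intro: polynomial_funs.const)

lemmas polynomial_funs_intros = polynomial_funs.const polynomial_funs.add polynomial_funs.mult
  polynomial_funs_uminus polynomial_funs_diff polynomial_funs_sum polynomial_funs_prod

lemma det_polynomial_funs:
  assumes "\<And>i j. i < m \<Longrightarrow> j < m \<Longrightarrow> (\<lambda>z. A z (i, j)) \<in> polynomial_funs X"
  shows "(\<lambda>z. det (Matrix.mat m m (A z))) \<in> polynomial_funs X"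
proof -
  have "(\<lambda>z. \<Sum>p\<in>{p. p permutes {0..<m}}. signof p * (\<Prod>i = 0..<m. A z (i, p i))) \<in> polynomial_funs X"
  proof (intro polynomial_funs_sum polynomial_funs.mult polynomial_funs.const polynomial_funs_prod)
    fix p i assume "p \<in> {p. p permutes {0..<m}}" "i \<in> {0..<m}"
    then have "p i < m" using permutes_in_image[of p "{0..<m}" i] by auto
    then show "(\<lambda>z. A z (i, p i)) \<in> polynomial_funs X" using assms \<open>i \<in> _\<close> by auto
  qed
  moreover have "det (Matrix.mat m m (A z)) =
      (\<Sum>p\<in>{p. p permutes {0..<m}}. signof p * (\<Prod>i = 0..<m. A z (i, p i)))" for z
    unfolding det_def by (auto intro!: sum.cong prod.cong dest: permutes_in_image)
  ultimately show ?thesis by simp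
qed

lemma regular_funs_extensional: "f \<in> regular_funs X V \<Longrightarrow> f \<in> extensional V"
  by (simp add: regular_funs_def)

lemma restrict_regular_funs: "f \<in> regular_funs X V \<Longrightarrow> restrict f V = f"
  by (simp add: regular_funs_extensional extensional_restrict)

lemma polynomial_regular_funs:
  assumes "P \<in> polynomial_funs X" shows "restrict P V \<in> regular_funs X V"
proof -
  have "\<exists>P'\<in>polynomial_funs X. \<exists>Q\<in>polynomial_funs X.
      Q z \<noteq> 0 \<and> (\<forall>w\<in>V. Q w \<noteq> 0 \<longrightarrow> restrict P V w = P' w / Q w)" for z
    by (rule bexI[OF _ assms], rule bexI[of _ "\<lambda>_. 1"]) (auto intro: polynomial_funs.const)
  then show ?thesis unfolding regular_funs_def by auto
qed

lemma regular_funs_add: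
  assumes "f \<in> regular_funs X V" "g \<in> regular_funs X V"
  shows "(\<lambda>z\<in>V. f z + g z) \<in> regular_funs X V"
proof -
  have "\<exists>P\<in>polynomial_funs X. \<exists>Q\<in>polynomial_funs X. Q z \<noteq> 0 \<and>
      (\<forall>w\<in>V. Q w \<noteq> 0 \<longrightarrow> (\<lambda>z\<in>V. f z + g z) w = P w / Q w)" if z: "z \<in> V" for z
  proof -
    obtain P Q where 1: "P \<in> polynomial_funs X" "Q \<in> polynomial_funs X" "Q z \<noteq> 0"
      "\<forall>w\<in>V. Q w \<noteq> 0 \<longrightarrow> f w = P w / Q w" using assms(1) z unfolding regular_funs_def by blast
    obtain P' Q' where 2: "P' \<in> polynomial_funs X" "Q' \<in> polynomial_funs X" "Q' z \<noteq> 0"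
      "\<forall>w\<in>V. Q' w \<noteq> 0 \<longrightarrow> g w = P' w / Q' w" using assms(2) z unfolding regular_funs_def by blast
    show ?thesis
      by (rule bexI[of _ "\<lambda>w. P w * Q' w + P' w * Q w"], rule bexI[of _ "\<lambda>w. Q w * Q' w"])
        (use 1 2 in \<open>auto intro: polynomial_funs_intros simp: field_simps\<close>)
  qed
  then show ?thesis unfolding regular_funs_def by auto
qed

lemma regular_funs_mult:
  assumes "f \<in> regular_funs X V" "g \<in> regular_funs X V"
  shows "(\<lambda>z\<in>V. f z * g z) \<in> regular_funs X V"
proof -
  have "\<exists>P\<in>polynomial_funs X. \<exists>Q\<in>polynomial_funs X. Q z \<noteq> 0 \<and>
      (\<forall>w\<in>V. Q w \<noteq> 0 \<longrightarrow> (\<lambda>z\<in>V. f z * g z) w = P w / Q w)" if z: "z \<in> V" for z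
  proof -
    obtain P Q where 1: "P \<in> polynomial_funs X" "Q \<in> polynomial_funs X" "Q z \<noteq> 0"
      "\<forall>w\<in>V. Q w \<noteq> 0 \<longrightarrow> f w = P w / Q w" using assms(1) z unfolding regular_funs_def by blast
    obtain P' Q' where 2: "P' \<in> polynomial_funs X" "Q' \<in> polynomial_funs X" "Q' z \<noteq> 0"
      "\<forall>w\<in>V. Q' w \<noteq> 0 \<longrightarrow> g w = P' w / Q' w" using assms(2) z unfolding regular_funs_def by blast
    show ?thesis
      by (rule bexI[of _ "\<lambda>w. P w * P' w"], rule bexI[of _ "\<lambda>w. Q w * Q' w"])
        (use 1 2 in \<open>auto intro: polynomial_funs_intros\<close>)
  qed
  then show ?thesis unfolding regular_funs_def by auto
qed

lemma regular_funs_const: "(\<lambda>_\<in>V. c) \<in> regular_funs X V"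
  using polynomial_regular_funs[OF polynomial_funs.const] .

text \<open>Used for composition with \<kappa>_n and with a polynomial section of it.\<close>

lemma regular_funs_pullback:
  assumes f: "f \<in> regular_funs X V" and h: "\<And>w. w \<in> W \<Longrightarrow> h w \<in> V"
    and pb: "\<And>q. q \<in> X \<Longrightarrow> (\<lambda>w. q (h w)) \<in> polynomial_funs Y"
  shows "(\<lambda>w\<in>W. f (h w)) \<in> regular_funs Y W"
proof -
  have "\<exists>P\<in>polynomial_funs Y. \<exists>Q\<in>polynomial_funs Y. Q z \<noteq> 0 \<and>
      (\<forall>w\<in>W. Q w \<noteq> 0 \<longrightarrow> (\<lambda>w\<in>W. f (h w)) w = P w / Q w)" if z: "z \<in> W" for z
  proof -
    obtain P Q where 1: "P \<in> polynomial_funs X" "Q \<in> polynomial_funs X" "Q (h z) \<noteq> 0"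
      "\<forall>w\<in>V. Q w \<noteq> 0 \<longrightarrow> f w = P w / Q w" using f h[OF z] unfolding regular_funs_def by blast
    show ?thesis
      by (rule bexI[of _ "\<lambda>w. P (h w)"], rule bexI[of _ "\<lambda>w. Q (h w)"])
        (use 1 h in \<open>auto intro: polynomial_funs_pullback[OF _ pb]\<close>)
  qed
  then show ?thesis unfolding regular_funs_def by auto
qed

text \<open>Chain rule with coefficients that do not depend on the curve. The curve needs a
  derivative only at 0 and only in each coordinate, so lifted lines and Hamiltonian flows can both
  be inserted. With V = UNIV it applies to curves that leave the variety.\<close>

definition curve_partials ::
  "('p \<Rightarrow> complex) set \<Rightarrow> 'p set \<Rightarrow> 'p \<Rightarrow> ('p \<Rightarrow> complex) \<Rightarrow> (('p \<Rightarrow> complex) \<Rightarrow> complex) \<Rightarrow> bool" where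
  "curve_partials X V z f a \<longleftrightarrow> (\<forall>\<gamma> d. \<gamma> 0 = z \<longrightarrow> (\<forall>\<^sub>F t in nhds 0. \<gamma> t \<in> V) \<longrightarrow>
     (\<forall>q\<in>X. ((\<lambda>t. q (\<gamma> t)) has_field_derivative d q) (at 0)) \<longrightarrow>
     ((\<lambda>t. f (\<gamma> t)) has_field_derivative (\<Sum>q\<in>X. a q * d q)) (at 0))"

text \<open>The algebraic counterpart: the same expression in the values of a point derivation on
  the coordinates. Sharing \<open>a\<close> with \<open>curve_partials\<close> is what makes
  derivatives and derivations comparable.\<close>

definition derivation_partials ::
  "('p \<Rightarrow> complex) set \<Rightarrow> 'p set \<Rightarrow> 'p \<Rightarrow> ('p \<Rightarrow> complex) \<Rightarrow> (('p \<Rightarrow> complex) \<Rightarrow> complex) \<Rightarrow> bool" where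
  "derivation_partials X V z f a \<longleftrightarrow> (\<forall>D\<in>tangent_space V (regular_funs X V) z.
     D (restrict f V) = (\<Sum>q\<in>X. a q * D (restrict q V)))"

lemma tangent_space_add:
  assumes "D \<in> tangent_space V R z" "restrict f V \<in> R" "restrict g V \<in> R"
  shows "D (\<lambda>w\<in>V. f w + g w) = D (restrict f V) + D (restrict g V)"
proof -
  have "(\<lambda>w\<in>V. f w + g w) = (\<lambda>w\<in>V. restrict f V w + restrict g V w)" by (rule restrict_ext) simp
  moreover have "D (\<lambda>w\<in>V. restrict f V w + restrict g V w) = D (restrict f V) + D (restrict g V)"
    using assms unfolding tangent_space_def by blast
  ultimately show ?thesis by simp
qed

lemma tangent_space_scale:
  assumes "D \<in> tangent_space V R z" "restrict f V \<in> R"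
  shows "D (\<lambda>w\<in>V. c * f w) = c * D (restrict f V)"
proof -
  have "(\<lambda>w\<in>V. c * f w) = (\<lambda>w\<in>V. c * restrict f V w)" by (rule restrict_ext) simp
  moreover have "D (\<lambda>w\<in>V. c * restrict f V w) = c * D (restrict f V)"
    using assms unfolding tangent_space_def by blast
  ultimately show ?thesis by simp
qed

lemma tangent_space_mult:
  assumes "D \<in> tangent_space V R z" "restrict f V \<in> R" "restrict g V \<in> R" "z \<in> V"
  shows "D (\<lambda>w\<in>V. f w * g w) = f z * D (restrict g V) + g z * D (restrict f V)"
proof -
  have "(\<lambda>w\<in>V. f w * g w) = (\<lambda>w\<in>V. restrict f V w * restrict g V w)" by (rule restrict_ext) simp
  moreover have "D (\<lambda>w\<in>V. restrict f V w * restrict g V w) = restrict f V z * D (restrict g V) + restrict g V z * D (restrict f V)"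
    using assms unfolding tangent_space_def by blast
  ultimately show ?thesis using assms(4) by simp
qed

lemma tangent_space_const:
  assumes D: "D \<in> tangent_space V (regular_funs X V) z" and z: "z \<in> V"
  shows "D (\<lambda>w\<in>V. c) = 0"
proof -
  have R: "(\<lambda>w\<in>V. 1) \<in> regular_funs X V" by (rule regular_funs_const)
  \<comment> \<open>Leibniz rule for 1 = 1 * 1.\<close>
  have "D (\<lambda>w\<in>V. 1) = 0"
    using tangent_space_mult[OF D R R z] by simp
  with tangent_space_scale[OF D R, of c] show ?thesis by simp
qed

text \<open>Sum and product rule act in the same way on curves and on derivations, so one induction
  yields a common witness. The curve half is over UNIV because a polynomial will be differentiated
  along a curve outside the variety.\<close>

lemma polynomial_partials:
  assumes "P \<in> polynomial_funs X" and fin: "finite X" and z: "z \<in> V"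
  shows "\<exists>a. curve_partials X UNIV z P a \<and> derivation_partials X V z P a"
  using assms(1)
proof induction
  case (const c)
  show ?case
    by (rule exI[of _ "\<lambda>_. 0"])
      (auto simp: curve_partials_def derivation_partials_def tangent_space_const[OF _ z])
next
  case (coord q)
  then have 1: "(\<Sum>q'\<in>X. (if q' = q then 1 else 0) * d q') = d q" for d :: "_ \<Rightarrow> complex"
    using fin by (simp add: if_distrib[of "\<lambda>c. c * _"] cong: if_cong)
  show ?case
    by (rule exI[of _ "\<lambda>q'. if q' = q then 1 else 0"])
      (auto simp: curve_partials_def derivation_partials_def 1 coord)
next
  case (add P Q)
  then obtain a b where a: "curve_partials X UNIV z P a" "derivation_partials X V z P a"
    and b: "curve_partials X UNIV z Q b" "derivation_partials X V z Q b" by auto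
  have 1: "(\<Sum>q\<in>X. (a q + b q) * d q) = (\<Sum>q\<in>X. a q * d q) + (\<Sum>q\<in>X. b q * d q)" for d
    by (simp add: algebra_simps sum.distrib)
  have "curve_partials X UNIV z (\<lambda>z. P z + Q z) (\<lambda>q. a q + b q)"
    using a(1) b(1) unfolding curve_partials_def 1 by (auto intro!: DERIV_add)
  moreover have "derivation_partials X V z (\<lambda>z. P z + Q z) (\<lambda>q. a q + b q)"
    using a(2) b(2) unfolding derivation_partials_def 1
    by (auto simp: tangent_space_add polynomial_regular_funs add.hyps)
  ultimately show ?case by blast
next
  case (mult P Q)
  then obtain a b where a: "curve_partials X UNIV z P a" "derivation_partials X V z P a"
    and b: "curve_partials X UNIV z Q b" "derivation_partials X V z Q b" by auto
  have 1: "(\<Sum>q\<in>X. (a q * Q z + b q * P z) * d q) =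
      (\<Sum>q\<in>X. a q * d q) * Q z + (\<Sum>q\<in>X. b q * d q) * P z" for d
    by (simp add: algebra_simps sum.distrib sum_distrib_left)
  have "curve_partials X UNIV z (\<lambda>z. P z * Q z) (\<lambda>q. a q * Q z + b q * P z)"
    using a(1) b(1) unfolding curve_partials_def 1 by (auto intro!: DERIV_mult)
  moreover have "derivation_partials X V z (\<lambda>z. P z * Q z) (\<lambda>q. a q * Q z + b q * P z)"
    using a(2) b(2) unfolding derivation_partials_def 1
    by (auto simp: tangent_space_mult polynomial_regular_funs mult.hyps z)
  ultimately show ?case by blast
qed

lemma regular_partials:
  assumes f: "f \<in> regular_funs X V" and fin: "finite X" and z: "z \<in> V"
  shows "\<exists>a. curve_partials X V z f a \<and> derivation_partials X V z f a"
proof -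
  obtain P Q where PQ: "P \<in> polynomial_funs X" "Q \<in> polynomial_funs X" "Q z \<noteq> 0"
    and fq: "\<And>w. w \<in> V \<Longrightarrow> Q w \<noteq> 0 \<Longrightarrow> f w = P w / Q w" using f z unfolding regular_funs_def by blast
  obtain a where a: "curve_partials X UNIV z P a" "derivation_partials X V z P a"
    using polynomial_partials[OF PQ(1) fin z] by blast
  obtain b where b: "curve_partials X UNIV z Q b" "derivation_partials X V z Q b"
    using polynomial_partials[OF PQ(2) fin z] by blast
  define c where "c q = (a q * Q z - P z * b q) / (Q z * Q z)" for q
  have 1: "(\<Sum>q\<in>X. c q * d q) =
      ((\<Sum>q\<in>X. a q * d q) * Q z - P z * (\<Sum>q\<in>X. b q * d q)) / (Q z * Q z)" for d
    unfolding c_def sum_distrib_left sum_distrib_right sum_subtractf[symmetric] sum_divide_distrib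
    by (intro sum.cong refl) (simp add: algebra_simps)
  have "curve_partials X V z f c"
    unfolding curve_partials_def
  proof (intro allI impI)
    fix \<gamma> d assume \<gamma>: "\<gamma> 0 = z" "\<forall>\<^sub>F t in nhds 0. \<gamma> t \<in> V"
      and d: "\<forall>q\<in>X. ((\<lambda>t. q (\<gamma> t)) has_field_derivative d q) (at 0)"
    have dP: "((\<lambda>t. P (\<gamma> t)) has_field_derivative (\<Sum>q\<in>X. a q * d q)) (at 0)"
      and dQ: "((\<lambda>t. Q (\<gamma> t)) has_field_derivative (\<Sum>q\<in>X. b q * d q)) (at 0)"
      using a(1) b(1) \<gamma> d unfolding curve_partials_def by auto
    have "((\<lambda>t. Q (\<gamma> t)) \<longlongrightarrow> Q z) (nhds 0)"
      using DERIV_isCont[OF dQ, unfolded isCont_def]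
        tendsto_at_iff_tendsto_nhds[of "\<lambda>t. Q (\<gamma> t)" 0] \<gamma>(1) by simp
    then have "\<forall>\<^sub>F t in nhds 0. Q (\<gamma> t) \<noteq> 0"
      using PQ(3) by (rule tendsto_imp_eventually_ne)
    with \<gamma>(2) have "\<forall>\<^sub>F t in nhds 0. f (\<gamma> t) = P (\<gamma> t) / Q (\<gamma> t)"
      by eventually_elim (simp add: fq)
    moreover have "((\<lambda>t. P (\<gamma> t) / Q (\<gamma> t)) has_field_derivative (\<Sum>q\<in>X. c q * d q)) (at 0)"
      using DERIV_divide[OF dP dQ] PQ(3) \<gamma>(1) unfolding 1 by simp
    ultimately show "((\<lambda>t. f (\<gamma> t)) has_field_derivative (\<Sum>q\<in>X. c q * d q)) (at 0)"
      by (subst DERIV_cong_ev[OF refl _ refl]) auto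
  qed
  moreover have "derivation_partials X V z f c"
    unfolding derivation_partials_def
  proof
    fix D assume D: "D \<in> tangent_space V (regular_funs X V) z"
    note reg = polynomial_regular_funs[of _ X V]
    have QQ: "(\<lambda>w. Q w * Q w) \<in> polynomial_funs X" using PQ by (intro polynomial_funs_intros)
    have fr: "restrict f V \<in> regular_funs X V" using f by (simp add: restrict_regular_funs)
    \<comment> \<open>The equation Q f = P is known only where Q is nonzero. One more factor Q makes
      both sides vanish elsewhere, which gives an identity on all of V to which D can be
      applied.\<close>
    have eq: "(\<lambda>w\<in>V. (Q w * Q w) * f w) = (\<lambda>w\<in>V. Q w * P w)"
    proof (rule restrict_ext)
      fix w assume "w \<in> V"
      then show "Q w * Q w * f w = Q w * P w" by (cases "Q w = 0") (auto simp: fq)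
    qed
    have "Q z * Q z * D (restrict f V) + f z * (2 * Q z * D (restrict Q V))
        = Q z * D (restrict P V) + P z * D (restrict Q V)"
      using arg_cong[OF eq, of D] tangent_space_mult[OF D reg[OF QQ] fr z]
        tangent_space_mult[OF D reg[OF PQ(2)] reg[OF PQ(1)] z]
        tangent_space_mult[OF D reg[OF PQ(2)] reg[OF PQ(2)] z]
      by (simp add: algebra_simps)
    then have "D (restrict f V) = (D (restrict P V) * Q z - P z * D (restrict Q V)) / (Q z * Q z)"
      using PQ(3) fq[OF z] by (simp add: field_simps)
    then show "D (restrict f V) = (\<Sum>q\<in>X. c q * D (restrict q V))"
      using a(2) b(2) D unfolding 1 derivation_partials_def by simp
  qed
  ultimately show ?thesis by blast
qed

subsection \<open>Eigenvector frames\<close>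

text \<open>Dual bases of right eigenvectors \<open>w k\<close> and left eigenvectors
  \<open>u k\<close> of the m-th block. Vectors are plain functions on indices, so they can be
  reused for any matrix with the same block and padded by zeros inside larger ones. Labels k start
  at 1, entries at 0.\<close>

definition eig_frame ::
  "nat \<Rightarrow> complex mat \<Rightarrow> (nat \<Rightarrow> complex) \<Rightarrow> (nat \<Rightarrow> nat \<Rightarrow> complex) \<Rightarrow> (nat \<Rightarrow> nat \<Rightarrow> complex) \<Rightarrow> bool" where
  "eig_frame m x l w u \<longleftrightarrow>
     (\<forall>k\<in>{1..m}. \<forall>i<m. (\<Sum>j<m. x $$ (i, j) * w k j) = l k * w k i) \<and>
     (\<forall>k\<in>{1..m}. \<forall>j<m. (\<Sum>i<m. u k i * x $$ (i, j)) = l k * u k j) \<and>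
     (\<forall>k\<in>{1..m}. \<forall>k'\<in>{1..m}. (\<Sum>i<m. u k i * w k' i) = (if k = k' then 1 else 0)) \<and>
     (\<forall>i<m. \<forall>j<m. (\<Sum>k\<in>{1..m}. w k i * u k j) = (if i = j then 1 else 0))"

lemma eig_frameD:
  assumes "eig_frame m x l w u"
  shows "\<And>k i. k \<in> {1..m} \<Longrightarrow> i < m \<Longrightarrow> (\<Sum>j<m. x $$ (i, j) * w k j) = l k * w k i"
    and "\<And>k j. k \<in> {1..m} \<Longrightarrow> j < m \<Longrightarrow> (\<Sum>i<m. u k i * x $$ (i, j)) = l k * u k j"
    and "\<And>k k'. k \<in> {1..m} \<Longrightarrow> k' \<in> {1..m} \<Longrightarrow> (\<Sum>i<m. u k i * w k' i) = (if k = k' then 1 else 0)"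
    and "\<And>i j. i < m \<Longrightarrow> j < m \<Longrightarrow> (\<Sum>k\<in>{1..m}. w k i * u k j) = (if i = j then 1 else 0)"
  using assms unfolding eig_frame_def by auto

text \<open>Lets one frame serve every matrix with the same m-th block, in particular all points of
  a flow of level m.\<close>

lemma eig_frame_cong:
  assumes "\<And>i j. i < m \<Longrightarrow> j < m \<Longrightarrow> x $$ (i, j) = y $$ (i, j)"
    and "\<And>k. k \<in> {1..m} \<Longrightarrow> l k = l' k"
  shows "eig_frame m x l w u \<longleftrightarrow> eig_frame m y l' w u"
proof -
  have "(\<Sum>j<m. x $$ (i, j) * w k j) = (\<Sum>j<m. y $$ (i, j) * w k j)"
    "(\<Sum>j<m. u k j * x $$ (j, i)) = (\<Sum>j<m. u k j * y $$ (j, i))" if "i < m" for i k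
    using that assms(1) by auto
  then show ?thesis unfolding eig_frame_def using assms(2) by auto
qed

lemma mult_mat_index_sum:
  assumes "A \<in> carrier_mat n m" "B \<in> carrier_mat m p" "i < n" "j < p"
  shows "(A * B) $$ (i, j) = (\<Sum>l<m. A $$ (i, l) * B $$ (l, j))"
  using assms by (auto simp: scalar_prod_def atLeast0LessThan intro!: sum.cong)

lemma block_carrier[simp]: "block m x \<in> carrier_mat m m"
  by (simp add: block_def)

lemma block_dim[simp]: "dim_row (block m x) = m" "dim_col (block m x) = m"
  by (simp_all add: block_def)

lemma block_index[simp]: "i < m \<Longrightarrow> j < m \<Longrightarrow> block m x $$ (i, j) = x $$ (i, j)"
  by (simp add: block_def)

text \<open>If D = P B Q with P and Q inverse to each other, then B Q = Q D and P B = D P: the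
  columns of Q are right eigenvectors and the rows of P left ones.\<close>

lemma similar_imp_eig_frame:
  assumes "similar_mat (eig_diag m \<nu>) (block m x)"
  shows "\<exists>w u. eig_frame m x (\<lambda>k. \<nu> (k, m)) w u"
proof -
  let ?D = "eig_diag m \<nu>" and ?B = "block m x"
  have D: "?D \<in> carrier_mat m m" by (simp add: eig_diag_def)
  from assms obtain P Q where pq: "similar_mat_wit ?D ?B P Q" unfolding similar_mat_def by auto
  have dm: "m = dim_row ?D" using D by simp
  note wit = similar_mat_witD[OF dm pq]
  have PB: "P * ?B = ?D * P"
  proof -
    have "?D * P = P * ?B * (Q * P)"
      unfolding wit(3) by (rule assoc_mult_mat[of _ m m _ m _ m]) (use wit in auto)
    then show ?thesis using wit by simp
  qed
  have BQ: "?B * Q = Q * ?D"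
  proof -
    have "Q * ?D = Q * (P * (?B * Q))"
      unfolding wit(3) using assoc_mult_mat[OF wit(6) wit(5) wit(7)] by simp
    also have "\<dots> = (Q * P) * (?B * Q)"
      by (rule assoc_mult_mat[symmetric, OF wit(7,6) mult_carrier_mat[OF wit(5,7)]])
    finally show ?thesis using mult_carrier_mat[OF wit(5,7)] by (simp add: wit(2))
  qed
  have "eig_frame m x (\<lambda>k. \<nu> (k, m)) (\<lambda>k i. Q $$ (i, k - 1)) (\<lambda>k j. P $$ (k - 1, j))"
    unfolding eig_frame_def
  proof (intro conjI ballI allI impI)
    fix k i assume k: "k \<in> {1..m}" and i: "i < m"
    then have k': "k - 1 < m" "k - 1 + 1 = k" by auto
    show "(\<Sum>j<m. x $$ (i, j) * Q $$ (j, k - 1)) = \<nu> (k, m) * Q $$ (i, k - 1)"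
      using arg_cong[OF BQ, of "\<lambda>A. A $$ (i, k - 1)"] i k' wit(7)
      unfolding mult_mat_index_sum[OF block_carrier wit(7) i k'(1)]
      unfolding eig_diag_def mat_diag_mult_right[OF wit(7)] by simp
    show "(\<Sum>j<m. P $$ (k - 1, j) * x $$ (j, i)) = \<nu> (k, m) * P $$ (k - 1, i)"
      using arg_cong[OF PB, of "\<lambda>A. A $$ (k - 1, i)"] i k' wit(6)
      unfolding mult_mat_index_sum[OF wit(6) block_carrier k'(1) i]
      unfolding eig_diag_def mat_diag_mult_left[OF wit(6)] by simp
  next
    fix k k' assume k: "k \<in> {1..m}" and k': "k' \<in> {1..m}"
    then have *: "k - 1 < m" "k' - 1 < m" "(k - 1 = k' - 1) = (k = k')" by auto
    then show "(\<Sum>i<m. P $$ (k - 1, i) * Q $$ (i, k' - 1)) = (if k = k' then 1 else 0)"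
      using arg_cong[OF wit(1), of "\<lambda>A. A $$ (k - 1, k' - 1)"]
      unfolding mult_mat_index_sum[OF wit(6,7) *(1,2)] by simp
  next
    fix i j assume *: "i < m" "j < m"
    then have "(\<Sum>k<m. Q $$ (i, k) * P $$ (k, j)) = (if i = j then 1 else 0)"
      using arg_cong[OF wit(2), of "\<lambda>A. A $$ (i, j)"]
      unfolding mult_mat_index_sum[OF wit(7,6) *(1,2)] by simp
    then show "(\<Sum>k\<in>{1..m}. Q $$ (i, k - 1) * P $$ (k - 1, j)) = (if i = j then 1 else 0)"
      by (simp add: sum.atLeast1_atMost_eq)
  qed
  then show ?thesis by blast
qed

lemma eig_frame_imp_similar:
  assumes "eig_frame m x (\<lambda>k. \<nu> (k, m)) w u"
  shows "similar_mat (eig_diag m \<nu>) (block m x)"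
proof -
  note fr = eig_frameD[OF assms]
  define P where "P = Matrix.mat m m (\<lambda>(k, j). u (Suc k) j)"
  define Q where "Q = Matrix.mat m m (\<lambda>(i, k). w (Suc k) i)"
  have PQc: "P \<in> carrier_mat m m" "Q \<in> carrier_mat m m" by (auto simp: P_def Q_def)
  have PQ: "P * Q = 1\<^sub>m m"
  proof (rule eq_matI)
    fix i j assume "i < dim_row (1\<^sub>m m)" "j < dim_col (1\<^sub>m m)"
    then have ij: "i < m" "j < m" by auto
    show "(P * Q) $$ (i, j) = 1\<^sub>m m $$ (i, j)"
      unfolding mult_mat_index_sum[OF PQc ij] using fr(3)[of "Suc i" "Suc j"] ij
      by (simp add: P_def Q_def)
  qed (use PQc in auto)
  have QP: "Q * P = 1\<^sub>m m"
    by (rule mat_mult_left_right_inverse[OF PQc PQ])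
  have D: "eig_diag m \<nu> \<in> carrier_mat m m" by (simp add: eig_diag_def)
  have PB: "P * block m x = eig_diag m \<nu> * P"
  proof (rule eq_matI)
    fix k j assume "k < dim_row (eig_diag m \<nu> * P)" "j < dim_col (eig_diag m \<nu> * P)"
    then have kj: "k < m" "j < m" using D PQc by auto
    show "(P * block m x) $$ (k, j) = (eig_diag m \<nu> * P) $$ (k, j)"
      unfolding mult_mat_index_sum[OF PQc(1) block_carrier kj]
      unfolding eig_diag_def mat_diag_mult_left[OF PQc(1)]
      using fr(2)[of "Suc k" j] kj by (simp add: P_def)
  qed (use D PQc in auto)
  have "P * block m x * Q = eig_diag m \<nu> * (P * Q)"
    unfolding PB by (rule assoc_mult_mat[OF D PQc])
  then have "eig_diag m \<nu> = P * block m x * Q" using D by (simp add: PQ)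
  then show ?thesis
    by (intro similar_matI[of _ _ P Q m]) (use D PQc PQ QP in auto)
qed

text \<open>Applying the product of A - l s over s \<in> S to the relation multiplies its k-th term
  by the product of the l k - l s. With S = K - {k} only the k-th term survives.\<close>

lemma eigenvectors_independent:
  fixes A :: "nat \<Rightarrow> nat \<Rightarrow> complex"
  assumes fin: "finite K" and inj: "inj_on l K"
    and ev: "\<And>k i. k \<in> K \<Longrightarrow> i < m \<Longrightarrow> (\<Sum>j<m. A i j * w k j) = l k * w k i"
    and zero: "\<And>i. i < m \<Longrightarrow> (\<Sum>k\<in>K. c k * w k i) = 0"
    and k: "k \<in> K" "i < m" "w k i \<noteq> 0"
  shows "c k = 0"
proof -
  have ind: "\<forall>i<m. (\<Sum>k\<in>K. (\<Prod>s\<in>S. l k - l s) * c k * w k i) = 0" if "finite S" for S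
    using that
  proof induction
    case empty
    then show ?case using zero by simp
  next
    case (insert s S)
    let ?d = "\<lambda>k. (\<Prod>s\<in>S. l k - l s) * c k"
    show ?case
    proof (intro allI impI)
      fix i assume i: "i < m"
      have "(\<Sum>k\<in>K. (\<Prod>s\<in>insert s S. l k - l s) * c k * w k i)
          = (\<Sum>k\<in>K. ?d k * (l k * w k i)) - l s * (\<Sum>k\<in>K. ?d k * w k i)"
        using insert.hyps by (simp add: sum_distrib_left sum_subtractf[symmetric] algebra_simps)
      also have "(\<Sum>k\<in>K. ?d k * (l k * w k i)) = (\<Sum>k\<in>K. \<Sum>j<m. A i j * (?d k * w k j))"
        by (intro sum.cong refl) (simp add: ev[OF _ i, symmetric] sum_distrib_left algebra_simps)
      also have "\<dots> = (\<Sum>j<m. A i j * (\<Sum>k\<in>K. ?d k * w k j))"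
        by (subst sum.swap) (simp add: sum_distrib_left)
      finally show "(\<Sum>k\<in>K. (\<Prod>s\<in>insert s S. l k - l s) * c k * w k i) = 0"
        using insert.IH i by simp
    qed
  qed
  have "(\<Sum>k'\<in>K. (\<Prod>s\<in>K - {k}. l k' - l s) * c k' * w k' i)
      = (\<Sum>k'\<in>K. if k' = k then (\<Prod>s\<in>K - {k}. l k - l s) * c k * w k i else 0)"
    using fin by (intro sum.cong) (auto intro!: prod_zero)
  then have "(\<Prod>s\<in>K - {k}. l k - l s) * c k * w k i = 0"
    using ind[of "K - {k}"] fin k by simp
  moreover have "(\<Prod>s\<in>K - {k}. l k - l s) \<noteq> 0"
    using inj k fin by (auto simp: inj_on_eq_iff)
  ultimately show ?thesis using k by simp
qed

text \<open>Eigenvectors for distinct eigenvalues form an invertible matrix W, and the rows of its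
  inverse are the dual left eigenvectors. Later this reduces membership in the variety to exhibiting
  eigenvalues.\<close>

lemma eigenvalues_imp_eig_frame:
  assumes inj: "inj_on l {1..m}" and ev: "\<And>k. k \<in> {1..m} \<Longrightarrow> eigenvalue (block m x) (l k)"
  shows "\<exists>w u. eig_frame m x l w u"
proof -
  have "\<exists>w. (\<exists>i<m. w i \<noteq> 0) \<and> (\<forall>i<m. (\<Sum>j<m. x $$ (i, j) * w j) = l k * w i)" if k: "k \<in> {1..m}" for k
  proof -
    from ev[OF k] obtain v where v: "eigenvector (block m x) v (l k)" unfolding eigenvalue_def by auto
    then have vc: "v \<in> carrier_vec m" and v0: "v \<noteq> 0\<^sub>v m" and e: "block m x *\<^sub>v v = l k \<cdot>\<^sub>v v"
      unfolding eigenvector_def by (auto simp: block_def)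
    have "\<exists>i<m. v $ i \<noteq> 0" using vc v0 by (auto simp: vec_eq_iff)
    moreover have "(\<Sum>j<m. x $$ (i, j) * v $ j) = l k * v $ i" if i: "i < m" for i
      using arg_cong[OF e, of "\<lambda>v. v $ i"] vc i
      by (simp add: scalar_prod_def atLeast0LessThan block_def)
    ultimately show ?thesis by blast
  qed
  then obtain w where w0: "\<And>k. k \<in> {1..m} \<Longrightarrow> \<exists>i<m. w k i \<noteq> 0"
    and w: "\<And>k i. k \<in> {1..m} \<Longrightarrow> i < m \<Longrightarrow> (\<Sum>j<m. x $$ (i, j) * w k j) = l k * w k i"
    by metis
  define W where "W = Matrix.mat m m (\<lambda>(i, k). w (Suc k) i)"
  have W: "W \<in> carrier_mat m m" by (simp add: W_def)
  have "det W \<noteq> 0"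
  proof
    assume "det W = 0"
    then obtain v where v: "v \<in> carrier_vec m" "v \<noteq> 0\<^sub>v m" "W *\<^sub>v v = 0\<^sub>v m"
      unfolding det_0_iff_vec_prod_zero[OF W] by auto
    have zero: "(\<Sum>k\<in>{1..m}. v $ (k - 1) * w k i) = 0" if i: "i < m" for i
      using arg_cong[OF v(3), of "\<lambda>v. v $ i"] v(1) i W
      by (simp add: scalar_prod_def atLeast0LessThan W_def sum.atLeast1_atMost_eq mult.commute)
    have "v $ (k - 1) = 0" if k: "k \<in> {1..m}" for k
    proof -
      obtain i where "i < m" "w k i \<noteq> 0" using w0[OF k] by auto
      then show ?thesis
        using eigenvectors_independent[of "{1..m}" l m "\<lambda>i j. x $$ (i, j)" w "\<lambda>k. v $ (k - 1)" k i] inj w zero k by auto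
    qed
    then have "v $ k = 0" if "k < m" for k using that by (metis Suc_leI atLeastAtMost_iff diff_Suc_1 le_add1 plus_1_eq_Suc)
    with v show False by (auto simp: vec_eq_iff)
  qed
  then have "W \<in> Units (ring_mat TYPE(complex) m undefined)"
    by (rule det_non_zero_imp_unit[OF W])
  then obtain U where U: "U \<in> carrier_mat m m" "U * W = 1\<^sub>m m" "W * U = 1\<^sub>m m"
    unfolding Units_def by (auto simp: ring_mat_simps)
  have BW: "block m x * W = W * mat_diag m (\<lambda>k. l (Suc k))"
  proof (rule eq_matI)
    fix i k assume "i < dim_row (W * mat_diag m (\<lambda>k. l (Suc k)))" "k < dim_col (W * mat_diag m (\<lambda>k. l (Suc k)))"
    then have ik: "i < m" "k < m" by (auto simp: W_def mat_diag_def)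
    show "(block m x * W) $$ (i, k) = (W * mat_diag m (\<lambda>k. l (Suc k))) $$ (i, k)"
      unfolding mult_mat_index_sum[OF block_carrier W ik]
      unfolding mat_diag_mult_right[OF W]
      using w[of "Suc k" i] ik by (simp add: W_def mult.commute)
  qed (auto simp: W_def mat_diag_def block_def)
  have UB: "U * block m x = mat_diag m (\<lambda>k. l (Suc k)) * U"
  proof -
    let ?D = "mat_diag m (\<lambda>k. l (Suc k))"
    have "U * block m x = U * (block m x * (W * U))" by (simp add: U right_mult_one_mat[OF block_carrier])
    also have "block m x * (W * U) = block m x * W * U"
      by (rule assoc_mult_mat[symmetric, OF block_carrier W U(1)])
    also have "\<dots> = W * (?D * U)"
      unfolding BW by (rule assoc_mult_mat[OF W mat_diag_dim U(1)])
    also have "U * \<dots> = U * W * (?D * U)"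
      by (rule assoc_mult_mat[symmetric, of _ m m _ m _ m]) (use U(1) W mult_carrier_mat[OF mat_diag_dim U(1)] in auto)
    also have "\<dots> = ?D * U" unfolding U(2) by (rule left_mult_one_mat[of _ m m]) (use U(1) mult_carrier_mat[OF mat_diag_dim U(1)] in auto)
    finally show ?thesis .
  qed
  have "eig_frame m x l w (\<lambda>k j. U $$ (k - 1, j))"
    unfolding eig_frame_def
  proof (intro conjI ballI allI impI)
    fix k i assume k: "k \<in> {1..m}" and i: "i < m"
    then have k': "k - 1 < m" "Suc (k - 1) = k" by auto
    show "(\<Sum>j<m. x $$ (i, j) * w k j) = l k * w k i" by (rule w[OF k i])
    show "(\<Sum>j<m. U $$ (k - 1, j) * x $$ (j, i)) = l k * U $$ (k - 1, i)"
      using arg_cong[OF UB, of "\<lambda>A. A $$ (k - 1, i)"] i k' U(1)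
      unfolding mult_mat_index_sum[OF U(1) block_carrier k'(1) i]
      unfolding mat_diag_mult_left[OF U(1)] by simp
  next
    fix k k' assume k: "k \<in> {1..m}" and k': "k' \<in> {1..m}"
    then have *: "k - 1 < m" "k' - 1 < m" "(k - 1 = k' - 1) = (k = k')" "Suc (k' - 1) = k'" by auto
    show "(\<Sum>i<m. U $$ (k - 1, i) * w k' i) = (if k = k' then 1 else 0)"
      using arg_cong[OF U(2), of "\<lambda>A. A $$ (k - 1, k' - 1)"]
      unfolding mult_mat_index_sum[OF U(1) W *(1,2)] using * by (simp add: W_def)
  next
    fix i j assume *: "i < m" "j < m"
    have "(\<Sum>k<m. w (Suc k) i * U $$ (k, j)) = (if i = j then 1 else 0)"
      using arg_cong[OF U(3), of "\<lambda>A. A $$ (i, j)"] *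
      unfolding mult_mat_index_sum[OF W U(1) *(1,2)] by (simp add: W_def)
    then show "(\<Sum>k\<in>{1..m}. w k i * U $$ (k - 1, j)) = (if i = j then 1 else 0)"
      by (simp add: sum.atLeast1_atMost_eq)
  qed
  then show ?thesis by blast
qed

lemma eig_frame_char_poly:
  assumes "eig_frame m x l w u"
  shows "char_poly (block m x) = (\<Prod>k\<in>{1..m}. [:- l k, 1:])"
proof -
  let ?D = "mat_diag m (\<lambda>k. l (k + 1))"
  have "similar_mat ?D (block m x)"
    using eig_frame_imp_similar[of m x "\<lambda>(k, _). l k" w u] assms by (simp add: eig_diag_def)
  then have "char_poly (block m x) = char_poly ?D" by (simp add: char_poly_similar)
  also have "\<dots> = (\<Prod>a\<leftarrow>diag_mat ?D. [:- a, 1:])"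
    by (rule char_poly_upper_triangular[of _ m]) (auto simp: upper_triangular_def mat_diag_def)
  also have "diag_mat ?D = map (\<lambda>k. l (k + 1)) [0..<m]"
    by (auto simp: diag_mat_def mat_diag_def)
  also have "(\<Prod>a\<leftarrow>map (\<lambda>k. l (k + 1)) [0..<m]. [:- a, 1:]) = (\<Prod>k<m. [:- l (Suc k), 1:])"
    by (simp add: prod.distinct_set_conv_list[symmetric] comp_def atLeast0LessThan)
  also have "\<dots> = (\<Prod>k\<in>{1..m}. [:- l k, 1:])" by (simp add: prod.atLeast1_atMost_eq)
  finally show ?thesis .
qed

lemma eig_frame_spectrum:
  assumes "eig_frame m x l w u"
  shows "spectrum (block m x) = l ` {1..m}"
  unfolding spectrum_root_char_poly[OF block_carrier] eig_frame_char_poly[OF assms]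
  by (auto simp: poly_prod)

section \<open>Points of the variety, and consequences of disjoint consecutive spectra\<close>

lemma eig_index_mem: "(k, m) \<in> eig_index n \<longleftrightarrow> m \<in> {1..n} \<and> k \<in> {1..m}"
  by (auto simp: eig_index_def)

text \<open>The spectral conditions on x follow from those on \<nu>, because a frame identifies the
  spectrum of x_m with the set of the \<nu>_{k m}. From here on membership is handled through frames
  alone.\<close>

lemma M_Omega_e_iff:
  "(\<nu>, x) \<in> M_Omega_e n \<longleftrightarrow> \<nu> \<in> e_Omega n \<and> x \<in> carrier_mat n n \<and>
     (\<forall>m\<in>{1..n}. \<exists>w u. eig_frame m x (\<lambda>k. \<nu> (k, m)) w u)"
proof
  assume "(\<nu>, x) \<in> M_Omega_e n"
  then show "\<nu> \<in> e_Omega n \<and> x \<in> carrier_mat n n \<and>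
     (\<forall>m\<in>{1..n}. \<exists>w u. eig_frame m x (\<lambda>k. \<nu> (k, m)) w u)"
    unfolding M_Omega_e_def M_Omega_def by (auto intro: similar_imp_eig_frame)
next
  assume *: "\<nu> \<in> e_Omega n \<and> x \<in> carrier_mat n n \<and>
     (\<forall>m\<in>{1..n}. \<exists>w u. eig_frame m x (\<lambda>k. \<nu> (k, m)) w u)"
  then have sim: "similar_mat (eig_diag m \<nu>) (block m x)"
    and spec: "spectrum (block m x) = (\<lambda>k. \<nu> (k, m)) ` {1..m}" if "m \<in> {1..n}" for m
    using that by (blast intro: eig_frame_imp_similar, blast dest: eig_frame_spectrum)
  have "x \<in> M_Omega n"
    unfolding M_Omega_def
  proof (intro CollectI conjI ballI)
    show "x \<in> carrier_mat n n" using * by simp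
    show "card (spectrum (block m x)) = m" if "m \<in> {1..n}" for m
      using * that spec[OF that] by (auto simp: e_Omega_def card_image)
    show "spectrum (block m x) \<inter> spectrum (block (m + 1) x) = {}" if "m \<in> {1..<n}" for m
    proof -
      have "m \<in> {1..n}" "m + 1 \<in> {1..n}" using that by auto
      then show ?thesis using * that spec[of m] spec[of "m + 1"] by (auto simp: e_Omega_def)
    qed
  qed
  then show "(\<nu>, x) \<in> M_Omega_e n" using * sim by (auto simp: M_Omega_e_def)
qed

text \<open>Evaluating v x w_k in two ways gives c (v w_k) = l_k (v w_k), so v annihilates the whole
  basis of right eigenvectors.\<close>

lemma eig_frame_left_eigenvector:
  assumes fr: "eig_frame m x l w u" and ev: "\<And>j. j < m \<Longrightarrow> (\<Sum>i<m. v i * x $$ (i, j)) = c * v j"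
    and c: "c \<notin> l ` {1..m}" and j: "j < m"
  shows "v j = 0"
proof -
  note fr = eig_frameD[OF fr]
  have 0: "(\<Sum>i<m. v i * w k i) = 0" if k: "k \<in> {1..m}" for k
  proof -
    have "c * (\<Sum>j<m. v j * w k j) = (\<Sum>j<m. (\<Sum>i<m. v i * x $$ (i, j)) * w k j)"
      unfolding sum_distrib_left by (intro sum.cong) (auto simp: ev algebra_simps)
    also have "\<dots> = (\<Sum>i<m. v i * (\<Sum>j<m. x $$ (i, j) * w k j))"
      unfolding sum_distrib_left sum_distrib_right by (subst sum.swap) (simp add: algebra_simps)
    also have "\<dots> = l k * (\<Sum>j<m. v j * w k j)"
      unfolding sum_distrib_left[of "l k"] by (intro sum.cong) (simp_all add: fr(1)[OF k] mult.left_commute)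
    finally show ?thesis using c k by auto
  qed
  have "v j = (\<Sum>i<m. v i * (\<Sum>k\<in>{1..m}. w k i * u k j))"
  proof -
    have "(\<Sum>i<m. v i * (\<Sum>k\<in>{1..m}. w k i * u k j)) = (\<Sum>i<m. if i = j then v i else 0)"
      using fr(4) j by (intro sum.cong) auto
    then show ?thesis using j by simp
  qed
  also have "\<dots> = (\<Sum>k\<in>{1..m}. (\<Sum>i<m. v i * w k i) * u k j)"
    unfolding sum_distrib_left sum_distrib_right by (subst sum.swap) (simp add: algebra_simps)
  finally show ?thesis using 0 by simp
qed

lemma eig_frame_nonzero:
  assumes "eig_frame m x l w u" "k \<in> {1..m}"
  shows "\<exists>i<m. u k i \<noteq> 0"
proof (rule ccontr)
  assume "\<not> ?thesis"
  then have "(\<Sum>i<m. u k i * w k i) = 0" by auto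
  then show False using eig_frameD(3)[OF assms(1,2,2)] by simp
qed

text \<open>If this component were 0, the row \<open>u k\<close> extended by a zero would be a left
  eigenvector of x_{m+1} for \<open>l k\<close>, which is not an eigenvalue there.\<close>

lemma last_column_nonzero:
  assumes fr: "eig_frame m x l w u" and fr': "eig_frame (Suc m) x l' w' u'"
    and disj: "l ` {1..m} \<inter> l' ` {1..Suc m} = {}" and k: "k \<in> {1..m}"
  shows "(\<Sum>i<m. u k i * x $$ (i, m)) \<noteq> 0"
proof
  assume 0: "(\<Sum>i<m. u k i * x $$ (i, m)) = 0"
  define v where "v i = (if i < m then u k i else 0)" for i
  have ev: "(\<Sum>i<Suc m. v i * x $$ (i, j)) = l k * v j" if "j < Suc m" for j
    using that 0 eig_frameD(2)[OF fr k] by (cases "j = m") (auto simp: v_def)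
  have "l k \<notin> l' ` {1..Suc m}" using disj k by blast
  from eig_frame_left_eigenvector[OF fr' ev this] have "v j = 0" if "j < Suc m" for j using that by auto
  then have "u k j = 0" if "j < m" for j using that by (metis v_def less_SucI)
  then show False using eig_frame_nonzero[OF fr k] by auto
qed

text \<open>Conversely, a left eigenvector of x_{m+1} with last entry 0 would restrict to one of x_m
  for the same eigenvalue.\<close>

lemma last_entry_nonzero:
  assumes fr: "eig_frame m x l w u" and fr': "eig_frame (Suc m) x l' w' u'"
    and disj: "l ` {1..m} \<inter> l' ` {1..Suc m} = {}" and k: "k \<in> {1..Suc m}"
  shows "u' k m \<noteq> 0"
proof
  assume 0: "u' k m = 0"
  have ev: "(\<Sum>i<m. u' k i * x $$ (i, j)) = l' k * u' k j" if "j < m" for j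
    using eig_frameD(2)[OF fr' k, of j] that 0 by simp
  have "l' k \<notin> l ` {1..m}" using disj k by blast
  from eig_frame_left_eigenvector[OF fr ev this] have "u' k j = 0" if "j < m" for j using that by auto
  with 0 have "u' k j = 0" if "j < Suc m" for j using that by (cases "j = m") auto
  then show False using eig_frame_nonzero[OF fr' k] by auto
qed

subsection \<open>The directions \<open>[x, w u]\<close>\<close>

text \<open>The number u X w, which \<open>eigenvalue_derivative\<close> identifies as the
  derivative of the eigenvalue in the direction X.\<close>

definition eig_pairing :: "nat \<Rightarrow> (nat \<Rightarrow> complex) \<Rightarrow> (nat \<Rightarrow> complex) \<Rightarrow> (nat \<Rightarrow> nat \<Rightarrow> complex) \<Rightarrow> complex" where
  "eig_pairing m u w X = (\<Sum>i<m. \<Sum>j<m. u i * X i j * w j)"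

text \<open>The entries of \<open>[x, w u]\<close>, where the column \<open>w\<close> and the row \<open>u\<close> of length \<open>m\<close> are padded by zeros.\<close>

definition eig_dir :: "nat \<Rightarrow> complex mat \<Rightarrow> (nat \<Rightarrow> complex) \<Rightarrow> (nat \<Rightarrow> complex) \<Rightarrow> nat \<Rightarrow> nat \<Rightarrow> complex" where
  "eig_dir m x w u i j = (\<Sum>l<m. x $$ (i, l) * w l) * (if j < m then u j else 0)
     - (if i < m then w i else 0) * (\<Sum>l<m. u l * x $$ (l, j))"

lemma eig_pairing_diff:
  "eig_pairing m u w (\<lambda>i j. X i j - Y i j) = eig_pairing m u w X - eig_pairing m u w Y"
  by (simp add: eig_pairing_def algebra_simps sum_subtractf)

lemma eig_pairing_sum:
  "eig_pairing m u w (\<lambda>i j. \<Sum>a\<in>A. X a i j) = (\<Sum>a\<in>A. eig_pairing m u w (X a))"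
  by (induction A rule: infinite_finite_induct)
    (auto simp: eig_pairing_def algebra_simps sum.distrib)

lemma eig_pairing_scale:
  "eig_pairing m u w (\<lambda>i j. c * X i j) = c * eig_pairing m u w X"
  by (simp add: eig_pairing_def algebra_simps sum_distrib_left)

lemma eig_pairing_cong:
  "(\<And>i j. i < m \<Longrightarrow> j < m \<Longrightarrow> X i j = Y i j) \<Longrightarrow> eig_pairing m u w X = eig_pairing m u w Y"
  by (simp add: eig_pairing_def)

lemma eig_frame_expand_column:
  assumes "eig_frame m x l w u" "i < m"
  shows "(\<Sum>k\<in>{1..m}. w k i * (\<Sum>j<m. u k j * b j)) = b i"
proof -
  have "(\<Sum>k\<in>{1..m}. w k i * (\<Sum>j<m. u k j * b j)) = (\<Sum>j<m. (\<Sum>k\<in>{1..m}. w k i * u k j) * b j)"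
    unfolding sum_distrib_left sum_distrib_right by (subst sum.swap) (simp add: algebra_simps)
  also have "\<dots> = (\<Sum>j<m. if i = j then b j else 0)"
    using eig_frameD(4)[OF assms(1)] assms(2) by (intro sum.cong) auto
  finally show ?thesis using assms(2) by simp
qed

lemma eig_frame_expand_row:
  assumes "eig_frame m x l w u" "j < m"
  shows "(\<Sum>k\<in>{1..m}. (\<Sum>i<m. r i * w k i) * u k j) = r j"
proof -
  have "(\<Sum>k\<in>{1..m}. (\<Sum>i<m. r i * w k i) * u k j) = (\<Sum>i<m. r i * (\<Sum>k\<in>{1..m}. w k i * u k j))"
    unfolding sum_distrib_left sum_distrib_right by (subst sum.swap) (simp add: algebra_simps)
  also have "\<dots> = (\<Sum>i<m. if i = j then r i else 0)"
    using eig_frameD(4)[OF assms(1)] assms(2) by (intro sum.cong) auto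
  finally show ?thesis using assms(2) by simp
qed

lemma eig_dir_block:
  assumes "eig_frame m x l w u" "k \<in> {1..m}" "i < m" "j < m"
  shows "eig_dir m x (w k) (u k) i j = 0"
  using assms eig_frameD(1,2)[OF assms(1,2)] by (simp add: eig_dir_def)

lemma eig_dir_column:
  "i < m \<Longrightarrow> m \<le> j \<Longrightarrow> eig_dir m x w u i j = - w i * (\<Sum>l<m. u l * x $$ (l, j))"
  by (simp add: eig_dir_def)

text \<open>For m' \<le> m the m'-th block of the direction is zero. Otherwise the padded w and u
  live in coordinates where u' x = l' u' and x w' = l' w' hold, and both terms of u' x w u w' - u' w
  u x w' equal l' (u' w) (u w').\<close>

lemma eig_pairing_eig_dir:
  assumes fr: "eig_frame m x l w u" "k \<in> {1..m}" and fr': "eig_frame m' x l' w' u'" "k' \<in> {1..m'}"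
  shows "eig_pairing m' (u' k') (w' k') (eig_dir m x (w k) (u k)) = 0"
proof (cases "m' \<le> m")
  case True
  then show ?thesis
    unfolding eig_pairing_def using eig_dir_block[OF fr] by simp
next
  case False
  then have mm: "m \<le> m'" by simp
  define a where "a = (\<Sum>i<m. u' k' i * w k i)"
  define b where "b = (\<Sum>j<m. u k j * w' k' j)"
  have pad: "(\<Sum>i<m'. f i * (if i < m then g i else 0)) = (\<Sum>i<m. f i * g i)" for f g :: "nat \<Rightarrow> complex"
    using mm by (intro sum.mono_neutral_cong_right) auto
  have pad': "(\<Sum>i<m'. (if i < m then g i else 0) * f i) = (\<Sum>i<m. g i * f i)" for f g :: "nat \<Rightarrow> complex"
    using mm by (intro sum.mono_neutral_cong_right) auto
  have 1: "(\<Sum>i<m'. u' k' i * (\<Sum>l<m. x $$ (i, l) * w k l)) = l' k' * a"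
  proof -
    have "(\<Sum>i<m'. u' k' i * (\<Sum>l<m. x $$ (i, l) * w k l)) = (\<Sum>l<m. (\<Sum>i<m'. u' k' i * x $$ (i, l)) * w k l)"
      unfolding sum_distrib_left sum_distrib_right by (subst sum.swap) (simp add: algebra_simps)
    also have "\<dots> = (\<Sum>l<m. l' k' * (u' k' l * w k l))"
      using eig_frameD(2)[OF fr'] mm by (intro sum.cong) auto
    finally show ?thesis by (simp add: a_def sum_distrib_left)
  qed
  have 2: "(\<Sum>j<m'. (\<Sum>l<m. u k l * x $$ (l, j)) * w' k' j) = l' k' * b"
  proof -
    have "(\<Sum>j<m'. (\<Sum>l<m. u k l * x $$ (l, j)) * w' k' j) = (\<Sum>l<m. u k l * (\<Sum>j<m'. x $$ (l, j) * w' k' j))"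
      unfolding sum_distrib_left sum_distrib_right by (subst sum.swap) (simp add: algebra_simps)
    also have "\<dots> = (\<Sum>l<m. l' k' * (u k l * w' k' l))"
      using eig_frameD(1)[OF fr'] mm by (intro sum.cong) auto
    finally show ?thesis by (simp add: b_def sum_distrib_left)
  qed
  have "eig_pairing m' (u' k') (w' k') (eig_dir m x (w k) (u k))
     = (\<Sum>i<m'. u' k' i * (\<Sum>l<m. x $$ (i, l) * w k l)) * (\<Sum>j<m'. (if j < m then u k j else 0) * w' k' j)
       - (\<Sum>i<m'. u' k' i * (if i < m then w k i else 0)) * (\<Sum>j<m'. (\<Sum>l<m. u k l * x $$ (l, j)) * w' k' j)"
    unfolding eig_pairing_def eig_dir_def sum_product sum_subtractf[symmetric]
    by (intro sum.cong refl) (simp only: algebra_simps)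
  also have "\<dots> = 0" unfolding 1 2 pad pad' a_def[symmetric] b_def[symmetric] by simp
  finally show ?thesis .
qed

text \<open>The linear algebra at one point, separated from the variety; \<open>L m k\<close> stands
  for \<nu>_{k m}.\<close>

locale eig_flag =
  fixes n :: nat and x :: "complex mat" and L :: "nat \<Rightarrow> nat \<Rightarrow> complex"
    and w u :: "nat \<Rightarrow> nat \<Rightarrow> nat \<Rightarrow> complex"
  assumes frame: "m \<in> {1..n} \<Longrightarrow> eig_frame m x (L m) (w m) (u m)"
    and disj: "m \<in> {1..<n} \<Longrightarrow> L m ` {1..m} \<inter> L (Suc m) ` {1..Suc m} = {}"
begin

definition dir :: "nat \<Rightarrow> nat \<Rightarrow> nat \<Rightarrow> nat \<Rightarrow> complex" where
  "dir m k = eig_dir m x (w m k) (u m k)"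

lemma dir_block:
  assumes "m \<in> {1..n}" "k \<in> {1..m}" "i < m" "j < m" shows "dir m k i j = 0"
  unfolding dir_def using eig_dir_block[OF frame[OF assms(1)] assms(2-4)] .

lemma dir_pairing:
  assumes "m \<in> {1..n}" "k \<in> {1..m}" "m' \<in> {1..n}" "k' \<in> {1..m'}"
  shows "eig_pairing m' (u m' k') (w m' k') (dir m k) = 0"
  unfolding dir_def
  using eig_pairing_eig_dir[OF frame[OF assms(1)] assms(2) frame[OF assms(3)] assms(4)] .

lemma dir_column:
  "i < m \<Longrightarrow> dir m k i m = - w m k i * (\<Sum>l<m. u m k l * x $$ (l, m))"
  unfolding dir_def by (rule eig_dir_column) auto

text \<open>A direction of level m vanishes on the m-th block, so only levels below N are visible in
  the N-th one. Passing to the block one size smaller hides the top level and yields the lower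
  coefficients by induction. The last column then carries a combination of the independent
  \<open>w N k\<close> with nonzero weights.\<close>

lemma dir_independent:
  assumes "N \<le> n"
    and "\<And>i j. i < N \<Longrightarrow> j < N \<Longrightarrow> (\<Sum>m\<in>{1..<N}. \<Sum>k\<in>{1..m}. c k m * dir m k i j) = 0"
    and "m \<in> {1..<N}" "k \<in> {1..m}"
  shows "c k m = 0"
  using assms
proof (induction N arbitrary: m k)
  case 0
  then show ?case by simp
next
  case (Suc N)
  have N1: "N \<ge> 1" using Suc.prems(3) by auto
  then have N: "N \<in> {1..n}" using Suc.prems(1) by simp
  have split: "(\<Sum>m\<in>{1..<Suc N}. \<Sum>k\<in>{1..m}. c k m * dir m k i j) =
      (\<Sum>m\<in>{1..<N}. \<Sum>k\<in>{1..m}. c k m * dir m k i j) + (\<Sum>k\<in>{1..N}. c k N * dir N k i j)" for i j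
    using N1 by simp
  have low: "c k m = 0" if "m \<in> {1..<N}" "k \<in> {1..m}" for m k
  proof (rule Suc.IH[OF _ _ that])
    fix i j assume ij: "i < N" "j < N"
    then have "(\<Sum>k\<in>{1..N}. c k N * dir N k i j) = 0"
      by (intro sum.neutral ballI) (simp only: dir_block[OF N] mult_zero_right)
    then show "(\<Sum>m\<in>{1..<N}. \<Sum>k\<in>{1..m}. c k m * dir m k i j) = 0"
      using Suc.prems(2)[of i j] ij unfolding split by simp
  qed (use Suc.prems in simp)
  have "c k' N = 0" if k': "k' \<in> {1..N}" for k'
  proof -
    let ?b = "\<lambda>k. \<Sum>l<N. u N k l * x $$ (l, N)"
    have col: "(\<Sum>k\<in>{1..N}. w N k i * (c k N * ?b k)) = 0" if "i < N" for i
    proof -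
      have "(\<Sum>m\<in>{1..<N}. \<Sum>k\<in>{1..m}. c k m * dir m k i N) = 0"
        by (intro sum.neutral ballI) (simp only: low mult_zero_left)
      then have "(\<Sum>k\<in>{1..N}. c k N * dir N k i N) = 0"
        using Suc.prems(2)[of i N] that unfolding split by simp
      then show ?thesis unfolding dir_column[OF that]
        by (simp add: sum_negf algebra_simps)
    qed
    \<comment> \<open>Pairing the column with the dual vector \<open>u N k'\<close> isolates the
      k'-th term.\<close>
    have "(\<Sum>i<N. u N k' i * (\<Sum>k\<in>{1..N}. w N k i * (c k N * ?b k))) =
        (\<Sum>k\<in>{1..N}. (\<Sum>i<N. u N k' i * w N k i) * (c k N * ?b k))"
      unfolding sum_distrib_left[of "u N k' _"] sum_distrib_right[of _ _ "c _ N * ?b _"]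
      by (subst sum.swap) (simp only: mult.assoc)
    also have "\<dots> = (\<Sum>k\<in>{1..N}. if k = k' then c k N * ?b k else 0)"
      using eig_frameD(3)[OF frame[OF N] k'] by (intro sum.cong) auto
    also have "\<dots> = c k' N * ?b k'" using k' by simp
    finally have "c k' N * ?b k' = 0" using col by simp
    moreover have "?b k' \<noteq> 0"
      using last_column_nonzero[OF frame[OF N] frame disj k'] Suc.prems(1) N1 by simp
    ultimately show ?thesis by simp
  qed
  then show ?case using low[of m k] Suc.prems(3,4) by (cases "m = N") auto
qed

text \<open>X is cleared in three stages: the N-th block by induction, the rest of the last column
  by the directions of level N, and the last row because the remainder still pairs to zero with the
  frame of level N + 1.\<close>

lemma dir_span:
  assumes "N \<le> n"
    and "\<And>m k. m \<in> {1..N} \<Longrightarrow> k \<in> {1..m} \<Longrightarrow> eig_pairing m (u m k) (w m k) X = 0"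
  shows "\<exists>c. \<forall>i<N. \<forall>j<N. X i j = (\<Sum>m\<in>{1..<N}. \<Sum>k\<in>{1..m}. c k m * dir m k i j)"
  using assms
proof (induction N)
  case 0
  then show ?case by simp
next
  case (Suc N)
  then obtain c where c: "\<And>i j. i < N \<Longrightarrow> j < N \<Longrightarrow> X i j = (\<Sum>m\<in>{1..<N}. \<Sum>k\<in>{1..m}. c k m * dir m k i j)"
    by force
  define Y where "Y i j = X i j - (\<Sum>m\<in>{1..<N}. \<Sum>k\<in>{1..m}. c k m * dir m k i j)" for i j
  have Y0: "Y i j = 0" if "i < N" "j < N" for i j using c[OF that] by (simp add: Y_def)
  let ?b = "\<lambda>k. \<Sum>l<N. u N k l * x $$ (l, N)"
  \<comment> \<open>In the last column \<open>dir N k\<close> is - \<open>?b k\<close> times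
    \<open>w N k\<close>. The component of Y along \<open>w N k\<close>, obtained by applying
    \<open>u N k\<close>, is therefore divided by - \<open>?b k\<close>.\<close>
  define d where "d k = - (\<Sum>i<N. u N k i * Y i N) / ?b k" for k
  define Z where "Z i j = Y i j - (\<Sum>k\<in>{1..N}. d k * dir N k i j)" for i j
  have frS: "eig_frame (Suc N) x (L (Suc N)) (w (Suc N)) (u (Suc N))"
    using frame Suc.prems(1) by simp
  have Z0: "Z i j = 0" if i: "i < N" and j: "j < Suc N" for i j
  proof (cases "j = N")
    case False
    then have j: "j < N" using j by simp
    have N: "N \<in> {1..n}" using i Suc.prems(1) by simp
    show ?thesis unfolding Z_def Y0[OF i j]
      by (simp add: dir_block[OF N _ i j])
  next
    case True
    have N: "N \<in> {1..n}" using i Suc.prems(1) by simp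
    have b: "?b k \<noteq> 0" if "k \<in> {1..N}" for k
      using last_column_nonzero[OF frame[OF N] frS disj that] Suc.prems(1) N by simp
    have "(\<Sum>k\<in>{1..N}. d k * dir N k i N) = (\<Sum>k\<in>{1..N}. w N k i * (\<Sum>j<N. u N k j * Y j N))"
      unfolding dir_column[OF i] by (intro sum.cong refl) (use b in \<open>simp add: d_def\<close>)
    also have "\<dots> = Y i N" by (rule eig_frame_expand_column[OF frame[OF N] i])
    finally show ?thesis by (simp add: Z_def True)
  qed
  have Zp: "eig_pairing (Suc N) (u (Suc N) k) (w (Suc N) k) Z = 0" if k: "k \<in> {1..Suc N}" for k
  proof -
    have S: "Suc N \<in> {1..n}" using Suc.prems(1) by simp
    have "eig_pairing (Suc N) (u (Suc N) k) (w (Suc N) k) (dir m k') = 0"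
      if "m \<in> {1..N}" "k' \<in> {1..m}" for m k'
      by (rule dir_pairing) (use that Suc.prems(1) k in auto)
    moreover have "Z = (\<lambda>i j. X i j - (\<Sum>m\<in>{1..<N}. \<Sum>k\<in>{1..m}. c k m * dir m k i j)
        - (\<Sum>k\<in>{1..N}. d k * dir N k i j))"
      by (intro ext) (simp add: Z_def Y_def)
    ultimately show ?thesis
      using Suc.prems(2)[of "Suc N" k] k
      by (cases "N = 0") (simp_all add: eig_pairing_diff eig_pairing_sum eig_pairing_scale)
  qed
  have row: "(\<Sum>j<Suc N. Z N j * w (Suc N) k j) = 0" if k: "k \<in> {1..Suc N}" for k
  proof -
    \<comment> \<open>Z lives in row N only, so the pairing factors into the last entry of the left
      eigenvector and the product of that row with the right one.\<close>
    have "u (Suc N) k N * (\<Sum>j<Suc N. Z N j * w (Suc N) k j) = eig_pairing (Suc N) (u (Suc N) k) (w (Suc N) k) Z"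
      unfolding eig_pairing_def sum.lessThan_Suc[of _ N]
      by (simp add: Z0 sum_distrib_left algebra_simps)
    then have "u (Suc N) k N * (\<Sum>j<Suc N. Z N j * w (Suc N) k j) = 0" using Zp[OF k] by simp
    moreover have "u (Suc N) k N \<noteq> 0"
    proof (cases "N = 0")
      case True
      then show ?thesis using eig_frame_nonzero[OF frS k] by simp
    next
      case False
      then show ?thesis
        using last_entry_nonzero[OF frame frS disj k] Suc.prems(1) by simp
    qed
    ultimately show ?thesis by simp
  qed
  have ZN: "Z N j = 0" if "j < Suc N" for j
  proof -
    have "Z N j = (\<Sum>k\<in>{1..Suc N}. (\<Sum>i<Suc N. Z N i * w (Suc N) k i) * u (Suc N) k j)"
      by (rule eig_frame_expand_row[OF frS that, symmetric])
    also have "\<dots> = 0" by (intro sum.neutral ballI) (simp only: row mult_zero_left)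
    finally show ?thesis .
  qed
  have "X i j = (\<Sum>m\<in>{1..<Suc N}. \<Sum>k\<in>{1..m}. (if m = N then d k else c k m) * dir m k i j)"
    if ij: "i < Suc N" "j < Suc N" for i j
  proof -
    have "Z i j = 0" using ij ZN Z0 by (cases "i = N") auto
    then have "X i j = (\<Sum>m\<in>{1..<N}. \<Sum>k\<in>{1..m}. c k m * dir m k i j) + (\<Sum>k\<in>{1..N}. d k * dir N k i j)"
      by (simp add: Z_def Y_def diff_eq_eq add.commute)
    also have "(\<Sum>m\<in>{1..<N}. \<Sum>k\<in>{1..m}. c k m * dir m k i j) =
        (\<Sum>m\<in>{1..<N}. \<Sum>k\<in>{1..m}. (if m = N then d k else c k m) * dir m k i j)"
      by (intro sum.cong) auto
    finally show ?thesis by (cases "N = 0") auto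
  qed
  then show ?case by (intro exI[of _ "\<lambda>k m. if m = N then d k else c k m"]) blast
qed

end

subsection \<open>Local sections of \<open>\<pi>\<^sub>n\<close>\<close>

lemma poly_char_poly_det:
  "poly (char_poly (block m y)) c = det (Matrix.mat m m (\<lambda>(i, j). (if i = j then c else 0) - y $$ (i, j)))"
  unfolding char_poly_matrix[OF block_carrier]
  by (rule arg_cong[of _ _ det], rule eq_matI) (auto simp: char_matrix_def block_def)

text \<open>The modulus at c is the product of the distances from c to the roots; if all of these
  were at least r, it would be at least r to the degree. This replaces continuity of roots by a
  condition that is open in the matrix.\<close>

lemma monic_factorized_root_near:
  fixes as :: "complex list"
  assumes "p = (\<Prod>a\<leftarrow>as. [:- a, 1:])" and "cmod (poly p c) < r ^ length as" and "r > 0"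
  shows "\<exists>a. poly p a = 0 \<and> cmod (c - a) < r"
proof -
  have "\<exists>a\<in>set as. cmod (c - a) < r"
  proof (rule ccontr)
    assume *: "\<not> ?thesis"
    have "r ^ length as \<le> cmod (poly (\<Prod>a\<leftarrow>as. [:- a, 1:]) c)"
      using *
    proof (induction as)
      case (Cons a as)
      have "poly (\<Prod>a\<leftarrow>a # as. [:- a, 1:]) c = (c - a) * poly (\<Prod>a\<leftarrow>as. [:- a, 1:]) c"
        by (simp add: algebra_simps)
      then show ?case using Cons \<open>r > 0\<close> by (auto simp: norm_mult intro!: mult_mono)
    qed simp
    then show False using assms by simp
  qed
  then obtain a where "a \<in> set as" "cmod (c - a) < r" by blast
  then show ?thesis unfolding assms(1)
    by (intro exI[of _ a]) (simp add: poly_prod_list prod_list_zero_iff image_iff)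
qed

lemma char_poly_root_near:
  assumes "cmod (poly (char_poly (block m y)) c) < r ^ m" "r > 0"
  shows "\<exists>a. poly (char_poly (block m y)) a = 0 \<and> cmod (c - a) < r"
proof -
  obtain as where "char_poly (block m y) = (\<Prod>a\<leftarrow>as. [:- a, 1:])" "length as = m"
    using char_poly_factorized[OF block_carrier] by blast
  then show ?thesis using monic_factorized_root_near assms by blast
qed

lemma eig_frame_root:
  assumes "eig_frame m x l w u"
  shows "poly (char_poly (block m x)) c = 0 \<longleftrightarrow> c \<in> l ` {1..m}"
  unfolding eig_frame_char_poly[OF assms] by (auto simp: poly_prod)

lemma topspace_mat_topology[simp]: "topspace (mat_topology n) = carrier_mat n n"
  unfolding mat_topology_def topspace_pullback_topology by simp

lemma openin_char_poly_less:
  assumes "m \<le> n"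
  shows "openin (mat_topology n) {y \<in> carrier_mat n n. cmod (poly (char_poly (block m y)) c) < r}"
proof -
  \<comment> \<open>The Leibniz expansion as a function of the array of entries, since
    \<open>mat_topology\<close> is pulled back from the product topology on such arrays.\<close>
  let ?F = "\<lambda>W :: nat \<times> nat \<Rightarrow> complex.
    \<Sum>p\<in>{p. p permutes {0..<m}}. signof p * (\<Prod>i = 0..<m. (if i = p i then c else 0) - W (i, p i))"
  have F: "poly (char_poly (block m y)) c = ?F (\<lambda>ij\<in>{..<n} \<times> {..<n}. y $$ ij)" for y
  proof -
    have "(\<Prod>i = 0..<m. Matrix.mat m m (\<lambda>(i, j). (if i = j then c else 0) - y $$ (i, j)) $$ (i, p i))
        = (\<Prod>i = 0..<m. (if i = p i then c else 0) - (\<lambda>ij\<in>{..<n} \<times> {..<n}. y $$ ij) (i, p i))"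
      if "p permutes {0..<m}" for p
    proof (rule prod.cong[OF refl])
      fix i assume "i \<in> {0..<m}"
      then have "i < m" "p i < m" using permutes_in_image[OF that, of i] by auto
      then show "Matrix.mat m m (\<lambda>(i, j). (if i = j then c else 0) - y $$ (i, j)) $$ (i, p i) =
          (if i = p i then c else 0) - (\<lambda>ij\<in>{..<n} \<times> {..<n}. y $$ ij) (i, p i)"
        using assms by simp
    qed
    then show ?thesis unfolding poly_char_poly_det by (simp add: det_def)
  qed
  have "continuous_on UNIV ?F"
    by (intro continuous_intros continuous_on_product_coordinates)
  then have "open (?F -` {v. cmod v < r})"
    by (intro open_vimage) (auto intro!: open_Collect_less continuous_intros)
  then show ?thesis
    unfolding mat_topology_def openin_pullback_topology
    by (intro exI[of _ "?F -` {v. cmod v < r}"]) (auto simp: F)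
qed

lemma eventually_line_in_open:
  assumes "openin (mat_topology n) T" "x \<in> T" "v \<in> carrier_mat n n"
  shows "\<forall>\<^sub>F t in nhds 0. x + t \<cdot>\<^sub>m v \<in> T"
proof -
  obtain O' where O: "open O'" "T = (\<lambda>x. \<lambda>ij\<in>{..<n} \<times> {..<n}. x $$ ij) -` O' \<inter> carrier_mat n n"
    using assms(1) unfolding mat_topology_def openin_pullback_topology by auto
  have x: "x \<in> carrier_mat n n" using assms(2) O by simp
  let ?f = "\<lambda>t. \<lambda>ij\<in>{..<n} \<times> {..<n}. (x + t \<cdot>\<^sub>m v) $$ ij"
  have eq: "?f t = (\<lambda>ij\<in>{..<n} \<times> {..<n}. x $$ ij + t * v $$ ij)" for t
    using x assms(3) by (auto simp: restrict_def)
  have "continuous_on UNIV ?f"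
    unfolding eq
  proof (rule continuous_on_coordinatewise_then_product)
    fix ij show "continuous_on UNIV (\<lambda>t. (\<lambda>ij\<in>{..<n} \<times> {..<n}. x $$ ij + t * v $$ ij) ij)"
      by (cases "ij \<in> {..<n} \<times> {..<n}") (auto intro!: continuous_intros)
  qed
  then have "open (?f -` O')" using O(1) by (intro open_vimage)
  moreover have "0 \<in> ?f -` O'" using assms(2) O x unfolding eq by simp
  ultimately have "\<forall>\<^sub>F t in nhds 0. t \<in> ?f -` O'" by (auto simp: eventually_nhds)
  then show ?thesis
    by eventually_elim (use x assms(3) O(2) in auto)
qed

lemma M_Omega_e_frame:
  assumes "z \<in> M_Omega_e n" "m \<in> {1..n}"
  shows "\<exists>w u. eig_frame m (snd z) (\<lambda>k. fst z (k, m)) w u"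
  using assms M_Omega_e_iff[of "fst z" "snd z" n] by auto

lemma M_Omega_eD:
  assumes "z \<in> M_Omega_e n"
  shows "fst z \<in> e_Omega n" "snd z \<in> carrier_mat n n"
  using assms M_Omega_e_iff[of "fst z" "snd z" n] by auto

lemma finite_eig_index[simp]: "finite (eig_index n)"
  by (rule finite_subset[of _ "{..n} \<times> {..n}"]) (auto simp: eig_index_def)

lemma eig_indexE:
  assumes "p \<in> eig_index n" obtains k m where "p = (k, m)" "m \<in> {1..n}" "k \<in> {1..m}"
  using assms eig_index_mem by (cases p) auto

lemma e_Omega_inj: "\<nu> \<in> e_Omega n \<Longrightarrow> m \<in> {1..n} \<Longrightarrow> inj_on (\<lambda>k. \<nu> (k, m)) {1..m}"
  by (simp add: e_Omega_def)

lemma e_Omega_neq: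
  "\<nu> \<in> e_Omega n \<Longrightarrow> m \<in> {1..n} \<Longrightarrow> k \<in> {1..m} \<Longrightarrow> k' \<in> {1..m} \<Longrightarrow> \<nu> (k, m) = \<nu> (k', m) \<longleftrightarrow> k = k'"
  using e_Omega_inj[of \<nu> n m] by (auto dest: inj_onD)

lemma e_Omega_disj:
  "\<nu> \<in> e_Omega n \<Longrightarrow> m \<in> {1..<n} \<Longrightarrow> i \<in> {1..m} \<Longrightarrow> j \<in> {1..m + 1} \<Longrightarrow> \<nu> (i, m) \<noteq> \<nu> (j, m + 1)"
  by (simp add: e_Omega_def)

lemma eig_index_snd: "p \<in> eig_index n \<Longrightarrow> snd p \<le> n"
  by (auto simp: eig_index_def)

lemma finite_separation:
  fixes f :: "'a \<Rightarrow> complex"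
  assumes "finite A"
  obtains e where "e > 0" "\<And>p q. p \<in> A \<Longrightarrow> q \<in> A \<Longrightarrow> f p \<noteq> f q \<Longrightarrow> 2 * e \<le> cmod (f p - f q)"
proof -
  \<comment> \<open>The element 1 keeps the set nonempty when f takes a single value on A.\<close>
  let ?S = "insert 1 ((\<lambda>(p, q). cmod (f p - f q)) ` {pq \<in> A \<times> A. f (fst pq) \<noteq> f (snd pq)})"
  have fin: "finite ?S" using assms by auto
  show ?thesis
  proof (rule that[of "Min ?S / 2"])
    have "Min ?S > 0" using fin by (subst Min_gr_iff) auto
    then show "Min ?S / 2 > 0" by simp
    fix p q assume "p \<in> A" "q \<in> A" "f p \<noteq> f q"
    then have "cmod (f p - f q) \<in> ?S" by force
    then show "2 * (Min ?S / 2) \<le> cmod (f p - f q)" using fin by simp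
  qed
qed

text \<open>Where the characteristic polynomials are small at the old eigenvalues, each \<nu>_p has
  a new root within e. Distinct old eigenvalues are at least 2 e apart, so this root is unique;
  choosing it defines the section, and uniqueness also gives continuity.\<close>

lemma local_section_exists:
  assumes z: "z \<in> M_Omega_e n"
  shows "\<exists>s U. local_section n z U s"
proof -
  define \<nu> where "\<nu> = fst z"
  define x where "x = snd z"
  have xc: "x \<in> carrier_mat n n" and nu: "\<nu> \<in> e_Omega n"
    using M_Omega_eD[OF z] by (auto simp: \<nu>_def x_def)
  obtain e where e: "e > 0"
    and sep: "\<And>p q. p \<in> eig_index n \<Longrightarrow> q \<in> eig_index n \<Longrightarrow> \<nu> p \<noteq> \<nu> q \<Longrightarrow> 2 * e \<le> cmod (\<nu> p - \<nu> q)"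
    using finite_separation[OF finite_eig_index[of n], of \<nu>] by blast
  define root where "root y p c \<longleftrightarrow> poly (char_poly (block (snd p) y)) c = 0" for y :: "complex mat" and p :: "nat \<times> nat" and c
  define U where "U = {y \<in> carrier_mat n n. \<forall>p\<in>eig_index n.
      cmod (poly (char_poly (block (snd p) y)) (\<nu> p)) < e ^ snd p}"
  have openU: "openin (mat_topology n) U"
  proof (cases "eig_index n = {}")
    case True
    then show ?thesis unfolding U_def using openin_topspace[of "mat_topology n"] by simp
  next
    case False
    have "U = (\<Inter>p\<in>eig_index n. {y \<in> carrier_mat n n. cmod (poly (char_poly (block (snd p) y)) (\<nu> p)) < e ^ snd p})"
      using False by (auto simp: U_def)
    moreover have "openin (mat_topology n) \<dots>"
      using False by (intro openin_Inter) (auto intro!: openin_char_poly_less eig_index_snd)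
    ultimately show ?thesis by simp
  qed
  have root_x: "root x p (\<nu> p)" if "p \<in> eig_index n" for p
  proof -
    obtain k m where p: "p = (k, m)" "m \<in> {1..n}" "k \<in> {1..m}"
      using \<open>p \<in> eig_index n\<close> by (rule eig_indexE)
    obtain w u where "eig_frame m x (\<lambda>k. \<nu> (k, m)) w u"
      using M_Omega_e_frame[OF z p(2)] by (auto simp: x_def \<nu>_def)
    then show ?thesis using p(3) by (auto simp: root_def p(1) eig_frame_root)
  qed
  have xU: "x \<in> U" unfolding U_def using xc root_x e by (auto simp: root_def)
  define g where "g y = (\<lambda>p\<in>eig_index n. SOME c. root y p c \<and> cmod (\<nu> p - c) < e)" for y
  have g: "root y p (g y p)" "cmod (\<nu> p - g y p) < e" if "y \<in> U" "p \<in> eig_index n" for y p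
  proof -
    have "\<exists>c. root y p c \<and> cmod (\<nu> p - c) < e"
      unfolding root_def by (rule char_poly_root_near) (use that e in \<open>auto simp: U_def\<close>)
    from someI_ex[OF this] show "root y p (g y p)" "cmod (\<nu> p - g y p) < e"
      using that by (auto simp: g_def)
  qed
  \<comment> \<open>Levels that are not adjacent may share eigenvalues, hence separation is claimed
    only for distinct values.\<close>
  have gne: "g y p \<noteq> g y q" if "y \<in> U" "p \<in> eig_index n" "q \<in> eig_index n" "\<nu> p \<noteq> \<nu> q" for y p q
  proof
    assume "g y p = g y q"
    then have "cmod (\<nu> p - \<nu> q) < 2 * e"
      using g(2)[OF that(1,2)] g(2)[OF that(1,3)]
      norm_triangle_ineq4[of "\<nu> p - g y p" "\<nu> q - g y q"] by simp
    then show False using sep[OF that(2-4)] by simp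
  qed
  have ge: "g y \<in> e_Omega n" if y: "y \<in> U" for y
  proof -
    have "g y (k, m) \<noteq> g y (k', m)" if "m \<in> {1..n}" "k \<in> {1..m}" "k' \<in> {1..m}" "k \<noteq> k'" for k k' m
      by (rule gne[OF y]) (use that e_Omega_neq[OF nu that(1-3)] in \<open>auto simp: eig_index_mem\<close>)
    moreover have "g y (k, m) \<noteq> g y (k', m + 1)" if "m \<in> {1..<n}" "k \<in> {1..m}" "k' \<in> {1..m + 1}" for k k' m
      by (rule gne[OF y]) (use that e_Omega_disj[OF nu that] in \<open>auto simp: eig_index_mem\<close>)
    moreover have "g y \<in> extensional (eig_index n)" by (simp add: g_def)
    ultimately show ?thesis unfolding e_Omega_def inj_on_def by blast
  qed
  have frame: "\<exists>w u. eig_frame m y (\<lambda>k. g y (k, m)) w u" if y: "y \<in> U" and m: "m \<in> {1..n}" for y m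
  proof (rule eigenvalues_imp_eig_frame)
    show "inj_on (\<lambda>k. g y (k, m)) {1..m}" using ge[OF y] m by (simp add: e_Omega_def)
    show "eigenvalue (block m y) (g y (k, m))" if "k \<in> {1..m}" for k
      using g(1)[OF y, of "(k, m)"] m that
      by (simp add: eigenvalue_root_char_poly[OF block_carrier] root_def eig_index_def)
  qed
  have gmem: "(g y, y) \<in> M_Omega_e n" if "y \<in> U" for y
    using ge[OF that] frame[OF that] that by (auto simp: M_Omega_e_iff U_def)
  have guniq: "c = g y p" if y: "y \<in> U" and p: "p \<in> eig_index n" and c: "root y p c" "cmod (\<nu> p - c) < e" for y p c
  proof -
    obtain k m where km: "p = (k, m)" "m \<in> {1..n}" "k \<in> {1..m}"
      using p by (rule eig_indexE)
    obtain w u where fr: "eig_frame m y (\<lambda>k. g y (k, m)) w u" using frame[OF y km(2)] by blast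
    then obtain k' where k': "k' \<in> {1..m}" "c = g y (k', m)"
      using c(1) by (auto simp: root_def km(1) eig_frame_root)
    have "\<nu> (k', m) = \<nu> p"
    proof (rule ccontr)
      assume "\<nu> (k', m) \<noteq> \<nu> p"
      moreover have q: "(k', m) \<in> eig_index n" using k' km by (simp add: eig_index_mem)
      ultimately have "2 * e \<le> cmod (\<nu> (k', m) - \<nu> p)" using sep p by blast
      moreover have "cmod (\<nu> (k', m) - \<nu> p) < 2 * e"
        using g(2)[OF y q] c(2) k'(2) norm_triangle_ineq4[of "\<nu> (k', m) - c" "\<nu> p - c"] by simp
      ultimately show False by simp
    qed
    then have "k' = k" using e_Omega_neq[OF nu km(2) k'(1) km(3)] km(1) by simp
    then show ?thesis using k' km by simp
  qed
  have gx: "g x = \<nu>"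
  proof (rule extensionalityI[of _ "eig_index n"])
    show "g x \<in> extensional (eig_index n)" "\<nu> \<in> extensional (eig_index n)"
      using nu by (auto simp: g_def e_Omega_def)
    fix p assume "p \<in> eig_index n"
    then show "g x p = \<nu> p" using guniq[OF xU _ root_x] e by simp
  qed
  have cont: "continuous_map (subtopology (mat_topology n) U) euclidean g"
    unfolding euclidean_product_topology[symmetric] continuous_map_componentwise_UNIV
  proof
    fix p
    show "continuous_map (subtopology (mat_topology n) U) euclidean (\<lambda>y. g y p)"
    proof (cases "p \<in> eig_index n")
      case False
      then show ?thesis by (simp add: g_def)
    next
      case True
      show ?thesis
        unfolding continuous_map_def
      proof (intro conjI allI impI)
        fix S assume "openin euclidean (S :: complex set)"
        then have S: "open S" by simp
        show "openin (subtopology (mat_topology n) U) {y \<in> topspace (subtopology (mat_topology n) U). g y p \<in> S}"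
        proof (subst openin_subopen, intro ballI)
          fix y0 assume "y0 \<in> {y \<in> topspace (subtopology (mat_topology n) U). g y p \<in> S}"
          then have y0: "y0 \<in> U" "g y0 p \<in> S" by auto
          obtain r where r: "r > 0" "ball (g y0 p) r \<subseteq> S" using S y0(2) open_contains_ball by blast
          \<comment> \<open>The bound r puts the value in S. The other bound keeps a root that is
            d-close to \<open>g y0 p\<close> within e of \<nu>_p, so that \<open>guniq\<close>
            identifies it with \<open>g y p\<close>.\<close>
          define d where "d = min r (e - cmod (\<nu> p - g y0 p))"
          have d: "d > 0" using r g(2)[OF y0(1) True] by (simp add: d_def)
          define T where "T = U \<inter> {y \<in> carrier_mat n n. cmod (poly (char_poly (block (snd p) y)) (g y0 p)) < d ^ snd p}"
          have "openin (mat_topology n) T"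
            unfolding T_def using openU True by (intro openin_Int openin_char_poly_less eig_index_snd)
          then have "openin (subtopology (mat_topology n) U) T"
            using openU by (simp add: openin_open_subtopology T_def)
          moreover have "y0 \<in> T" using y0 g(1)[OF y0(1) True] d by (auto simp: T_def root_def U_def)
          moreover have "g y p \<in> S" if yT: "y \<in> T" for y
          proof -
            have y: "y \<in> U" using yT by (simp add: T_def)
            obtain a where a: "root y p a" "cmod (g y0 p - a) < d"
              using char_poly_root_near[of "snd p" y "g y0 p" d] yT d by (auto simp: T_def root_def)
            have "cmod (\<nu> p - a) < e"
              using norm_triangle_ineq[of "\<nu> p - g y0 p" "g y0 p - a"] a(2) by (simp add: d_def)
            then have "a = g y p" using guniq[OF y True a(1)] by simp
            then show ?thesis using a(2) r(2) by (auto simp: d_def dist_norm)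
          qed
          ultimately show "\<exists>T. openin (subtopology (mat_topology n) U) T \<and> y0 \<in> T \<and>
              T \<subseteq> {y \<in> topspace (subtopology (mat_topology n) U). g y p \<in> S}"
            by (intro exI[of _ T]) (auto simp: T_def)
        qed
      qed simp
    qed
  qed
  have "local_section n z U (\<lambda>y. (g y, y))"
    unfolding local_section_def using openU xU gx gmem cont by (auto simp: x_def \<nu>_def)
  then show ?thesis by blast
qed

subsection \<open>Derivatives of eigenvalues\<close>

text \<open>A permutation other than the identity moves at least two indices. After one factor is
  differentiated, an off-diagonal factor that is zero at t = 0 remains, so only the product of the
  diagonal entries contributes.\<close>

lemma det_diagonal_derivative:
  fixes d :: "nat \<Rightarrow> complex" and X :: "nat \<Rightarrow> nat \<Rightarrow> complex"
  shows "((\<lambda>t. det (Matrix.mat m m (\<lambda>(a, b). (if a = b then d a else 0) - t * X a b)))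
     has_field_derivative - (\<Sum>i<m. X i i * (\<Prod>j\<in>{..<m} - {i}. d j))) (at 0)"
proof -
  let ?P = "{p. p permutes {0..<m}}"
  let ?e = "\<lambda>t a b. (if a = b then d a else 0) - t * X a b"
  have det: "det (Matrix.mat m m (\<lambda>(a, b). ?e t a b)) = (\<Sum>p\<in>?P. signof p * (\<Prod>i\<in>{..<m}. ?e t i (p i)))" for t
    unfolding det_def by (auto simp: atLeast0LessThan intro!: sum.cong prod.cong dest: permutes_in_image)
  let ?D = "\<lambda>p. \<Sum>i<m. - X i (p i) * (\<Prod>j\<in>{..<m} - {i}. ?e 0 j (p j))"
  have der: "((\<lambda>t. \<Sum>p\<in>?P. signof p * (\<Prod>i\<in>{..<m}. ?e t i (p i))) has_field_derivative
      (\<Sum>p\<in>?P. signof p * ?D p)) (at 0)"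
    by (intro DERIV_sum DERIV_cmult has_field_derivative_prod) (auto intro!: derivative_eq_intros)
  have D0: "?D p = 0" if p: "p \<in> ?P" "p \<noteq> id" for p
  proof (intro sum.neutral ballI)
    fix i assume "i \<in> {..<m}"
    have "\<exists>j\<in>{..<m} - {i}. p j \<noteq> j"
    proof (rule ccontr)
      assume "\<not> ?thesis"
      then have *: "p j = j" if "j \<noteq> i" for j
        using that p(1) by (cases "j < m") (auto simp: permutes_def)
      have "inj p" using p(1) by (auto dest: permutes_inj)
      then have "p i = i" using *[of "p i"] by (auto dest: injD)
      with * p(2) show False by (metis eq_id_iff)
    qed
    then show "- X i (p i) * (\<Prod>j\<in>{..<m} - {i}. ?e 0 j (p j)) = 0" by (auto intro!: prod_zero)
  qed
  have "(\<Sum>p\<in>?P. signof p * ?D p) = (\<Sum>p\<in>{id}. signof p * ?D p)"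
    using D0 by (intro sum.mono_neutral_right) (auto simp: finite_permutations permutes_id)
  also have "\<dots> = - (\<Sum>i<m. X i i * (\<Prod>j\<in>{..<m} - {i}. d j))" by (simp add: sum_negf)
  finally show ?thesis using der unfolding det by simp
qed

text \<open>The difference quotient in t extends to a function continuous in both variables. This
  allows t to tend to 0 while the first variable moves along with it.\<close>

lemma polynomial_increment:
  assumes "P \<in> polynomial_funs {fst, snd}"
  shows "\<exists>H. continuous_on UNIV H \<and> (\<forall>l t. P (l, t) - P (l, 0) = t * H (l, t))"
proof -
  have "continuous_on UNIV P \<and> (\<exists>H. continuous_on UNIV H \<and> (\<forall>l t. P (l, t) - P (l, 0) = t * H (l, t)))"
    using assms
  proof induction
    case (const c)
    then show ?case by (intro conjI exI[of _ "\<lambda>_. 0"]) auto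
  next
    case (coord q)
    show ?case
    proof (cases "q = snd")
      case True
      then show ?thesis by (intro conjI exI[of _ "\<lambda>_. 1"]) (auto intro!: continuous_intros)
    next
      case False
      then have "q = fst" using coord by auto
      then show ?thesis by (intro conjI exI[of _ "\<lambda>_. 0"]) (auto intro!: continuous_intros)
    qed
  next
    case (add P Q)
    then obtain H K where H: "continuous_on UNIV H" "\<forall>l t. P (l, t) - P (l, 0) = t * H (l, t)"
      and K: "continuous_on UNIV K" "\<forall>l t. Q (l, t) - Q (l, 0) = t * K (l, t)" by auto
    have "P (l, t) + Q (l, t) - (P (l, 0) + Q (l, 0)) = t * (H (l, t) + K (l, t))" for l t
      using H(2)[rule_format, of l t] K(2)[rule_format, of l t] by (simp add: algebra_simps)
    moreover have "continuous_on UNIV (\<lambda>z. P z + Q z)" "continuous_on UNIV (\<lambda>z. H z + K z)"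
      using add H(1) K(1) by (blast intro: continuous_on_add)+
    ultimately show ?case by blast
  next
    case (mult P Q)
    then obtain H K where H: "continuous_on UNIV H" "\<forall>l t. P (l, t) - P (l, 0) = t * H (l, t)"
      and K: "continuous_on UNIV K" "\<forall>l t. Q (l, t) - Q (l, 0) = t * K (l, t)" by auto
    have *: "P (l, t) * Q (l, t) - P (l, 0) * Q (l, 0) =
        (P (l, t) - P (l, 0)) * Q (l, t) + P (l, 0) * (Q (l, t) - Q (l, 0))" for l t
      by (simp add: algebra_simps)
    have eq: "P (l, t) * Q (l, t) - P (l, 0) * Q (l, 0) =
        t * (H (l, t) * Q (l, t) + P (fst (l, t), 0) * K (l, t))" for l t
      unfolding * H(2)[rule_format, of l t] K(2)[rule_format, of l t] by (simp add: algebra_simps)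
    have cP: "continuous_on UNIV P" and cQ: "continuous_on UNIV Q" using mult.IH by auto
    have "continuous_on UNIV (\<lambda>z :: complex \<times> complex. P (fst z, 0))"
      by (intro continuous_on_compose2[OF cP]) (auto intro!: continuous_intros)
    then have "continuous_on UNIV (\<lambda>z. H z * Q z + P (fst z, 0) * K z)"
      using H(1) K(1) cQ by (intro continuous_on_add continuous_on_mult)
    moreover have "continuous_on UNIV (\<lambda>z. P z * Q z)" using cP cQ by (rule continuous_on_mult)
    ultimately show ?case using eq by blast
  qed
  then show ?thesis by blast
qed

lemma eig_frame_conjugate_det:
  assumes fr: "eig_frame m x l w u"
  shows "det (Matrix.mat m m (\<lambda>(a, b). \<Sum>i<m. \<Sum>j<m. u (Suc a) i * M i j * w (Suc b) j)) = det (Matrix.mat m m (\<lambda>(i, j). M i j))"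
proof -
  define U where "U = Matrix.mat m m (\<lambda>(a, i). u (Suc a) i)"
  define W where "W = Matrix.mat m m (\<lambda>(i, b). w (Suc b) i)"
  define N where "N = Matrix.mat m m (\<lambda>(i, j). M i j)"
  have c: "U \<in> carrier_mat m m" "W \<in> carrier_mat m m" "N \<in> carrier_mat m m"
    by (auto simp: U_def W_def N_def)
  have UN: "U * N \<in> carrier_mat m m" using c by simp
  have UW: "U * W = 1\<^sub>m m"
  proof (rule eq_matI)
    fix i j assume "i < dim_row (1\<^sub>m m)" "j < dim_col (1\<^sub>m m)"
    then have ij: "i < m" "j < m" by auto
    show "(U * W) $$ (i, j) = 1\<^sub>m m $$ (i, j)"
      unfolding mult_mat_index_sum[OF c(1,2) ij] using eig_frameD(3)[OF fr, of "Suc i" "Suc j"] ij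
      by (simp add: U_def W_def)
  qed (use c in auto)
  have "Matrix.mat m m (\<lambda>(a, b). \<Sum>i<m. \<Sum>j<m. u (Suc a) i * M i j * w (Suc b) j) = U * N * W"
  proof (rule eq_matI)
    fix a b assume "a < dim_row (U * N * W)" "b < dim_col (U * N * W)"
    then have ab: "a < m" "b < m" using c by auto
    have "(U * N * W) $$ (a, b) = (\<Sum>j<m. (\<Sum>i<m. U $$ (a, i) * N $$ (i, j)) * W $$ (j, b))"
      unfolding mult_mat_index_sum[OF UN c(2) ab]
      by (intro sum.cong refl arg_cong[of _ _ "\<lambda>c. c * _"] mult_mat_index_sum[OF c(1,3) ab(1)]) auto
    also have "\<dots> = (\<Sum>j<m. \<Sum>i<m. u (Suc a) i * M i j * w (Suc b) j)"
      unfolding sum_distrib_right using ab by (simp add: U_def W_def N_def)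
    also have "\<dots> = (\<Sum>i<m. \<Sum>j<m. u (Suc a) i * M i j * w (Suc b) j)" by (rule sum.swap)
    finally show "Matrix.mat m m (\<lambda>(a, b). \<Sum>i<m. \<Sum>j<m. u (Suc a) i * M i j * w (Suc b) j) $$ (a, b) = (U * N * W) $$ (a, b)"
      using ab by simp
  qed (use c in auto)
  then have "det (Matrix.mat m m (\<lambda>(a, b). \<Sum>i<m. \<Sum>j<m. u (Suc a) i * M i j * w (Suc b) j)) = det U * det N * det W"
    by (simp add: det_mult[OF UN c(2)] det_mult[OF c(1,3)])
  also have "\<dots> = det N * (det U * det W)" by simp
  also have "det U * det W = 1" using det_mult[OF c(1,2)] UW by simp
  finally show ?thesis by (simp add: N_def)
qed

text \<open>In the basis of eigenvectors x is diagonal and v has the entries u_a v w_b, which brings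
  the determinant into the form of \<open>det_diagonal_derivative\<close>.\<close>

lemma eig_frame_char_poly_line:
  assumes fr: "eig_frame m x l w u" and x: "x \<in> carrier_mat n n" and v: "v \<in> carrier_mat n n" and m: "m \<le> n"
  shows "poly (char_poly (block m (x + t \<cdot>\<^sub>m v))) c = det (Matrix.mat m m (\<lambda>(a, b).
     (if a = b then c - l (Suc a) else 0) - t * (\<Sum>i<m. \<Sum>j<m. u (Suc a) i * v $$ (i, j) * w (Suc b) j)))"
proof -
  let ?V = "\<lambda>a b. \<Sum>i<m. \<Sum>j<m. u (Suc a) i * v $$ (i, j) * w (Suc b) j"
  have 1: "(\<Sum>i<m. \<Sum>j<m. u (Suc a) i * ((if i = j then c else 0) - (x + t \<cdot>\<^sub>m v) $$ (i, j)) * w (Suc b) j)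
     = (if a = b then c - l (Suc a) else 0) - t * ?V a b" if ab: "a < m" "b < m" for a b
  proof -
    have "(\<Sum>i<m. \<Sum>j<m. u (Suc a) i * ((if i = j then c else 0) - (x + t \<cdot>\<^sub>m v) $$ (i, j)) * w (Suc b) j)
       = (\<Sum>i<m. \<Sum>j<m. (if i = j then c * (u (Suc a) i * w (Suc b) j) else 0)
           - u (Suc a) i * (x $$ (i, j) * w (Suc b) j) - t * (u (Suc a) i * v $$ (i, j) * w (Suc b) j))"
      using x v m by (intro sum.cong refl) (auto simp: algebra_simps)
    also have "\<dots> = c * (\<Sum>i<m. u (Suc a) i * w (Suc b) i)
        - (\<Sum>i<m. u (Suc a) i * (\<Sum>j<m. x $$ (i, j) * w (Suc b) j)) - t * ?V a b"
      by (simp add: sum_subtractf sum_distrib_left)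
    also have "(\<Sum>i<m. u (Suc a) i * (\<Sum>j<m. x $$ (i, j) * w (Suc b) j)) = l (Suc b) * (\<Sum>i<m. u (Suc a) i * w (Suc b) i)"
      unfolding sum_distrib_left[of "l _"] using eig_frameD(1)[OF fr, of "Suc b"] ab
      by (intro sum.cong refl) (simp add: algebra_simps)
    also have "(\<Sum>i<m. u (Suc a) i * w (Suc b) i) = (if a = b then 1 else 0)"
      using eig_frameD(3)[OF fr, of "Suc a" "Suc b"] ab by simp
    finally show ?thesis by simp
  qed
  have "poly (char_poly (block m (x + t \<cdot>\<^sub>m v))) c =
      det (Matrix.mat m m (\<lambda>(i, j). (if i = j then c else 0) - (x + t \<cdot>\<^sub>m v) $$ (i, j)))"
    by (rule poly_char_poly_det)
  also have "\<dots> = det (Matrix.mat m m (\<lambda>(a, b). \<Sum>i<m. \<Sum>j<m. u (Suc a) i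
      * ((if i = j then c else 0) - (x + t \<cdot>\<^sub>m v) $$ (i, j)) * w (Suc b) j))"
    by (rule eig_frame_conjugate_det[OF fr, symmetric])
  also have "\<dots> = det (Matrix.mat m m (\<lambda>(a, b). (if a = b then c - l (Suc a) else 0) - t * ?V a b))"
    by (rule arg_cong[of _ _ det], rule eq_matI) (use 1 in auto)
  finally show ?thesis .
qed

lemma char_poly_line_derivative:
  assumes fr: "eig_frame m x l w u" and x: "x \<in> carrier_mat n n" and v: "v \<in> carrier_mat n n"
    and m: "m \<le> n" and k: "k \<in> {1..m}"
  shows "((\<lambda>t. poly (char_poly (block m (x + t \<cdot>\<^sub>m v))) (l k)) has_field_derivative
    - (\<Prod>j\<in>{1..m} - {k}. l k - l j) * eig_pairing m (u k) (w k) (\<lambda>i j. v $$ (i, j))) (at 0)"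
proof -
  let ?V = "\<lambda>a b. \<Sum>i<m. \<Sum>j<m. u (Suc a) i * v $$ (i, j) * w (Suc b) j"
  have "(\<Sum>i<m. ?V i i * (\<Prod>j\<in>{..<m} - {i}. l k - l (Suc j)))
     = (\<Sum>i\<in>{1..m}. eig_pairing m (u i) (w i) (\<lambda>i j. v $$ (i, j)) * (\<Prod>j\<in>{1..m} - {i}. l k - l j))"
  proof -
    have "(\<Prod>j\<in>{..<m} - {i}. l k - l (Suc j)) = (\<Prod>j\<in>{1..m} - {Suc i}. l k - l j)" for i
      by (rule prod.reindex_bij_witness[of _ "\<lambda>j. j - 1" Suc]) auto
    then show ?thesis by (simp add: sum.atLeast1_atMost_eq eig_pairing_def)
  qed
  \<comment> \<open>For i \<noteq> k the product contains the factor l_k - l_k.\<close>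
  also have "\<dots> = (\<Sum>i\<in>{1..m}. if i = k then eig_pairing m (u k) (w k) (\<lambda>i j. v $$ (i, j)) * (\<Prod>j\<in>{1..m} - {k}. l k - l j) else 0)"
    using k by (intro sum.cong) (auto intro!: prod_zero)
  also have "\<dots> = (\<Prod>j\<in>{1..m} - {k}. l k - l j) * eig_pairing m (u k) (w k) (\<lambda>i j. v $$ (i, j))"
    using k by simp
  finally show ?thesis
    unfolding eig_frame_char_poly_line[OF fr x v m]
    using det_diagonal_derivative[of m "\<lambda>a. l k - l (Suc a)" ?V] by simp
qed

text \<open>Let F(a, t) be the characteristic polynomial of x + t v at a, with F(a, 0) = (a - l_k)
  R(a) and F(a, t) - F(a, 0) = t H(a, t). Then F(c t, t) = 0 gives (c t - l_k) / t = - H(c t, t) /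
  R(c t), and mere continuity of c at 0 yields the limit.\<close>

lemma eigenvalue_derivative:
  assumes fr: "eig_frame m x l w u" and x: "x \<in> carrier_mat n n" and v: "v \<in> carrier_mat n n"
    and m: "m \<le> n" and k: "k \<in> {1..m}" and inj: "inj_on l {1..m}"
    and ev: "\<forall>\<^sub>F t in nhds 0. poly (char_poly (block m (x + t \<cdot>\<^sub>m v))) (c t) = 0"
    and c: "c 0 = l k" "isCont c 0"
  shows "(c has_field_derivative eig_pairing m (u k) (w k) (\<lambda>i j. v $$ (i, j))) (at 0)"
proof -
  let ?V = "\<lambda>a b. \<Sum>i<m. \<Sum>j<m. u (Suc a) i * v $$ (i, j) * w (Suc b) j"
  define F where "F p = det (Matrix.mat m m (\<lambda>(a, b). (if a = b then fst p - l (Suc a) else 0) - snd p * ?V a b))" for p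
  have F: "poly (char_poly (block m (x + t \<cdot>\<^sub>m v))) a = F (a, t)" for a t
    unfolding F_def eig_frame_char_poly_line[OF fr x v m] fst_conv snd_conv ..
  have "F \<in> polynomial_funs {fst, snd}"
  proof -
    have "(\<lambda>p. if a = b then fst p - l (Suc a) else 0) \<in> polynomial_funs {fst, snd}" for a b
      by (cases "a = b") (auto intro: polynomial_funs.const polynomial_funs_diff[OF polynomial_funs.coord polynomial_funs.const])
    moreover have "snd \<in> polynomial_funs {fst, snd}" by (intro polynomial_funs.coord) simp
    ultimately show ?thesis unfolding F_def
      by (intro det_polynomial_funs, unfold prod.case)
        (intro polynomial_funs_diff polynomial_funs.mult polynomial_funs.const)
  qed
  then obtain H where H: "continuous_on UNIV H" "\<And>a t. F (a, t) - F (a, 0) = t * H (a, t)"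
    using polynomial_increment by blast
  have x0: "x + 0 \<cdot>\<^sub>m v = x" using x v by (intro eq_matI) auto
  have F0: "F (a, 0) = (\<Prod>j\<in>{1..m}. a - l j)" for a
    using F[of 0 a] eig_frame_char_poly[OF fr] by (simp add: x0 poly_prod)
  define R where "R a = (\<Prod>j\<in>{1..m} - {k}. a - l j)" for a
  have F0R: "F (a, 0) = (a - l k) * R a" for a
    unfolding F0 R_def using k by (subst prod.remove[of _ k]) auto
  have Rk: "R (l k) \<noteq> 0" using inj k by (auto simp: R_def inj_on_eq_iff)
  \<comment> \<open>H at (l_k, 0) is the t-derivative of F with the first variable frozen at l_k,
    which is already known.\<close>
  have Hk: "H (l k, 0) = - R (l k) * eig_pairing m (u k) (w k) (\<lambda>i j. v $$ (i, j))"
  proof (rule DERIV_unique)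
    show "((\<lambda>t. F (l k, t)) has_field_derivative
        - R (l k) * eig_pairing m (u k) (w k) (\<lambda>i j. v $$ (i, j))) (at 0)"
      using char_poly_line_derivative[OF fr x v m k] unfolding F R_def .
    have "isCont (\<lambda>t. H (l k, t)) 0"
      using H(1) by (intro continuous_on_interior[of UNIV]) (auto intro!: continuous_on_compose2[of UNIV H] continuous_intros)
    then show "((\<lambda>t. F (l k, t)) has_field_derivative H (l k, 0)) (at 0)"
      unfolding CARAT_DERIV using H(2)[of "l k"] by (intro exI[of _ "\<lambda>t. H (l k, t)"]) auto
  qed
  have cc: "c \<midarrow>0\<rightarrow> l k" using c by (simp add: isCont_def)
  have cH: "(\<lambda>t. H (c t, t)) \<midarrow>0\<rightarrow> H (l k, 0)"
    using H(1) cc by (intro isCont_tendsto_compose[of _ H] tendsto_intros)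
      (auto simp: continuous_on_eq_continuous_at)
  have cR: "(\<lambda>t. R (c t)) \<midarrow>0\<rightarrow> R (l k)"
    unfolding R_def using cc by (intro tendsto_intros)
  have lim: "(\<lambda>t. - H (c t, t) / R (c t)) \<midarrow>0\<rightarrow> eig_pairing m (u k) (w k) (\<lambda>i j. v $$ (i, j))"
    using tendsto_divide[OF tendsto_minus[OF cH] cR Rk] Rk unfolding Hk by simp
  have "\<forall>\<^sub>F t in at 0. R (c t) \<noteq> 0" using cR Rk by (rule tendsto_imp_eventually_ne)
  moreover have "\<forall>\<^sub>F t in at 0. poly (char_poly (block m (x + t \<cdot>\<^sub>m v))) (c t) = 0"
    using ev by (simp add: eventually_nhds_conv_at)
  moreover have "\<forall>\<^sub>F t in at (0::complex). t \<noteq> 0" by (simp add: eventually_at_filter)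
  ultimately have "\<forall>\<^sub>F t in at 0. - H (c t, t) / R (c t) = (c t - c 0) / (t - 0)"
  proof eventually_elim
    case (elim t)
    then have "t * H (c t, t) = - ((c t - l k) * R (c t))" using H(2)[of "c t" t] by (simp add: F F0R)
    then have "(c t - l k) * R (c t) + t * H (c t, t) = 0" by simp
    then show ?case using elim c(1) by (simp add: field_simps eq_neg_iff_add_eq_0)
  qed
  then have "(\<lambda>t. (c t - c 0) / (t - 0)) \<midarrow>0\<rightarrow> eig_pairing m (u k) (w k) (\<lambda>i j. v $$ (i, j))"
    using lim by (rule Lim_transform_eventually[rotated])
  then show ?thesis by (simp add: has_field_derivative_iff)
qed

subsection \<open>The lifted bracket\<close>

text \<open>For small t a line in M(n) stays in U, so the section lifts it to a curve in the
  variety. Continuity of the section makes each eigenvalue a continuous branch along it, and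
  \<open>eigenvalue_derivative\<close> applies.\<close>

lemma local_section_curve:
  assumes sec: "local_section n z U s" and v: "v \<in> carrier_mat n n"
  defines "\<gamma> \<equiv> \<lambda>t. s (snd z + t \<cdot>\<^sub>m v)"
  shows "\<gamma> 0 = z"
    and "\<forall>\<^sub>F t in nhds 0. \<gamma> t \<in> M_Omega_e n \<and> snd (\<gamma> t) = snd z + t \<cdot>\<^sub>m v"
    and "i < n \<Longrightarrow> j < n \<Longrightarrow> ((\<lambda>t. snd (\<gamma> t) $$ (i, j)) has_field_derivative v $$ (i, j)) (at 0)"
    and "m \<in> {1..n} \<Longrightarrow> k \<in> {1..m} \<Longrightarrow> eig_frame m (snd z) (\<lambda>k. fst z (k, m)) w u \<Longrightarrow>
      ((\<lambda>t. fst (\<gamma> t) (k, m)) has_field_derivative eig_pairing m (u k) (w k) (\<lambda>i j. v $$ (i, j))) (at 0)"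
proof -
  let ?x = "snd z"
  have U: "openin (mat_topology n) U" "?x \<in> U" and sx: "s ?x = z"
    and sU: "\<And>y. y \<in> U \<Longrightarrow> s y \<in> M_Omega_e n \<and> snd (s y) = y"
    and cont: "continuous_map (subtopology (mat_topology n) U) euclidean (\<lambda>y. fst (s y))"
    using sec unfolding local_section_def by auto
  have xc: "?x \<in> carrier_mat n n" using openin_subset[OF U(1)] U(2) by auto
  have x0: "?x + 0 \<cdot>\<^sub>m v = ?x" using xc v by (intro eq_matI) auto
  show g0: "\<gamma> 0 = z" by (simp add: \<gamma>_def x0 sx)
  have "\<forall>\<^sub>F t in nhds 0. ?x + t \<cdot>\<^sub>m v \<in> U" by (rule eventually_line_in_open[OF U v])
  then show ev: "\<forall>\<^sub>F t in nhds 0. \<gamma> t \<in> M_Omega_e n \<and> snd (\<gamma> t) = ?x + t \<cdot>\<^sub>m v"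
    by eventually_elim (use sU in \<open>auto simp: \<gamma>_def\<close>)
  show "((\<lambda>t. snd (\<gamma> t) $$ (i, j)) has_field_derivative v $$ (i, j)) (at 0)" if ij: "i < n" "j < n"
  proof -
    have "((\<lambda>t. ?x $$ (i, j) + t * v $$ (i, j)) has_field_derivative v $$ (i, j)) (at 0)"
      by (auto intro!: derivative_eq_intros)
    moreover have "\<forall>\<^sub>F t in nhds 0. snd (\<gamma> t) $$ (i, j) = ?x $$ (i, j) + t * v $$ (i, j)"
      using ev by eventually_elim (use ij xc v in auto)
    ultimately show ?thesis by (subst DERIV_cong_ev[OF refl _ refl]) auto
  qed
  show "((\<lambda>t. fst (\<gamma> t) (k, m)) has_field_derivative eig_pairing m (u k) (w k) (\<lambda>i j. v $$ (i, j))) (at 0)"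
    if m: "m \<in> {1..n}" and k: "k \<in> {1..m}" and fr: "eig_frame m ?x (\<lambda>k. fst z (k, m)) w u"
  proof (rule eigenvalue_derivative[OF fr xc v _ k])
    show "m \<le> n" using m by simp
    have zM: "z \<in> M_Omega_e n" using sU[OF U(2)] sx by simp
    show "inj_on (\<lambda>k. fst z (k, m)) {1..m}" by (rule e_Omega_inj[OF M_Omega_eD(1)[OF zM] m])
    show "\<forall>\<^sub>F t in nhds 0. poly (char_poly (block m (?x + t \<cdot>\<^sub>m v))) (fst (\<gamma> t) (k, m)) = 0"
      using ev
    proof eventually_elim
      case (elim t)
      then obtain w u where "eig_frame m (?x + t \<cdot>\<^sub>m v) (\<lambda>k. fst (\<gamma> t) (k, m)) w u"
        using M_Omega_e_frame[OF _ m, of "\<gamma> t"] by auto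
      then show ?case using k by (simp add: eig_frame_root)
    qed
    show "fst (\<gamma> 0) (k, m) = fst z (k, m)" by (simp add: g0)
    have "continuous_map (subtopology (mat_topology n) U) euclidean (\<lambda>y. fst (s y) (k, m))"
      using cont unfolding euclidean_product_topology[symmetric] continuous_map_componentwise_UNIV by simp
    then have op: "openin (mat_topology n) {y \<in> U. fst (s y) (k, m) \<in> S}" if "open S" for S
    proof -
      have "topspace (subtopology (mat_topology n) U) = U" using openin_subset[OF U(1)] by auto
      then have "openin (subtopology (mat_topology n) U) {y \<in> U. fst (s y) (k, m) \<in> S}"
        using \<open>continuous_map _ _ (\<lambda>y. fst (s y) (k, m))\<close> that unfolding continuous_map_def by simp
      then show ?thesis using U(1) by (simp add: openin_open_subtopology)
    qed
    show "isCont (\<lambda>t. fst (\<gamma> t) (k, m)) 0"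
      unfolding isCont_def
    proof (rule topological_tendstoI)
      fix S assume "open S" "fst (\<gamma> 0) (k, m) \<in> S"
      then have "\<forall>\<^sub>F t in nhds 0. ?x + t \<cdot>\<^sub>m v \<in> {y \<in> U. fst (s y) (k, m) \<in> S}"
        by (intro eventually_line_in_open[OF _ _ v] op) (auto simp: \<gamma>_def x0 U)
      then have "\<forall>\<^sub>F t in nhds 0. fst (\<gamma> t) (k, m) \<in> S" by eventually_elim (simp add: \<gamma>_def)
      then show "\<forall>\<^sub>F t in at 0. fst (\<gamma> t) (k, m) \<in> S" by (simp add: eventually_nhds_conv_at)
    qed
  qed
qed

text \<open>The very choice made inside \<open>lifted_bracket\<close>; all differentials are taken
  along it.\<close>

definition sec :: "nat \<Rightarrow> point \<Rightarrow> complex mat \<Rightarrow> point" where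
  "sec n z = (SOME s. \<exists>U. local_section n z U s)"

text \<open>The differential of f at z in the chart \<pi>_n, with v a tangent vector of
  M(n).\<close>

definition dlift :: "nat \<Rightarrow> point \<Rightarrow> (point \<Rightarrow> complex) \<Rightarrow> complex mat \<Rightarrow> complex" where
  "dlift n z f v = mat_differential (f \<circ> sec n z) (snd z) v"

lemma lifted_bracket_sec:
  "z \<in> M_Omega_e n \<Longrightarrow> lifted_bracket n f g z = mat_bracket n (f \<circ> sec n z) (g \<circ> sec n z) (snd z)"
  by (simp add: lifted_bracket_def sec_def Let_def)

lemma local_section_sec:
  assumes "z \<in> M_Omega_e n" shows "\<exists>U. local_section n z U (sec n z)"
  unfolding sec_def by (rule someI_ex[OF local_section_exists[OF assms]])

lemma dlift_eqI:
  assumes "((\<lambda>t. f (sec n z (snd z + t \<cdot>\<^sub>m v))) has_field_derivative d) (at 0)"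
  shows "dlift n z f v = d"
  unfolding dlift_def mat_differential_def comp_def using assms by (rule DERIV_imp_deriv)

lemma sec_curve:
  assumes z: "z \<in> M_Omega_e n" and v: "v \<in> carrier_mat n n"
  shows "sec n z (snd z + 0 \<cdot>\<^sub>m v) = z"
    and "\<forall>\<^sub>F t in nhds 0. sec n z (snd z + t \<cdot>\<^sub>m v) \<in> M_Omega_e n"
proof -
  obtain U where "local_section n z U (sec n z)" using local_section_sec[OF z] by blast
  note * = local_section_curve[OF this v]
  show "sec n z (snd z + 0 \<cdot>\<^sub>m v) = z" by (rule *(1))
  show "\<forall>\<^sub>F t in nhds 0. sec n z (snd z + t \<cdot>\<^sub>m v) \<in> M_Omega_e n"
    using *(2) by eventually_elim simp
qed

lemma
  assumes z: "z \<in> M_Omega_e n" and v: "v \<in> carrier_mat n n"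
  shows sec_entry_derivative: "i < n \<Longrightarrow> j < n \<Longrightarrow>
      ((\<lambda>t. snd (sec n z (snd z + t \<cdot>\<^sub>m v)) $$ (i, j)) has_field_derivative v $$ (i, j)) (at 0)"
    and sec_eigenvalue_derivative: "m \<in> {1..n} \<Longrightarrow> k \<in> {1..m} \<Longrightarrow> eig_frame m (snd z) (\<lambda>k. fst z (k, m)) w u \<Longrightarrow>
      ((\<lambda>t. fst (sec n z (snd z + t \<cdot>\<^sub>m v)) (k, m)) has_field_derivative
        eig_pairing m (u k) (w k) (\<lambda>i j. v $$ (i, j))) (at 0)"
proof -
  obtain U where "local_section n z U (sec n z)" using local_section_sec[OF z] by blast
  note * = local_section_curve[OF this v]
  show "i < n \<Longrightarrow> j < n \<Longrightarrow>
      ((\<lambda>t. snd (sec n z (snd z + t \<cdot>\<^sub>m v)) $$ (i, j)) has_field_derivative v $$ (i, j)) (at 0)"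
    by (rule *(3))
  show "m \<in> {1..n} \<Longrightarrow> k \<in> {1..m} \<Longrightarrow> eig_frame m (snd z) (\<lambda>k. fst z (k, m)) w u \<Longrightarrow>
      ((\<lambda>t. fst (sec n z (snd z + t \<cdot>\<^sub>m v)) (k, m)) has_field_derivative
        eig_pairing m (u k) (w k) (\<lambda>i j. v $$ (i, j))) (at 0)"
    by (rule *(4))
qed

lemma dlift_entry:
  assumes "z \<in> M_Omega_e n" "v \<in> carrier_mat n n" "i < n" "j < n"
  shows "dlift n z (\<lambda>z. snd z $$ (i, j)) v = v $$ (i, j)"
  by (rule dlift_eqI[OF sec_entry_derivative[OF assms]])

lemma dlift_eigenvalue:
  assumes "z \<in> M_Omega_e n" "v \<in> carrier_mat n n" "m \<in> {1..n}" "k \<in> {1..m}"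
    "eig_frame m (snd z) (\<lambda>k. fst z (k, m)) w u"
  shows "dlift n z (\<lambda>z. fst z (k, m)) v = eig_pairing m (u k) (w k) (\<lambda>i j. v $$ (i, j))"
  by (rule dlift_eqI[OF sec_eigenvalue_derivative[OF assms]])

lemma coords_M_e_cases:
  assumes "q \<in> coords_M_e n"
  obtains (eig) k m where "m \<in> {1..n}" "k \<in> {1..m}" "q = (\<lambda>z. fst z (k, m))"
  | (entry) i j where "i < n" "j < n" "q = (\<lambda>z. snd z $$ (i, j))"
  using assms unfolding coords_M_e_def
  by (auto elim!: eig_indexE)

lemma finite_coords_M_e[simp]: "finite (coords_M_e n)"
  by (simp add: coords_M_e_def)

lemma coord_derivative:
  assumes z: "z \<in> M_Omega_e n" and v: "v \<in> carrier_mat n n" and q: "q \<in> coords_M_e n"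
  shows "((\<lambda>t. q (sec n z (snd z + t \<cdot>\<^sub>m v))) has_field_derivative dlift n z q v) (at 0)"
  using q
proof (cases rule: coords_M_e_cases)
  case (eig k m)
  obtain w u where fr: "eig_frame m (snd z) (\<lambda>k. fst z (k, m)) w u"
    using M_Omega_e_frame[OF z eig(1)] by blast
  show ?thesis
    unfolding eig(3) dlift_eigenvalue[OF z v eig(1,2) fr] by (rule sec_eigenvalue_derivative[OF z v eig(1,2) fr])
next
  case (entry i j)
  show ?thesis unfolding entry(3) dlift_entry[OF z v entry(1,2)]
    by (rule sec_entry_derivative[OF z v entry(1,2)])
qed

text \<open>Linearity with explicit coefficients. The definite description in
  \<open>mat_gradient\<close> can be evaluated once such coefficients are exhibited; the gradient is
  their transpose.\<close>

definition mat_linear :: "nat \<Rightarrow> (complex mat \<Rightarrow> complex) \<Rightarrow> (nat \<Rightarrow> nat \<Rightarrow> complex) \<Rightarrow> bool" where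
  "mat_linear n \<phi> c \<longleftrightarrow> (\<forall>v\<in>carrier_mat n n. \<phi> v = (\<Sum>i<n. \<Sum>j<n. c i j * v $$ (i, j)))"

lemma mat_linear_sum:
  assumes "\<And>q. q \<in> X \<Longrightarrow> mat_linear n (\<phi> q) (c q)"
    and "\<And>v. v \<in> carrier_mat n n \<Longrightarrow> \<psi> v = (\<Sum>q\<in>X. a q * \<phi> q v)"
  shows "mat_linear n \<psi> (\<lambda>i j. \<Sum>q\<in>X. a q * c q i j)"
  unfolding mat_linear_def
proof
  fix v :: "complex mat" assume v: "v \<in> carrier_mat n n"
  have "(\<Sum>i<n. \<Sum>j<n. (\<Sum>q\<in>X. a q * c q i j) * v $$ (i, j)) = (\<Sum>q\<in>X. a q * (\<Sum>i<n. \<Sum>j<n. c q i j * v $$ (i, j)))"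
  proof -
    have "(\<Sum>i<n. \<Sum>j<n. (\<Sum>q\<in>X. a q * c q i j) * v $$ (i, j)) = (\<Sum>i<n. \<Sum>j<n. \<Sum>q\<in>X. a q * (c q i j * v $$ (i, j)))"
      by (simp add: sum_distrib_right mult.assoc)
    also have "\<dots> = (\<Sum>i<n. \<Sum>q\<in>X. \<Sum>j<n. a q * (c q i j * v $$ (i, j)))"
      by (rule sum.cong[OF refl], rule sum.swap)
    also have "\<dots> = (\<Sum>q\<in>X. \<Sum>i<n. \<Sum>j<n. a q * (c q i j * v $$ (i, j)))" by (rule sum.swap)
    finally show ?thesis by (simp add: sum_distrib_left)
  qed
  also have "\<dots> = \<psi> v"
    unfolding assms(2)[OF v] using assms(1) v by (intro sum.cong refl) (simp add: mat_linear_def)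
  finally show "\<psi> v = (\<Sum>i<n. \<Sum>j<n. (\<Sum>q\<in>X. a q * c q i j) * v $$ (i, j))" by simp
qed

lemma mat_linear_combination:
  assumes "mat_linear n \<phi> c"
  shows "\<phi> (Matrix.mat n n (\<lambda>(i, j). \<Sum>a\<in>A. b a * V a i j)) = (\<Sum>a\<in>A. b a * \<phi> (Matrix.mat n n (\<lambda>(i, j). V a i j)))"
proof -
  have "\<phi> (Matrix.mat n n (\<lambda>(i, j). \<Sum>a\<in>A. b a * V a i j)) = (\<Sum>i<n. \<Sum>j<n. \<Sum>a\<in>A. b a * (c i j * V a i j))"
    using assms by (simp add: mat_linear_def sum_distrib_left mult.left_commute)
  also have "\<dots> = (\<Sum>a\<in>A. \<Sum>i<n. \<Sum>j<n. b a * (c i j * V a i j))"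
  proof -
    have "(\<Sum>i<n. \<Sum>j<n. \<Sum>a\<in>A. b a * (c i j * V a i j)) = (\<Sum>i<n. \<Sum>a\<in>A. \<Sum>j<n. b a * (c i j * V a i j))"
      by (rule sum.cong[OF refl], rule sum.swap)
    also have "\<dots> = (\<Sum>a\<in>A. \<Sum>i<n. \<Sum>j<n. b a * (c i j * V a i j))" by (rule sum.swap)
    finally show ?thesis .
  qed
  also have "\<dots> = (\<Sum>a\<in>A. b a * \<phi> (Matrix.mat n n (\<lambda>(i, j). V a i j)))"
    using assms by (simp add: mat_linear_def sum_distrib_left)
  finally show ?thesis .
qed

lemma mat_linear_entry: "i < n \<Longrightarrow> j < n \<Longrightarrow> mat_linear n (\<lambda>v. v $$ (i, j)) (\<lambda>a b. if a = i \<and> b = j then 1 else 0)"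
proof -
  assume ij: "i < n" "j < n"
  have "(\<Sum>a<n. \<Sum>b<n. (if a = i \<and> b = j then 1 else 0) * v $$ (a, b)) = (\<Sum>a<n. if a = i then v $$ (i, j) else 0)" for v :: "complex mat"
    using ij by (intro sum.cong refl) (simp add: if_distrib[of "\<lambda>c. c * _"] cong: if_cong)
  then show ?thesis using ij by (simp add: mat_linear_def)
qed

text \<open>Coefficients of v \<mapsto> u v w. Their transpose is the gradient, the matrix w u
  padded by zeros.\<close>

definition eig_grad :: "nat \<Rightarrow> (nat \<Rightarrow> complex) \<Rightarrow> (nat \<Rightarrow> complex) \<Rightarrow> nat \<Rightarrow> nat \<Rightarrow> complex" where
  "eig_grad m u w i j = (if i < m \<and> j < m then u i * w j else 0)"

lemma mat_linear_eig_pairing: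
  assumes "m \<le> n" shows "mat_linear n (\<lambda>v. eig_pairing m u w (\<lambda>i j. v $$ (i, j))) (eig_grad m u w)"
  unfolding mat_linear_def
proof
  fix v :: "complex mat"
  have "(\<Sum>j<n. eig_grad m u w i j * v $$ (i, j)) = (if i < m then \<Sum>j<m. u i * v $$ (i, j) * w j else 0)" for i
    using assms by (auto simp: eig_grad_def algebra_simps split: if_splits intro!: sum.mono_neutral_cong_right)
  then have "(\<Sum>i<n. \<Sum>j<n. eig_grad m u w i j * v $$ (i, j)) = (\<Sum>i<n. if i < m then \<Sum>j<m. u i * v $$ (i, j) * w j else 0)"
    by simp
  also have "\<dots> = eig_pairing m u w (\<lambda>i j. v $$ (i, j))"
    unfolding eig_pairing_def using assms by (intro sum.mono_neutral_cong_right) auto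
  finally show "eig_pairing m u w (\<lambda>i j. v $$ (i, j)) = (\<Sum>i<n. \<Sum>j<n. eig_grad m u w i j * v $$ (i, j))" by simp
qed

lemma mat_linear_cong:
  "(\<And>v. v \<in> carrier_mat n n \<Longrightarrow> \<phi> v = \<psi> v) \<Longrightarrow> mat_linear n \<phi> c \<longleftrightarrow> mat_linear n \<psi> c"
  by (simp add: mat_linear_def)

lemma mat_linear_dlift_eigenvalue:
  assumes "z \<in> M_Omega_e n" "m \<in> {1..n}" "k \<in> {1..m}" "eig_frame m (snd z) (\<lambda>k. fst z (k, m)) w u"
  shows "mat_linear n (dlift n z (\<lambda>z. fst z (k, m))) (eig_grad m (u k) (w k))"
  using assms mat_linear_eig_pairing[of m n "u k" "w k"]
  by (subst mat_linear_cong[OF dlift_eigenvalue]) auto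

lemma mat_linear_dlift_coord:
  assumes z: "z \<in> M_Omega_e n" and q: "q \<in> coords_M_e n"
  shows "\<exists>c. mat_linear n (dlift n z q) c"
  using q
proof (cases rule: coords_M_e_cases)
  case (eig k m)
  obtain w u where fr: "eig_frame m (snd z) (\<lambda>k. fst z (k, m)) w u"
    using M_Omega_e_frame[OF z eig(1)] by blast
  show ?thesis
    unfolding eig(3) using mat_linear_dlift_eigenvalue[OF z eig(1,2) fr] by blast
next
  case (entry i j)
  have "mat_linear n (dlift n z q) (\<lambda>a b. if a = i \<and> b = j then 1 else 0)"
    unfolding entry(3) using mat_linear_entry[OF entry(1,2)] by (subst mat_linear_cong[OF dlift_entry[OF z _ entry(1,2)]])
  then show ?thesis by blast
qed

text \<open>The bridge between the two notions of derivative: one \<open>a\<close> for curves, for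
  derivations and for the lifted differential.\<close>

lemma dlift_regular:
  assumes z: "z \<in> M_Omega_e n" and f: "f \<in> O_M_e n"
  obtains a where "curve_partials (coords_M_e n) (M_Omega_e n) z f a"
    and "derivation_partials (coords_M_e n) (M_Omega_e n) z f a"
    and "\<And>v. v \<in> carrier_mat n n \<Longrightarrow>
      ((\<lambda>t. f (sec n z (snd z + t \<cdot>\<^sub>m v))) has_field_derivative dlift n z f v) (at 0)"
    and "\<And>v. v \<in> carrier_mat n n \<Longrightarrow> dlift n z f v = (\<Sum>q\<in>coords_M_e n. a q * dlift n z q v)"
proof -
  obtain a where a: "curve_partials (coords_M_e n) (M_Omega_e n) z f a"
    "derivation_partials (coords_M_e n) (M_Omega_e n) z f a"
    using regular_partials[OF _ finite_coords_M_e z] f unfolding O_M_e_def by blast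
  have *: "((\<lambda>t. f (sec n z (snd z + t \<cdot>\<^sub>m v))) has_field_derivative
      (\<Sum>q\<in>coords_M_e n. a q * dlift n z q v)) (at 0)" if v: "v \<in> carrier_mat n n" for v
    using a(1)[unfolded curve_partials_def, rule_format, of "\<lambda>t. sec n z (snd z + t \<cdot>\<^sub>m v)" "\<lambda>q. dlift n z q v"]
      sec_curve[OF z v] coord_derivative[OF z v] by blast
  show ?thesis using that[OF a] * dlift_eqI[OF *] by simp
qed

lemma mat_linear_dlift:
  assumes z: "z \<in> M_Omega_e n" and f: "f \<in> O_M_e n"
  shows "\<exists>c. mat_linear n (dlift n z f) c"
proof -
  obtain a where a: "\<And>v. v \<in> carrier_mat n n \<Longrightarrow> dlift n z f v = (\<Sum>q\<in>coords_M_e n. a q * dlift n z q v)"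
    using dlift_regular[OF z f] by metis
  obtain c where "\<And>q. q \<in> coords_M_e n \<Longrightarrow> mat_linear n (dlift n z q) (c q)"
    using mat_linear_dlift_coord[OF z] by metis
  from mat_linear_sum[OF this a] show ?thesis by blast
qed

lemma trace_mat_mult:
  assumes "A \<in> carrier_mat n n" "B \<in> carrier_mat n n"
  shows "trace_mat (A * B) = (\<Sum>i<n. \<Sum>j<n. A $$ (i, j) * B $$ (j, i))"
proof -
  have dim: "dim_row (A * B) = n" using assms by auto
  show ?thesis
    unfolding trace_mat_def dim by (intro sum.cong refl mult_mat_index_sum[OF assms]) auto
qed

lemma mat_gradient_eq:
  assumes c: "mat_linear n (mat_differential f x) c"
  shows "mat_gradient n f x = Matrix.mat n n (\<lambda>(j, i). c i j)"
  unfolding mat_gradient_def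
proof (rule the_equality)
  let ?G = "Matrix.mat n n (\<lambda>(j, i). c i j)"
  have G: "?G \<in> carrier_mat n n" by simp
  have tr: "trace_mat (?G * v) = mat_differential f x v" if "v \<in> carrier_mat n n" for v
  proof -
    have "trace_mat (?G * v) = (\<Sum>i<n. \<Sum>j<n. c j i * v $$ (j, i))"
      unfolding trace_mat_mult[OF G that] by simp
    also have "\<dots> = (\<Sum>j<n. \<Sum>i<n. c j i * v $$ (j, i))" by (rule sum.swap)
    finally show ?thesis using c that by (simp add: mat_linear_def)
  qed
  then show "?G \<in> carrier_mat n n \<and> (\<forall>v\<in>carrier_mat n n. trace_mat (?G * v) = mat_differential f x v)"
    by simp
  fix A assume A: "A \<in> carrier_mat n n \<and> (\<forall>v\<in>carrier_mat n n. trace_mat (A * v) = mat_differential f x v)"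
  show "A = ?G"
  proof (rule eq_matI)
    fix i j assume "i < dim_row ?G" "j < dim_col ?G"
    then have ij: "i < n" "j < n" by auto
    \<comment> \<open>The elementary matrix with its 1 at (j, i), so that the trace of B E is the
      entry (i, j) of B.\<close>
    define E where "E = Matrix.mat n n (\<lambda>(a, b). if a = j \<and> b = i then 1 else (0::complex))"
    have E: "E \<in> carrier_mat n n" by (simp add: E_def)
    have *: "trace_mat (B * E) = B $$ (i, j)" if B: "B \<in> carrier_mat n n" for B
    proof -
      have "trace_mat (B * E) = (\<Sum>a<n. \<Sum>b<n. if b = j \<and> a = i then B $$ (i, j) else 0)"
        unfolding trace_mat_mult[OF B E] by (intro sum.cong refl) (auto simp: E_def)
      also have "\<dots> = (\<Sum>a<n. if a = i then B $$ (i, j) else 0)"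
        using ij by (intro sum.cong refl) auto
      finally show ?thesis using ij by simp
    qed
    show "A $$ (i, j) = ?G $$ (i, j)"
      using *[of A] *[OF G] A tr[OF E] E by simp
  qed (use A in auto)
qed

text \<open>By cyclicity of the trace, tr(x [A, B]) = tr([x, A] B) for the gradients A and B, and
  this is the derivative of g along [x, A]. The matrix in the conclusion is [x, A] with A the
  transpose of c.\<close>

lemma lifted_bracket_eq:
  assumes z: "z \<in> M_Omega_e n" and c: "mat_linear n (dlift n z f) c" and d: "mat_linear n (dlift n z g) d"
  shows "lifted_bracket n f g z = dlift n z g (Matrix.mat n n (\<lambda>(i, j).
     (\<Sum>l<n. snd z $$ (i, l) * c j l) - (\<Sum>l<n. c l i * snd z $$ (l, j))))"
proof -
  let ?x = "snd z"
  define A where "A = Matrix.mat n n (\<lambda>(j, i). c i j)"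
  define B where "B = Matrix.mat n n (\<lambda>(j, i). d i j)"
  have x: "?x \<in> carrier_mat n n" using M_Omega_eD[OF z] by simp
  have AB: "A \<in> carrier_mat n n" "B \<in> carrier_mat n n" by (auto simp: A_def B_def)
  have gA: "mat_gradient n (f \<circ> sec n z) ?x = A"
    unfolding A_def using c by (intro mat_gradient_eq) (simp add: dlift_def[abs_def])
  have gB: "mat_gradient n (g \<circ> sec n z) ?x = B"
    unfolding B_def using d by (intro mat_gradient_eq) (simp add: dlift_def[abs_def])
  have "lifted_bracket n f g z = trace_mat (?x * (A * B - B * A))"
    unfolding lifted_bracket_sec[OF z] mat_bracket_def gA gB by simp
  also have "\<dots> = (\<Sum>i<n. \<Sum>l<n. ?x $$ (i, l) * (A * B - B * A) $$ (l, i))"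
    by (rule trace_mat_mult[OF x]) (use AB in auto)
  also have "\<dots> = (\<Sum>i<n. \<Sum>l<n. ?x $$ (i, l) * ((\<Sum>j<n. c j l * d i j) - (\<Sum>j<n. d j l * c i j)))"
  proof (intro sum.cong refl arg_cong[of _ _ "\<lambda>a. _ * a"])
    fix i l assume "i \<in> {..<n}" "l \<in> {..<n}"
    then have il: "i < n" "l < n" by auto
    have "(A * B - B * A) $$ (l, i) = (A * B) $$ (l, i) - (B * A) $$ (l, i)"
      using AB il by auto
    then show "(A * B - B * A) $$ (l, i) = (\<Sum>j<n. c j l * d i j) - (\<Sum>j<n. d j l * c i j)"
      unfolding mult_mat_index_sum[OF AB il(2,1)] mult_mat_index_sum[OF AB(2,1) il(2,1)]
      using il by (simp add: A_def B_def)
  qed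
  also have "\<dots> = (\<Sum>i<n. \<Sum>l<n. \<Sum>j<n. d i j * (?x $$ (i, l) * c j l))
      - (\<Sum>i<n. \<Sum>l<n. \<Sum>j<n. d j l * (c i j * ?x $$ (i, l)))"
    by (simp add: algebra_simps sum_subtractf sum_distrib_left)
  also have "(\<Sum>i<n. \<Sum>l<n. \<Sum>j<n. d i j * (?x $$ (i, l) * c j l)) = (\<Sum>i<n. \<Sum>j<n. d i j * (\<Sum>l<n. ?x $$ (i, l) * c j l))"
    unfolding sum_distrib_left by (rule sum.cong[OF refl], rule sum.swap)
  also have "(\<Sum>i<n. \<Sum>l<n. \<Sum>j<n. d j l * (c i j * ?x $$ (i, l))) = (\<Sum>j<n. \<Sum>l<n. d j l * (\<Sum>i<n. c i j * ?x $$ (i, l)))"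
  proof -
    have "(\<Sum>i<n. \<Sum>l<n. \<Sum>j<n. d j l * (c i j * ?x $$ (i, l))) = (\<Sum>i<n. \<Sum>j<n. \<Sum>l<n. d j l * (c i j * ?x $$ (i, l)))"
      by (rule sum.cong[OF refl], rule sum.swap)
    also have "\<dots> = (\<Sum>j<n. \<Sum>i<n. \<Sum>l<n. d j l * (c i j * ?x $$ (i, l)))" by (rule sum.swap)
    also have "\<dots> = (\<Sum>j<n. \<Sum>l<n. \<Sum>i<n. d j l * (c i j * ?x $$ (i, l)))"
      by (rule sum.cong[OF refl], rule sum.swap)
    finally show ?thesis by (simp add: sum_distrib_left)
  qed
  finally show ?thesis
    using d by (simp add: mat_linear_def sum_subtractf algebra_simps)
qed

text \<open>The first argument enters the bracket only through its differential at z, so linear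
  relations between differentials pass to brackets.\<close>

lemma lifted_bracket_linear:
  assumes z: "z \<in> M_Omega_e n" and g: "mat_linear n (dlift n z g) d" and h: "\<And>p. p \<in> I \<Longrightarrow> mat_linear n (dlift n z (h p)) (c p)"
    and f: "\<And>v. v \<in> carrier_mat n n \<Longrightarrow> dlift n z f v = (\<Sum>p\<in>I. b p * dlift n z (h p) v)"
  shows "lifted_bracket n f g z = (\<Sum>p\<in>I. b p * lifted_bracket n (h p) g z)"
proof -
  let ?x = "snd z"
  let ?V = "\<lambda>p i j. (\<Sum>l<n. ?x $$ (i, l) * c p j l) - (\<Sum>l<n. c p l i * ?x $$ (l, j))"
  have "mat_linear n (dlift n z f) (\<lambda>i j. \<Sum>p\<in>I. b p * c p i j)"
    by (rule mat_linear_sum[OF h f])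
  from lifted_bracket_eq[OF z this g]
  have "lifted_bracket n f g z = dlift n z g (Matrix.mat n n (\<lambda>(i, j).
     (\<Sum>l<n. ?x $$ (i, l) * (\<Sum>p\<in>I. b p * c p j l)) - (\<Sum>l<n. (\<Sum>p\<in>I. b p * c p l i) * ?x $$ (l, j))))" .
  also have "(\<lambda>(i, j). (\<Sum>l<n. ?x $$ (i, l) * (\<Sum>p\<in>I. b p * c p j l)) - (\<Sum>l<n. (\<Sum>p\<in>I. b p * c p l i) * ?x $$ (l, j)))
      = (\<lambda>(i, j). \<Sum>p\<in>I. b p * ?V p i j)"
  proof (intro ext, clarify)
    fix i j
    have "(\<Sum>l<n. ?x $$ (i, l) * (\<Sum>p\<in>I. b p * c p j l)) = (\<Sum>p\<in>I. b p * (\<Sum>l<n. ?x $$ (i, l) * c p j l))"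
      unfolding sum_distrib_left by (subst sum.swap) (simp add: mult.left_commute)
    moreover have "(\<Sum>l<n. (\<Sum>p\<in>I. b p * c p l i) * ?x $$ (l, j)) = (\<Sum>p\<in>I. b p * (\<Sum>l<n. c p l i * ?x $$ (l, j)))"
      unfolding sum_distrib_left sum_distrib_right by (subst sum.swap) (simp add: mult.assoc)
    ultimately show "(\<Sum>l<n. ?x $$ (i, l) * (\<Sum>p\<in>I. b p * c p j l)) - (\<Sum>l<n. (\<Sum>p\<in>I. b p * c p l i) * ?x $$ (l, j))
      = (\<Sum>p\<in>I. b p * ?V p i j)"
      by (simp add: right_diff_distrib sum_subtractf)
  qed
  also have "dlift n z g (Matrix.mat n n \<dots>) = (\<Sum>p\<in>I. b p * dlift n z g (Matrix.mat n n (\<lambda>(i, j). ?V p i j)))"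
    by (rule mat_linear_combination[OF g])
  also have "\<dots> = (\<Sum>p\<in>I. b p * lifted_bracket n (h p) g z)"
    by (intro sum.cong refl) (simp add: lifted_bracket_eq[OF z h g])
  finally show ?thesis .
qed

lemma lifted_bracket_eigenvalue:
  assumes z: "z \<in> M_Omega_e n" and m: "m \<in> {1..n}" and k: "k \<in> {1..m}"
    and fr: "eig_frame m (snd z) (\<lambda>k. fst z (k, m)) w u" and g: "mat_linear n (dlift n z g) d"
  shows "lifted_bracket n (\<lambda>z. fst z (k, m)) g z =
    dlift n z g (Matrix.mat n n (\<lambda>(i, j). eig_dir m (snd z) (w k) (u k) i j))"
proof -
  let ?x = "snd z"
  have "(\<Sum>l<n. ?x $$ (i, l) * eig_grad m (u k) (w k) j l) - (\<Sum>l<n. eig_grad m (u k) (w k) l i * ?x $$ (l, j))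
     = eig_dir m ?x (w k) (u k) i j" for i j
  proof -
    have "(\<Sum>l<n. ?x $$ (i, l) * eig_grad m (u k) (w k) j l) = (\<Sum>l<m. ?x $$ (i, l) * (w k l * (if j < m then u k j else 0)))"
      using m by (intro sum.mono_neutral_cong_right) (auto simp: eig_grad_def)
    moreover have "(\<Sum>l<n. eig_grad m (u k) (w k) l i * ?x $$ (l, j)) = (\<Sum>l<m. (if i < m then w k i else 0) * (u k l * ?x $$ (l, j)))"
      using m by (intro sum.mono_neutral_cong_right) (auto simp: eig_grad_def)
    ultimately show ?thesis unfolding eig_dir_def sum_distrib_left sum_distrib_right by (simp add: mult.assoc)
  qed
  then show ?thesis
    using lifted_bracket_eq[OF z mat_linear_dlift_eigenvalue[OF z m k fr] g] by simp
qed

subsection \<open>The flow of an eigenvalue\<close>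

lemma eigenvalueI:
  assumes "\<And>i. i < m \<Longrightarrow> (\<Sum>j<m. y $$ (i, j) * v j) = c * v i" and "\<exists>i<m. v i \<noteq> 0"
  shows "eigenvalue (block m y) c"
proof -
  let ?v = "Matrix.vec m v"
  have "block m y *\<^sub>v ?v = c \<cdot>\<^sub>v ?v"
  proof (rule eq_vecI)
    fix i assume "i < dim_vec (c \<cdot>\<^sub>v ?v)"
    then have i: "i < m" by simp
    then show "(block m y *\<^sub>v ?v) $ i = (c \<cdot>\<^sub>v ?v) $ i"
      using assms(1)[OF i] by (simp add: scalar_prod_def atLeast0LessThan block_def)
  qed simp
  moreover have "?v \<noteq> 0\<^sub>v m"
  proof
    assume "?v = 0\<^sub>v m"
    then have "v i = 0" if "i < m" for i using that by (metis index_vec index_zero_vec(1))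
    with assms(2) show False by blast
  qed
  ultimately show ?thesis unfolding eigenvalue_def eigenvector_def by (intro exI[of _ ?v]) simp
qed

text \<open>Conjugation of \<open>x\<close> by \<open>exp (s w u) = 1 + (exp s - 1) w u\<close>, multiplied out; here \<open>u w = 1\<close> and \<open>u x w = c\<close>.\<close>

definition eig_flow ::
  "nat \<Rightarrow> nat \<Rightarrow> complex mat \<Rightarrow> complex \<Rightarrow> (nat \<Rightarrow> complex) \<Rightarrow> (nat \<Rightarrow> complex) \<Rightarrow> complex \<Rightarrow> complex mat" where
  "eig_flow n m x c w u s = Matrix.mat n n (\<lambda>(i, j). x $$ (i, j)
     + (exp s - 1) * ((if i < m then w i else 0) * (\<Sum>l<m. u l * x $$ (l, j)))
     + (exp (- s) - 1) * ((\<Sum>l<m. x $$ (i, l) * w l) * (if j < m then u j else 0))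
     + (exp s - 1) * (exp (- s) - 1) * c * ((if i < m then w i else 0) * (if j < m then u j else 0)))"

lemma eig_flow_0: "x \<in> carrier_mat n n \<Longrightarrow> eig_flow n m x c w u 0 = x"
  by (intro eq_matI) (auto simp: eig_flow_def)

lemma eig_flow_carrier[simp]: "eig_flow n m x c w u s \<in> carrier_mat n n"
  by (simp add: eig_flow_def)

text \<open>A form of exp s exp (- s) = 1 that turns the doubly scaled term of the flow into a sum
  of singly scaled ones.\<close>

lemma exp_minus_relation: "(exp s - 1) * (exp (- s) - 1) = - ((exp s - 1) + (exp (- s) - 1 :: complex))"
  by (simp add: algebra_simps exp_minus field_simps)

lemma exp_rearrange:
  fixes E F U A c :: complex
  shows "U + (E - 1) * U * 1 + (F - 1) * A * c + - ((E - 1) + (F - 1)) * c * A * 1 = E * U + (1 - E) * c * A"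
    and "U + (F - 1) * U * 1 + (E - 1) * A * c + - ((E - 1) + (F - 1)) * c * A * 1 = F * U + (1 - F) * c * A"
  by (simp_all add: algebra_simps)

context
  fixes n m :: nat and x :: "complex mat" and l :: "nat \<Rightarrow> complex" and w u :: "nat \<Rightarrow> nat \<Rightarrow> complex" and k :: nat
  assumes fr: "eig_frame m x l w u" and k: "k \<in> {1..m}" and mn: "m \<le> n"
begin

private abbreviation "fl s \<equiv> eig_flow n m x (l k) (w k) (u k) s"
private abbreviation "ew i \<equiv> (if i < m then w k i else 0)"
private abbreviation "eu j \<equiv> (if j < m then u k j else 0)"
private abbreviation "ux j \<equiv> (\<Sum>i<m. u k i * x $$ (i, j))"
private abbreviation "xw i \<equiv> (\<Sum>j<m. x $$ (i, j) * w k j)"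

lemma eig_flow_index: "i < n \<Longrightarrow> j < n \<Longrightarrow> fl s $$ (i, j) = x $$ (i, j)
     + (exp s - 1) * (ew i * ux j) + (exp (- s) - 1) * (xw i * eu j)
     + (exp s - 1) * (exp (- s) - 1) * l k * (ew i * eu j)"
  by (simp add: eig_flow_def)

text \<open>The projection w u commutes with the m-th block of x, so conjugation by its exponential
  fixes this block.\<close>

lemma eig_flow_block: "i < m \<Longrightarrow> j < m \<Longrightarrow> fl s $$ (i, j) = x $$ (i, j)"
  using eig_frameD(1,2)[OF fr k] mn
  by (simp add: eig_flow_index exp_minus_relation) (simp add: algebra_simps)

lemma eig_flow_column: "i < m \<Longrightarrow> m \<le> j \<Longrightarrow> j < n \<Longrightarrow> fl s $$ (i, j) = x $$ (i, j) + (exp s - 1) * (w k i * ux j)"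
  using mn by (simp add: eig_flow_index)

lemma eig_flow_frame: "eig_frame m (fl s) l w u"
  using fr by (subst eig_frame_cong[of m _ x]) (auto simp: eig_flow_block)

text \<open>With g = exp (s w u) the row u satisfies u g = exp(s) u. Columns from m on are untouched
  by the inverse of g and are scaled by exp s; inside the block the two terms add up to the constant
  value l_k u.\<close>

lemma eig_flow_ux:
  assumes "j < n"
  shows "(\<Sum>i<m. u k i * fl s $$ (i, j)) = exp s * ux j + (1 - exp s) * l k * eu j"
proof -
  have uw: "(\<Sum>i<m. u k i * w k i) = 1" using eig_frameD(3)[OF fr k k] by simp
  have uxw: "(\<Sum>i<m. u k i * xw i) = l k"
  proof -
    have "(\<Sum>i<m. u k i * xw i) = (\<Sum>i<m. l k * (u k i * w k i))"
      using eig_frameD(1)[OF fr k] by (intro sum.cong) auto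
    then show ?thesis by (simp add: sum_distrib_left[symmetric] uw)
  qed
  have "(\<Sum>i<m. u k i * fl s $$ (i, j)) = (\<Sum>i<m. u k i * x $$ (i, j)
     + (exp s - 1) * ux j * (u k i * w k i) + (exp (- s) - 1) * eu j * (u k i * xw i)
     + (exp s - 1) * (exp (- s) - 1) * l k * eu j * (u k i * w k i))"
  proof (intro sum.cong refl)
    fix i assume "i \<in> {..<m}"
    then have i: "i < n" "i < m" using mn by auto
    show "u k i * fl s $$ (i, j) = u k i * x $$ (i, j)
     + (exp s - 1) * ux j * (u k i * w k i) + (exp (- s) - 1) * eu j * (u k i * xw i)
     + (exp s - 1) * (exp (- s) - 1) * l k * eu j * (u k i * w k i)"
      unfolding eig_flow_index[OF i(1) assms] using i(2) by (simp only: if_True algebra_simps)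
  qed
  also have "\<dots> = ux j + (exp s - 1) * ux j * 1 + (exp (- s) - 1) * eu j * l k + (exp s - 1) * (exp (- s) - 1) * l k * eu j * 1"
    unfolding sum.distrib sum_distrib_left[symmetric] uw uxw ..
  also have "\<dots> = exp s * ux j + (1 - exp s) * l k * eu j"
    unfolding exp_minus_relation by (rule exp_rearrange)
  finally show ?thesis .
qed

lemma eig_flow_xw:
  assumes "i < n"
  shows "(\<Sum>j<m. fl s $$ (i, j) * w k j) = exp (- s) * xw i + (1 - exp (- s)) * l k * ew i"
proof -
  have uw: "(\<Sum>i<m. u k i * w k i) = 1" using eig_frameD(3)[OF fr k k] by simp
  have uxw: "(\<Sum>i<m. ux i * w k i) = l k"
  proof -
    have "(\<Sum>i<m. ux i * w k i) = (\<Sum>i<m. l k * (u k i * w k i))"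
      using eig_frameD(2)[OF fr k] by (intro sum.cong) auto
    then show ?thesis by (simp add: sum_distrib_left[symmetric] uw)
  qed
  have "(\<Sum>j<m. fl s $$ (i, j) * w k j) = (\<Sum>j<m. x $$ (i, j) * w k j
     + (exp s - 1) * ew i * (ux j * w k j) + (exp (- s) - 1) * xw i * (u k j * w k j)
     + (exp s - 1) * (exp (- s) - 1) * l k * ew i * (u k j * w k j))"
  proof (intro sum.cong refl)
    fix j assume "j \<in> {..<m}"
    then have j: "j < n" "j < m" using mn by auto
    show "fl s $$ (i, j) * w k j = x $$ (i, j) * w k j
     + (exp s - 1) * ew i * (ux j * w k j) + (exp (- s) - 1) * xw i * (u k j * w k j)
     + (exp s - 1) * (exp (- s) - 1) * l k * ew i * (u k j * w k j)"
      unfolding eig_flow_index[OF assms j(1)] using j(2) by (simp only: if_True algebra_simps)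
  qed
  also have "\<dots> = xw i + (exp s - 1) * ew i * l k + (exp (- s) - 1) * xw i * 1 + (exp s - 1) * (exp (- s) - 1) * l k * ew i * 1"
    unfolding sum.distrib sum_distrib_left[symmetric] uw uxw ..
  also have "\<dots> = xw i + (exp (- s) - 1) * xw i * 1 + (exp s - 1) * ew i * l k + (exp s - 1) * (exp (- s) - 1) * l k * ew i * 1"
    by (rule arg_cong[of _ _ "\<lambda>a. a + _"]) (simp only: ac_simps)
  also have "\<dots> = exp (- s) * xw i + (1 - exp (- s)) * l k * ew i"
    unfolding exp_minus_relation by (rule exp_rearrange)
  finally show ?thesis .
qed

text \<open>Conjugation by exp (s w u) moves y = \<open>fl s\<close> in the direction [w u, y], the
  negative of \<open>eig_dir\<close>. Since w and u stay eigenvectors along the flow, the same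
  vectors occur at every time.\<close>

lemma eig_flow_derivative:
  assumes "i < n" "j < n"
  shows "((\<lambda>s. fl s $$ (i, j)) has_field_derivative - eig_dir m (fl s) (w k) (u k) i j) (at s)"
proof -
  have "((\<lambda>s. fl s $$ (i, j)) has_field_derivative exp s * (ew i * ux j) - exp (- s) * (xw i * eu j)
      - (exp s - exp (- s)) * l k * (ew i * eu j)) (at s)"
    unfolding eig_flow_index[OF assms] exp_minus_relation
  proof -
    have "((\<lambda>s. X + (exp s - 1) * A + (exp (- s) - 1) * B + - ((exp s - 1) + (exp (- s) - 1)) * c * C)
      has_field_derivative exp s * A - exp (- s) * B - (exp s - exp (- s)) * c * C) (at s)" for X A B C c :: complex
      by (auto intro!: derivative_eq_intros simp: algebra_simps)
    then show "((\<lambda>s. x $$ (i, j) + (exp s - 1) * (ew i * ux j) + (exp (- s) - 1) * (xw i * eu j)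
      + - ((exp s - 1) + (exp (- s) - 1)) * l k * (ew i * eu j)) has_field_derivative exp s * (ew i * ux j)
      - exp (- s) * (xw i * eu j) - (exp s - exp (- s)) * l k * (ew i * eu j)) (at s)" .
  qed
  moreover have "- eig_dir m (fl s) (w k) (u k) i j = exp s * (ew i * ux j) - exp (- s) * (xw i * eu j)
      - (exp s - exp (- s)) * l k * (ew i * eu j)"
  proof -
    have "- ((F * B + (1 - F) * c * W) * V - W * (E * A + (1 - E) * c * V)) = E * (W * A) - F * (B * V) - (E - F) * c * (W * V)"
      for A B E F W V c :: complex by (simp add: algebra_simps)
    then show ?thesis unfolding eig_dir_def eig_flow_ux[OF assms(2)] eig_flow_xw[OF assms(1)] .
  qed
  ultimately show ?thesis by (simp only:)
qed

lemma eig_flow_eigenvalue: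
  assumes fr': "eig_frame m' x l' w' u'" and k': "k' \<in> {1..m'}" and mm: "m \<le> m'" "m' \<le> n"
  shows "eigenvalue (block m' (fl s)) (l' k')"
proof (rule eigenvalueI)
  define a where "a = (\<Sum>i<m. u k i * w' k' i)"
  \<comment> \<open>The transported eigenvector g w' = w' + (exp s - 1) (u w') w.\<close>
  let ?v = "\<lambda>i. w' k' i + (exp s - 1) * a * ew i"
  have uw: "(\<Sum>i<m. u k i * w k i) = 1" using eig_frameD(3)[OF fr k k] by simp
  have pad: "(\<Sum>i<m'. f i * ew i) = (\<Sum>i<m. f i * w k i)" "(\<Sum>i<m'. eu i * f i) = (\<Sum>i<m. u k i * f i)" for f :: "nat \<Rightarrow> complex"
    using mm by (auto intro!: sum.mono_neutral_cong_right split: if_splits)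
  show "(\<Sum>j<m'. fl s $$ (i, j) * ?v j) = l' k' * ?v i" if i: "i < m'" for i
  proof -
    have xw': "(\<Sum>j<m'. x $$ (i, j) * w' k' j) = l' k' * w' k' i" by (rule eig_frameD(1)[OF fr' k' i])
    have uxw': "(\<Sum>j<m'. ux j * w' k' j) = l' k' * a"
    proof -
      have "(\<Sum>j<m'. ux j * w' k' j) = (\<Sum>i<m. u k i * (\<Sum>j<m'. x $$ (i, j) * w' k' j))"
        unfolding sum_distrib_left sum_distrib_right by (subst sum.swap) (simp add: mult.assoc)
      also have "\<dots> = (\<Sum>i<m. l' k' * (u k i * w' k' i))"
        using eig_frameD(1)[OF fr' k'] mm by (intro sum.cong) auto
      finally show ?thesis by (simp add: a_def sum_distrib_left)
    qed
    have euw': "(\<Sum>j<m'. eu j * w' k' j) = a" unfolding pad a_def ..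
    have 1: "(\<Sum>j<m'. fl s $$ (i, j) * w' k' j) = l' k' * w' k' i + (exp s - 1) * ew i * (l' k' * a)
        + (exp (- s) - 1) * xw i * a + (exp s - 1) * (exp (- s) - 1) * l k * ew i * a"
    proof -
      have "(\<Sum>j<m'. fl s $$ (i, j) * w' k' j) = (\<Sum>j<m'. x $$ (i, j) * w' k' j
         + (exp s - 1) * ew i * (ux j * w' k' j) + (exp (- s) - 1) * xw i * (eu j * w' k' j)
         + (exp s - 1) * (exp (- s) - 1) * l k * ew i * (eu j * w' k' j))"
      proof (intro sum.cong refl)
        fix j assume "j \<in> {..<m'}"
        then have ij: "i < n" "j < n" using i mm by auto
        show "fl s $$ (i, j) * w' k' j = x $$ (i, j) * w' k' j
         + (exp s - 1) * ew i * (ux j * w' k' j) + (exp (- s) - 1) * xw i * (eu j * w' k' j)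
         + (exp s - 1) * (exp (- s) - 1) * l k * ew i * (eu j * w' k' j)"
          unfolding eig_flow_index[OF ij] by (simp only: algebra_simps)
      qed
      then show ?thesis
        unfolding sum.distrib sum_distrib_left[symmetric] uxw' euw' xw' .
    qed
    have 2: "(\<Sum>j<m'. fl s $$ (i, j) * ew j) = exp (- s) * xw i + (1 - exp (- s)) * l k * ew i"
      unfolding pad by (rule eig_flow_xw) (use i mm in simp)
    have "(\<Sum>j<m'. fl s $$ (i, j) * ?v j) = (\<Sum>j<m'. fl s $$ (i, j) * w' k' j) + (exp s - 1) * a * (\<Sum>j<m'. fl s $$ (i, j) * ew j)"
      unfolding sum_distrib_left sum.distrib[symmetric] by (intro sum.cong refl) (simp only: algebra_simps)
    also have "\<dots> = l' k' * ?v i + a * xw i * ((exp (- s) - 1) + (exp s - 1) * exp (- s))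
        + a * l k * ew i * (exp s - 1) * ((exp (- s) - 1) + (1 - exp (- s)))"
      unfolding 1 2 by (simp only: algebra_simps)
    also have "(exp (- s) - 1) + (exp s - 1) * exp (- s) = 0"
      by (simp add: algebra_simps exp_minus)
    finally show ?thesis by simp
  qed
  \<comment> \<open>If it vanished, applying u would give exp s times a = 0. Then a = 0, the
    correction disappears, and w' itself would be zero.\<close>
  show "\<exists>i<m'. ?v i \<noteq> 0"
  proof (rule ccontr)
    assume "\<not> ?thesis"
    then have v0: "?v i = 0" if "i < m'" for i using that by blast
    have "(\<Sum>i<m. u k i * ?v i) = a + (exp s - 1) * a * (\<Sum>i<m. u k i * w k i)"
      unfolding a_def sum_distrib_left sum.distrib[symmetric] by (intro sum.cong refl) (simp add: algebra_simps)
    moreover have "(\<Sum>i<m. u k i * ?v i) = 0"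
    proof (intro sum.neutral ballI)
      fix i assume "i \<in> {..<m}"
      then have "i < m'" using mm by simp
      then show "u k i * ?v i = 0" by (simp only: v0 mult_zero_right)
    qed
    ultimately have "exp s * a = 0" by (simp add: uw algebra_simps)
    then have "a = 0" by simp
    then have "w' k' i = 0" if "i < m'" for i using v0[OF that] by simp
    then show False using eig_frameD(3)[OF fr' k' k'] by simp
  qed
qed

end

text \<open>Blocks of size at least m are conjugated and keep their eigenvalues; smaller ones lie
  inside the m-th block, which does not change.\<close>

lemma eig_flow_mem:
  assumes z: "z \<in> M_Omega_e n" and m: "m \<in> {1..n}" and k: "k \<in> {1..m}"
    and fr: "eig_frame m (snd z) (\<lambda>k. fst z (k, m)) w u"
  shows "(fst z, eig_flow n m (snd z) (fst z (k, m)) (w k) (u k) s) \<in> M_Omega_e n"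
  unfolding M_Omega_e_iff
proof (intro conjI ballI)
  show nu: "fst z \<in> e_Omega n" by (rule M_Omega_eD[OF z])
  have mn: "m \<le> n" using m by simp
  fix m' assume m': "m' \<in> {1..n}"
  obtain w' u' where fr': "eig_frame m' (snd z) (\<lambda>k. fst z (k, m')) w' u'"
    using M_Omega_e_frame[OF z m'] by blast
  show "\<exists>w' u'. eig_frame m' (eig_flow n m (snd z) (fst z (k, m)) (w k) (u k) s) (\<lambda>k. fst z (k, m')) w' u'"
  proof (cases "m \<le> m'")
    case True
    show ?thesis
      by (intro eigenvalues_imp_eig_frame e_Omega_inj[OF nu m'] eig_flow_eigenvalue[OF fr k mn fr'])
        (use True m' in auto)
  next
    case False
    then have "eig_frame m' (eig_flow n m (snd z) (fst z (k, m)) (w k) (u k) s) (\<lambda>k. fst z (k, m')) w' u'"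
      using fr' eig_flow_block[OF fr k mn] by (subst eig_frame_cong[of m' _ "snd z"]) auto
    then show ?thesis by blast
  qed
qed simp

lemma eig_dir_tangent:
  assumes z: "z \<in> M_Omega_e n" and m: "m \<in> {1..n}" and k: "k \<in> {1..m}"
    and fr: "eig_frame m (snd z) (\<lambda>k. fst z (k, m)) w u"
    and m': "m' \<in> {1..n}" and k': "k' \<in> {1..m'}"
  shows "dlift n z (\<lambda>z. fst z (k', m')) (Matrix.mat n n (\<lambda>(i, j). eig_dir m (snd z) (w k) (u k) i j)) = 0"
proof -
  obtain w' u' where fr': "eig_frame m' (snd z) (\<lambda>k. fst z (k, m')) w' u'"
    using M_Omega_e_frame[OF z m'] by blast
  have "eig_pairing m' (u' k') (w' k') (\<lambda>i j. Matrix.mat n n (\<lambda>(i, j). eig_dir m (snd z) (w k) (u k) i j) $$ (i, j))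
     = eig_pairing m' (u' k') (w' k') (eig_dir m (snd z) (w k) (u k))"
    using m' by (intro eig_pairing_cong) auto
  also have "\<dots> = 0" by (rule eig_pairing_eig_dir[OF fr k fr' k'])
  finally show ?thesis
    by (subst dlift_eigenvalue[OF z _ m' k' fr']) auto
qed

text \<open>The flow is not a line, so its derivative is transferred by
  \<open>curve_partials\<close>: in every coordinate it moves like the lifted line along minus
  \<open>eig_dir\<close>, with the \<nu> coordinates constant. The sign is that of
  \<open>eig_flow_derivative\<close>.\<close>

lemma flow_function_derivative:
  assumes z: "z \<in> M_Omega_e n" and m: "m \<in> {1..n}" and k: "k \<in> {1..m}"
    and fr: "eig_frame m (snd z) (\<lambda>k. fst z (k, m)) w u" and f: "f \<in> O_M_e n"
  defines "\<zeta> \<equiv> \<lambda>s. (fst z, eig_flow n m (snd z) (fst z (k, m)) (w k) (u k) s)"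
  shows "((\<lambda>s. f (\<zeta> s)) has_field_derivative - lifted_bracket n (\<lambda>z. fst z (k, m)) f (\<zeta> s)) (at s)"
proof -
  have mn: "m \<le> n" using m by simp
  have \<zeta>: "\<zeta> t \<in> M_Omega_e n" for t unfolding \<zeta>_def by (rule eig_flow_mem[OF z m k fr])
  have fr': "eig_frame m (snd (\<zeta> s)) (\<lambda>k. fst (\<zeta> s) (k, m)) w u"
    using eig_flow_frame[OF fr k mn] by (simp add: \<zeta>_def)
  let ?V = "Matrix.mat n n (\<lambda>(i, j). eig_dir m (snd (\<zeta> s)) (w k) (u k) i j)"
  have V: "?V \<in> carrier_mat n n" by simp
  obtain a where a: "curve_partials (coords_M_e n) (M_Omega_e n) (\<zeta> s) f a"
    "\<And>v. v \<in> carrier_mat n n \<Longrightarrow> dlift n (\<zeta> s) f v = (\<Sum>q\<in>coords_M_e n. a q * dlift n (\<zeta> s) q v)"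
    using dlift_regular[OF \<zeta> f] by metis
  \<comment> \<open>Time is shifted by s because \<open>curve_partials\<close> differentiates at
    0.\<close>
  have "((\<lambda>t. q (\<zeta> (t + s))) has_field_derivative - dlift n (\<zeta> s) q ?V) (at 0)" if "q \<in> coords_M_e n" for q
    using that
  proof (cases rule: coords_M_e_cases)
    case (eig k' m')
    show ?thesis unfolding eig(3) eig_dir_tangent[OF \<zeta> m k fr' eig(1,2)] by (simp add: \<zeta>_def)
  next
    case (entry i j)
    have "((\<lambda>t. snd (\<zeta> t) $$ (i, j)) has_field_derivative - ?V $$ (i, j)) (at (0 + s))"
      using eig_flow_derivative[OF fr k mn entry(1,2), of s] entry by (simp add: \<zeta>_def)
    then have "((\<lambda>t. snd (\<zeta> (t + s)) $$ (i, j)) has_field_derivative - ?V $$ (i, j)) (at 0)"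
      by (simp only: DERIV_shift)
    then show ?thesis unfolding entry(3) dlift_entry[OF \<zeta> V entry(1,2)] .
  qed
  then have "((\<lambda>t. f (\<zeta> (t + s))) has_field_derivative (\<Sum>q\<in>coords_M_e n. a q * - dlift n (\<zeta> s) q ?V)) (at 0)"
    using a(1)[unfolded curve_partials_def, rule_format, of "\<lambda>t. \<zeta> (t + s)" "\<lambda>q. - dlift n (\<zeta> s) q ?V"] \<zeta> by simp
  moreover have "(\<Sum>q\<in>coords_M_e n. a q * - dlift n (\<zeta> s) q ?V) = - dlift n (\<zeta> s) f ?V"
    unfolding a(2)[OF V] by (simp add: sum_negf)
  moreover have "dlift n (\<zeta> s) f ?V = lifted_bracket n (\<lambda>z. fst z (k, m)) f (\<zeta> s)"
    using mat_linear_dlift[OF \<zeta> f] lifted_bracket_eigenvalue[OF \<zeta> m k fr'] by metis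
  ultimately have "((\<lambda>t. f (\<zeta> (t + s))) has_field_derivative - lifted_bracket n (\<lambda>z. fst z (k, m)) f (\<zeta> s)) (at 0)"
    by simp
  then show ?thesis
    using DERIV_shift[of "\<lambda>t. f (\<zeta> t)" _ 0 s] by simp
qed

subsection \<open>The algebra \<open>J(n, \<ee>)\<close> and the tangent spaces of the fibres\<close>

lemma M_Omega_e_flag:
  assumes z: "z \<in> M_Omega_e n"
  obtains w u where "eig_flag n (snd z) (\<lambda>m k. fst z (k, m)) w u"
proof -
  have "\<forall>m. \<exists>w u. m \<in> {1..n} \<longrightarrow> eig_frame m (snd z) (\<lambda>k. fst z (k, m)) w u"
    using M_Omega_e_frame[OF z] by blast
  then obtain w u where *: "\<And>m. m \<in> {1..n} \<Longrightarrow> eig_frame m (snd z) (\<lambda>k. fst z (k, m)) (w m) (u m)"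
    by metis
  have "eig_flag n (snd z) (\<lambda>m k. fst z (k, m)) w u"
  proof
    fix m assume m: "m \<in> {1..<n}"
    show "(\<lambda>k. fst z (k, m)) ` {1..m} \<inter> (\<lambda>k. fst z (k, Suc m)) ` {1..Suc m} = {}"
      using e_Omega_disj[OF M_Omega_eD(1)[OF z] m] by auto
  qed (rule *)
  then show ?thesis by (rule that)
qed

lemma sum_eig_index: "(\<Sum>p\<in>eig_index N. F p) = (\<Sum>m\<in>{1..N}. \<Sum>k\<in>{1..m}. F (k, m))"
proof -
  have "(\<Sum>m\<in>{1..N}. \<Sum>k\<in>{1..m}. F (k, m)) = (\<Sum>(m, k)\<in>Sigma {1..N} (\<lambda>m. {1..m}). F (k, m))"
    by (rule sum.Sigma) auto
  also have "\<dots> = (\<Sum>p\<in>eig_index N. F p)"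
    by (rule sum.reindex_bij_witness[of _ prod.swap prod.swap]) (auto simp: eig_index_def)
  finally show ?thesis by simp
qed

lemma eig_index_mono: "N \<le> n \<Longrightarrow> eig_index N \<subseteq> eig_index n"
  by (auto simp: eig_index_def)

lemma coordinate_mem:
  assumes "p \<in> eig_index n" shows "(\<lambda>z. fst z p) \<in> coords_M_e n"
  using assms by (auto simp: coords_M_e_def)

lemma entry_coordinate_mem:
  assumes "i < n" "j < n" shows "(\<lambda>z. snd z $$ (i, j)) \<in> coords_M_e n"
  unfolding coords_M_e_def using assms by (intro UnI2 image_eqI[of _ _ "(i, j)"]) auto

lemma coordinate_regular:
  "q \<in> coords_M_e n \<Longrightarrow> restrict q (M_Omega_e n) \<in> O_M_e n"
  unfolding O_M_e_def by (intro polynomial_regular_funs polynomial_funs.coord)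

text \<open>Near x the section takes values in the variety, so a coordinate and its extensional
  restriction have the same differential.\<close>

lemma dlift_cong:
  assumes z: "z \<in> M_Omega_e n" and v: "v \<in> carrier_mat n n" and fg: "\<And>y. y \<in> M_Omega_e n \<Longrightarrow> f y = g y"
  shows "dlift n z f v = dlift n z g v"
proof -
  have "\<forall>\<^sub>F t in nhds 0. f (sec n z (snd z + t \<cdot>\<^sub>m v)) = g (sec n z (snd z + t \<cdot>\<^sub>m v))"
    using sec_curve(2)[OF z v] by eventually_elim (rule fg)
  then show ?thesis
    unfolding dlift_def mat_differential_def comp_def by (rule deriv_cong_ev) simp
qed

lemma lifted_bracket_cong:
  assumes z: "z \<in> M_Omega_e n" and fg: "\<And>y. y \<in> M_Omega_e n \<Longrightarrow> f y = f' y"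
    and f: "mat_linear n (dlift n z f') c" and g: "g \<in> O_M_e n"
  shows "lifted_bracket n f g z = lifted_bracket n f' g z"
proof -
  obtain d where d: "mat_linear n (dlift n z g) d" using mat_linear_dlift[OF z g] by blast
  have "mat_linear n (dlift n z f) c"
    using f by (subst mat_linear_cong[of n _ "dlift n z f'"]) (auto intro: dlift_cong[OF z _ fg])
  from lifted_bracket_eq[OF z this d] lifted_bracket_eq[OF z f d] show ?thesis by simp
qed

lemma J_e_regular:
  assumes "f \<in> J_e n" shows "f \<in> O_M_e n"
proof -
  obtain q where q: "q \<in> regular_funs (coords_e n) (e_Omega n)" "f = (\<lambda>z\<in>M_Omega_e n. q (fst z))"
    using assms unfolding J_e_def O_e_def by blast
  show ?thesis unfolding q(2) O_M_e_def
    by (rule regular_funs_pullback[OF q(1)])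
      (auto simp: coords_e_def coords_M_e_def dest: M_Omega_eD intro!: polynomial_funs.coord)
qed

lemma J_e_coordinate:
  assumes "p \<in> eig_index n" shows "(\<lambda>z\<in>M_Omega_e n. fst z p) \<in> J_e n"
proof -
  have "(\<lambda>\<nu>\<in>e_Omega n. \<nu> p) \<in> O_e n"
    unfolding O_e_def using assms by (intro polynomial_regular_funs polynomial_funs.coord) (auto simp: coords_e_def)
  moreover have "(\<lambda>z\<in>M_Omega_e n. fst z p) = (\<lambda>z\<in>M_Omega_e n. (\<lambda>\<nu>\<in>e_Omega n. \<nu> p) (fst z))"
    by (rule restrict_ext) (simp add: M_Omega_eD)
  ultimately show ?thesis unfolding J_e_def by blast
qed

lemma J_e_subalgebra: "subalgebra_of (M_Omega_e n) (O_M_e n) (J_e n)"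
  unfolding subalgebra_of_def
proof (intro conjI allI ballI subsetI)
  fix f assume "f \<in> J_e n" then show "f \<in> O_M_e n" by (rule J_e_regular)
next
  fix c
  have "(\<lambda>\<nu>\<in>e_Omega n. c) \<in> O_e n" unfolding O_e_def by (rule regular_funs_const)
  moreover have "(\<lambda>z\<in>M_Omega_e n. c) = (\<lambda>z\<in>M_Omega_e n. (\<lambda>\<nu>\<in>e_Omega n. c) (fst z))"
    by (rule restrict_ext) (simp add: M_Omega_eD)
  ultimately show "(\<lambda>z\<in>M_Omega_e n. c) \<in> J_e n" unfolding J_e_def by blast
next
  fix f g assume "f \<in> J_e n" "g \<in> J_e n"
  then obtain q r where q: "q \<in> O_e n" "f = (\<lambda>z\<in>M_Omega_e n. q (fst z))"
    and r: "r \<in> O_e n" "g = (\<lambda>z\<in>M_Omega_e n. r (fst z))" unfolding J_e_def by blast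
  have "(\<lambda>\<nu>\<in>e_Omega n. q \<nu> + r \<nu>) \<in> O_e n" "(\<lambda>\<nu>\<in>e_Omega n. q \<nu> * r \<nu>) \<in> O_e n"
    using q(1) r(1) unfolding O_e_def by (auto intro: regular_funs_add regular_funs_mult)
  moreover have "(\<lambda>z\<in>M_Omega_e n. f z + g z) = (\<lambda>z\<in>M_Omega_e n. (\<lambda>\<nu>\<in>e_Omega n. q \<nu> + r \<nu>) (fst z))"
    "(\<lambda>z\<in>M_Omega_e n. f z * g z) = (\<lambda>z\<in>M_Omega_e n. (\<lambda>\<nu>\<in>e_Omega n. q \<nu> * r \<nu>) (fst z))"
    unfolding q(2) r(2) by (intro restrict_ext; simp add: M_Omega_eD(1) del: split_paired_All)+
  ultimately show "(\<lambda>z\<in>M_Omega_e n. f z + g z) \<in> J_e n" "(\<lambda>z\<in>M_Omega_e n. f z * g z) \<in> J_e n"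
    unfolding J_e_def by blast+
qed

lemma coords_e_sum: "(\<Sum>q\<in>coords_e n. F q) = (\<Sum>p\<in>eig_index n. F (\<lambda>\<nu>. \<nu> p))"
proof -
  have "inj_on (\<lambda>p \<nu>. \<nu> p :: complex) (eig_index n)"
  proof (rule inj_onI)
    fix p q :: "nat \<times> nat" assume "(\<lambda>\<nu>. \<nu> p :: complex) = (\<lambda>\<nu>. \<nu> q)"
    from fun_cong[OF this, of "\<lambda>r. if r = p then 1 else 0"] show "p = q" by (auto split: if_splits)
  qed
  then show ?thesis unfolding coords_e_def by (simp add: sum.reindex)
qed

text \<open>The coefficients are the partial derivatives of q at \<nu>, hence common to all z in the
  fibre. This uniformity is the source of the constancy of the f_i.\<close>

lemma J_e_dlift:
  assumes f: "f \<in> J_e n" and nu: "\<nu> \<in> e_Omega n"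
  obtains b where "\<And>z v. z \<in> M_fibre n \<nu> \<Longrightarrow> v \<in> carrier_mat n n \<Longrightarrow>
    dlift n z f v = (\<Sum>p\<in>eig_index n. b p * dlift n z (\<lambda>z. fst z p) v)"
proof -
  obtain q where q: "q \<in> regular_funs (coords_e n) (e_Omega n)" "f = (\<lambda>z\<in>M_Omega_e n. q (fst z))"
    using f unfolding J_e_def O_e_def by blast
  have "finite (coords_e n)" by (simp add: coords_e_def)
  then obtain a where a: "curve_partials (coords_e n) (e_Omega n) \<nu> q a"
    using regular_partials[OF q(1) _ nu] by blast
  show ?thesis
  proof (rule that[of "\<lambda>p. a (\<lambda>\<nu>. \<nu> p)"])
    fix z :: point and v :: "complex mat" assume z: "z \<in> M_fibre n \<nu>" and v: "v \<in> carrier_mat n n"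
    then have zM: "z \<in> M_Omega_e n" and zn: "fst z = \<nu>" by (auto simp: M_fibre_def)
    let ?g = "\<lambda>t. sec n z (snd z + t \<cdot>\<^sub>m v)"
    have ev: "\<forall>\<^sub>F t in nhds 0. fst (?g t) \<in> e_Omega n"
      using sec_curve(2)[OF zM v] by eventually_elim (rule M_Omega_eD)
    have d: "((\<lambda>t. c (fst (?g t))) has_field_derivative dlift n z (\<lambda>z. c (fst z)) v) (at 0)"
      if "c \<in> coords_e n" for c
      using that coord_derivative[OF zM v, of "\<lambda>z. c (fst z)"] by (auto simp: coords_e_def coordinate_mem)
    have "((\<lambda>t. q (fst (?g t))) has_field_derivative (\<Sum>c\<in>coords_e n. a c * dlift n z (\<lambda>z. c (fst z)) v)) (at 0)"
      using a[unfolded curve_partials_def, rule_format, of "\<lambda>t. fst (?g t)" "\<lambda>c. dlift n z (\<lambda>z. c (fst z)) v"]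
        sec_curve(1)[OF zM v] ev d zn by auto
    then have "dlift n z (\<lambda>z. q (fst z)) v = (\<Sum>c\<in>coords_e n. a c * dlift n z (\<lambda>z. c (fst z)) v)"
      by (rule dlift_eqI)
    then show "dlift n z f v = (\<Sum>p\<in>eig_index n. a (\<lambda>\<nu>. \<nu> p) * dlift n z (\<lambda>z. fst z p) v)"
      unfolding coords_e_sum using dlift_cong[OF zM v, of f "\<lambda>z. q (fst z)"] by (simp add: q(2))
  qed
qed

lemma M_fibreD: "z \<in> M_fibre n \<nu> \<Longrightarrow> z \<in> M_Omega_e n" "z \<in> M_fibre n \<nu> \<Longrightarrow> fst z = \<nu>"
  by (auto simp: M_fibre_def)

lemma M_fibreI: "z \<in> M_Omega_e n \<Longrightarrow> z \<in> M_fibre n (fst z)"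
  by (auto simp: M_fibre_def)

section \<open>Brackets with the eigenvalue coordinates\<close>

definition eig_dir_mat :: "nat \<Rightarrow> complex mat \<Rightarrow> (nat \<Rightarrow> nat \<Rightarrow> nat \<Rightarrow> complex) \<Rightarrow> (nat \<Rightarrow> nat \<Rightarrow> nat \<Rightarrow> complex) \<Rightarrow> nat \<times> nat \<Rightarrow> complex mat" where
  "eig_dir_mat n x w u p = Matrix.mat n n (\<lambda>(i, j). eig_flag.dir x w u (snd p) (fst p) i j)"

lemma eig_dir_mat_carrier[simp]: "eig_dir_mat n x w u p \<in> carrier_mat n n"
  by (simp add: eig_dir_mat_def)

lemma bracket_coordinate:
  assumes z: "z \<in> M_Omega_e n" and fl: "eig_flag n (snd z) (\<lambda>m k. fst z (k, m)) w u"
    and p: "p \<in> eig_index n" and g: "g \<in> O_M_e n"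
  shows "lifted_bracket n (\<lambda>z. fst z p) g z = dlift n z g (eig_dir_mat n (snd z) w u p)"
proof -
  interpret eig_flag n "snd z" "\<lambda>m k. fst z (k, m)" w u by (rule fl)
  obtain k m where km: "p = (k, m)" "m \<in> {1..n}" "k \<in> {1..m}" using p by (rule eig_indexE)
  obtain d where d: "mat_linear n (dlift n z g) d" using mat_linear_dlift[OF z g] by blast
  show ?thesis
    using lifted_bracket_eigenvalue[OF z km(2,3) frame[OF km(2)] d] km(1)
    by (simp add: eig_dir_mat_def dir_def)
qed

lemma bracket_coordinate_restrict:
  assumes z: "z \<in> M_Omega_e n" and p: "p \<in> eig_index n" and g: "g \<in> O_M_e n"
  shows "lifted_bracket n (\<lambda>z\<in>M_Omega_e n. fst z p) g z = lifted_bracket n (\<lambda>z. fst z p) g z"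
  using mat_linear_dlift_coord[OF z coordinate_mem[OF p]] lifted_bracket_cong[OF z _ _ g, of "\<lambda>z\<in>M_Omega_e n. fst z p" "\<lambda>z. fst z p"]
  by auto

text \<open>At level n the block is the whole matrix, so the direction vanishes: the eigenvalues of
  x itself are Casimir functions.\<close>

lemma bracket_top_coordinate:
  assumes z: "z \<in> M_Omega_e n" and n: "n \<ge> 1" and k: "k \<in> {1..n}" and g: "g \<in> O_M_e n"
  shows "lifted_bracket n (\<lambda>z. fst z (k, n)) g z = 0"
proof -
  obtain w u where fl: "eig_flag n (snd z) (\<lambda>m k. fst z (k, m)) w u" using M_Omega_e_flag[OF z] .
  interpret eig_flag n "snd z" "\<lambda>m k. fst z (k, m)" w u by (rule fl)
  obtain d where d: "mat_linear n (dlift n z g) d" using mat_linear_dlift[OF z g] by blast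
  have "(k, n) \<in> eig_index n" using k n by (simp add: eig_index_mem)
  from bracket_coordinate[OF z fl this g] show ?thesis
    using d dir_block[of n k] n k by (simp add: mat_linear_def eig_dir_mat_def)
qed

lemma bracket_coordinates:
  assumes z: "z \<in> M_Omega_e n" and p: "p \<in> eig_index n" and q: "q \<in> eig_index n"
  shows "lifted_bracket n (\<lambda>z. fst z p) (\<lambda>z\<in>M_Omega_e n. fst z q) z = 0"
proof -
  obtain w u where fl: "eig_flag n (snd z) (\<lambda>m k. fst z (k, m)) w u" using M_Omega_e_flag[OF z] .
  interpret eig_flag n "snd z" "\<lambda>m k. fst z (k, m)" w u by (rule fl)
  obtain k m where km: "p = (k, m)" "m \<in> {1..n}" "k \<in> {1..m}" using p by (rule eig_indexE)
  obtain k' m' where km': "q = (k', m')" "m' \<in> {1..n}" "k' \<in> {1..m'}" using q by (rule eig_indexE)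
  have "lifted_bracket n (\<lambda>z. fst z p) (\<lambda>z\<in>M_Omega_e n. fst z q) z
      = dlift n z (\<lambda>z\<in>M_Omega_e n. fst z q) (eig_dir_mat n (snd z) w u p)"
    using bracket_coordinate[OF z fl p coordinate_regular[OF coordinate_mem[OF q]]] .
  also have "\<dots> = dlift n z (\<lambda>z. fst z q) (eig_dir_mat n (snd z) w u p)"
    by (rule dlift_cong[OF z]) auto
  also have "\<dots> = 0"
    using eig_dir_tangent[OF z km(2,3) frame[OF km(2)] km'(2,3)]
    by (simp add: km(1) km'(1) eig_dir_mat_def dir_def)
  finally show ?thesis .
qed

text \<open>The chain rule with coefficients depending on \<nu> only. Level n drops out, which
  leaves d(n - 1) terms.\<close>

lemma J_e_bracket:
  assumes f: "f \<in> J_e n" and nu: "\<nu> \<in> e_Omega n" and n: "n \<ge> 1"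
  obtains b where "\<And>z g. z \<in> M_fibre n \<nu> \<Longrightarrow> g \<in> O_M_e n \<Longrightarrow>
    lifted_bracket n f g z = (\<Sum>p\<in>eig_index (n - 1). b p * lifted_bracket n (\<lambda>z. fst z p) g z)"
proof -
  obtain b where b: "\<And>z v. z \<in> M_fibre n \<nu> \<Longrightarrow> v \<in> carrier_mat n n \<Longrightarrow>
    dlift n z f v = (\<Sum>p\<in>eig_index n. b p * dlift n z (\<lambda>z. fst z p) v)" using J_e_dlift[OF f nu] by blast
  show ?thesis
  proof (rule that[of b])
    fix z g assume z: "z \<in> M_fibre n \<nu>" and g: "g \<in> O_M_e n"
    note zM = M_fibreD(1)[OF z]
    obtain d where d: "mat_linear n (dlift n z g) d" using mat_linear_dlift[OF zM g] by blast
    obtain c where c: "\<And>p. p \<in> eig_index n \<Longrightarrow> mat_linear n (dlift n z (\<lambda>z. fst z p)) (c p)"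
      using mat_linear_dlift_coord[OF zM coordinate_mem] by metis
    have "lifted_bracket n f g z = (\<Sum>p\<in>eig_index n. b p * lifted_bracket n (\<lambda>z. fst z p) g z)"
      by (rule lifted_bracket_linear[OF zM d c b[OF z]])
    also have "\<dots> = (\<Sum>p\<in>eig_index (n - 1). b p * lifted_bracket n (\<lambda>z. fst z p) g z)"
    proof (rule sum.mono_neutral_right)
      show "eig_index (n - 1) \<subseteq> eig_index n" by (rule eig_index_mono) simp
      show "\<forall>p\<in>eig_index n - eig_index (n - 1). b p * lifted_bracket n (\<lambda>z. fst z p) g z = 0"
      proof
        fix p assume "p \<in> eig_index n - eig_index (n - 1)"
        then have "p = (fst p, n)" "fst p \<in> {1..n}" by (auto simp: eig_index_def)
        then have "lifted_bracket n (\<lambda>z. fst z p) g z = 0"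
          using bracket_top_coordinate[OF zM n _ g, of "fst p"] by simp
        then show "b p * lifted_bracket n (\<lambda>z. fst z p) g z = 0" by simp
      qed
    qed simp
    finally show "lifted_bracket n f g z = (\<Sum>p\<in>eig_index (n - 1). b p * lifted_bracket n (\<lambda>z. fst z p) g z)" .
  qed
qed

lemma J_e_commutative:
  assumes f: "f \<in> J_e n" and g: "g \<in> J_e n" and z: "z \<in> M_Omega_e n" and n: "n \<ge> 1"
  shows "lifted_bracket n f g z = 0"
proof -
  note zf = M_fibreI[OF z]
  note nu = M_Omega_eD(1)[OF z]
  obtain w u where fl: "eig_flag n (snd z) (\<lambda>m k. fst z (k, m)) w u" using M_Omega_e_flag[OF z] .
  have "lifted_bracket n (\<lambda>z. fst z p) g z = 0" if p: "p \<in> eig_index n" for p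
  proof -
    obtain b where b: "\<And>y v. y \<in> M_fibre n (fst z) \<Longrightarrow> v \<in> carrier_mat n n \<Longrightarrow>
      dlift n y g v = (\<Sum>q\<in>eig_index n. b q * dlift n y (\<lambda>z. fst z q) v)" using J_e_dlift[OF g nu] by blast
    have "lifted_bracket n (\<lambda>z. fst z p) g z
       = (\<Sum>q\<in>eig_index n. b q * dlift n z (\<lambda>z. fst z q) (eig_dir_mat n (snd z) w u p))"
      unfolding bracket_coordinate[OF z fl p J_e_regular[OF g]] by (rule b[OF zf]) simp
    also have "\<dots> = (\<Sum>q\<in>eig_index n. b q * lifted_bracket n (\<lambda>z. fst z p) (\<lambda>z\<in>M_Omega_e n. fst z q) z)"
    proof (intro sum.cong refl arg_cong[of _ _ "\<lambda>a. _ * a"])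
      fix q assume q: "q \<in> eig_index n"
      show "dlift n z (\<lambda>z. fst z q) (eig_dir_mat n (snd z) w u p) =
          lifted_bracket n (\<lambda>z. fst z p) (\<lambda>z\<in>M_Omega_e n. fst z q) z"
        unfolding bracket_coordinate[OF z fl p coordinate_regular[OF coordinate_mem[OF q]]]
        by (rule dlift_cong[OF z]) auto
    qed
    also have "\<dots> = 0" by (intro sum.neutral ballI) (simp only: bracket_coordinates[OF z p] mult_zero_right)
    finally show ?thesis .
  qed
  then have 0: "lifted_bracket n (\<lambda>z. fst z p) g z = 0" if "p \<in> eig_index (n - 1)" for p
    using that eig_index_mono[of "n - 1" n] by (meson diff_le_self subsetD)
  obtain b where b: "\<And>y h. y \<in> M_fibre n (fst z) \<Longrightarrow> h \<in> O_M_e n \<Longrightarrow>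
    lifted_bracket n f h y = (\<Sum>p\<in>eig_index (n - 1). b p * lifted_bracket n (\<lambda>z. fst z p) h y)"
    using J_e_bracket[OF f nu n] by blast
  show ?thesis unfolding b[OF zf J_e_regular[OF g]] by (intro sum.neutral ballI) (simp only: 0 mult_zero_right)
qed

section \<open>Tangency to the fibres and the basis of their tangent spaces\<close>

lemma dlift_tangent_space:
  assumes z: "z \<in> M_Omega_e n" and v: "v \<in> carrier_mat n n"
  shows "(\<lambda>\<psi>\<in>O_M_e n. dlift n z \<psi> v) \<in> tangent_space (M_Omega_e n) (O_M_e n) z"
proof -
  let ?M = "M_Omega_e n" and ?g = "\<lambda>t. sec n z (snd z + t \<cdot>\<^sub>m v)"
  have d: "((\<lambda>t. f (?g t)) has_field_derivative dlift n z f v) (at 0)" if "f \<in> O_M_e n" for f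
    using dlift_regular[OF z that] v by metis
  have restr: "dlift n z (restrict h ?M) v = d" if "((\<lambda>t. h (?g t)) has_field_derivative d) (at 0)" for h d
    using dlift_cong[OF z v, of "restrict h ?M" h] dlift_eqI[OF that] by simp
  have g0: "?g 0 = z" by (rule sec_curve(1)[OF z v])
  have mem: "(\<lambda>w\<in>?M. f w + g w) \<in> O_M_e n" "(\<lambda>w\<in>?M. c * f w) \<in> O_M_e n" "(\<lambda>w\<in>?M. f w * g w) \<in> O_M_e n"
    if "f \<in> O_M_e n" "g \<in> O_M_e n" for f g c
  proof -
    have "(\<lambda>w\<in>?M. c * f w) = (\<lambda>w\<in>?M. (\<lambda>w\<in>?M. c) w * f w)" by (rule restrict_ext) simp
    then show "(\<lambda>w\<in>?M. c * f w) \<in> O_M_e n"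
      using that regular_funs_const regular_funs_mult unfolding O_M_e_def by metis
  qed (use that regular_funs_add regular_funs_mult in \<open>auto simp: O_M_e_def\<close>)
  have "dlift n z (\<lambda>w\<in>?M. f w + g w) v = dlift n z f v + dlift n z g v"
    "dlift n z (\<lambda>w\<in>?M. c * f w) v = c * dlift n z f v"
    "dlift n z (\<lambda>w\<in>?M. f w * g w) v = f z * dlift n z g v + g z * dlift n z f v"
    if "f \<in> O_M_e n" "g \<in> O_M_e n" for f g c
  proof -
    show "dlift n z (\<lambda>w\<in>?M. f w + g w) v = dlift n z f v + dlift n z g v"
      by (rule restr[of "\<lambda>w. f w + g w", OF DERIV_add[OF d[OF that(1)] d[OF that(2)]]])
    show "dlift n z (\<lambda>w\<in>?M. c * f w) v = c * dlift n z f v"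
      by (rule restr[of "\<lambda>w. c * f w", OF DERIV_cmult[OF d[OF that(1)]]])
    show "dlift n z (\<lambda>w\<in>?M. f w * g w) v = f z * dlift n z g v + g z * dlift n z f v"
      using restr[of "\<lambda>w. f w * g w", OF DERIV_mult[OF d[OF that(1)] d[OF that(2)]]]
      unfolding g0 by (simp only: mult.commute add.commute)
  qed
  then show ?thesis unfolding tangent_space_def by (simp add: mem)
qed

lemma mat_linear_eig_dir_sum:
  assumes "mat_linear n \<phi> c"
  shows "(\<Sum>p\<in>A. b p * \<phi> (eig_dir_mat n x w u p)) =
    \<phi> (Matrix.mat n n (\<lambda>(i, j). \<Sum>p\<in>A. b p * eig_flag.dir x w u (snd p) (fst p) i j))"
  unfolding eig_dir_mat_def by (rule mat_linear_combination[OF assms, symmetric])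

text \<open>The flow through z stays in the fibre, where g is zero, and the bracket is minus the
  derivative of g along it. This treats the full ideal of the fibre at once.\<close>

lemma bracket_coordinate_vanishing:
  assumes z: "z \<in> M_Omega_e n" and p: "p \<in> eig_index n" and g: "g \<in> O_M_e n"
    and 0: "\<And>y. y \<in> M_fibre n (fst z) \<Longrightarrow> g y = 0"
  shows "lifted_bracket n (\<lambda>z. fst z p) g z = 0"
proof -
  obtain w u where fl: "eig_flag n (snd z) (\<lambda>m k. fst z (k, m)) w u" using M_Omega_e_flag[OF z] .
  interpret eig_flag n "snd z" "\<lambda>m k. fst z (k, m)" w u by (rule fl)
  obtain k m where km: "p = (k, m)" "m \<in> {1..n}" "k \<in> {1..m}" using p by (rule eig_indexE)
  let ?y = "\<lambda>s. (fst z, eig_flow n m (snd z) (fst z (k, m)) (w m k) (u m k) s)"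
  have "g (?y s) = 0" for s
    using 0 eig_flow_mem[OF z km(2,3) frame[OF km(2)]] by (simp add: M_fibre_def)
  moreover have "?y 0 = z" using M_Omega_eD(2)[OF z] by (simp add: eig_flow_0)
  ultimately have "((\<lambda>s. 0) has_field_derivative - lifted_bracket n (\<lambda>z. fst z p) g z) (at 0)"
    using flow_function_derivative[OF z km(2,3) frame[OF km(2)] g, of 0] km(1) by simp
  from DERIV_unique[OF this DERIV_const] show ?thesis by simp
qed

lemma ham_vec_J_e_mem:
  assumes f: "f \<in> J_e n" and nu: "\<nu> \<in> e_Omega n" and z: "z \<in> M_fibre n \<nu>" and n: "n \<ge> 1"
  shows "ham_vec n f z \<in> T_fibre n \<nu> z"
proof -
  note zM = M_fibreD(1)[OF z]
  obtain w u where fl: "eig_flag n (snd z) (\<lambda>m k. fst z (k, m)) w u" using M_Omega_e_flag[OF zM] .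
  obtain b where "\<And>y h. y \<in> M_fibre n \<nu> \<Longrightarrow> h \<in> O_M_e n \<Longrightarrow>
    lifted_bracket n f h y = (\<Sum>p\<in>eig_index (n - 1). b p * lifted_bracket n (\<lambda>z. fst z p) h y)"
    using J_e_bracket[OF f nu n] by blast
  note b = this[OF z]
  have idx: "p \<in> eig_index n" if "p \<in> eig_index (n - 1)" for p
    using that eig_index_mono[of "n - 1" n] by auto
  \<comment> \<open>By linearity the Hamiltonian vector of f is the lifted differential along a
    single matrix, hence a point derivation.\<close>
  let ?V = "Matrix.mat n n (\<lambda>(i, j). \<Sum>p\<in>eig_index (n - 1). b p * eig_flag.dir (snd z) w u (snd p) (fst p) i j)"
  have "lifted_bracket n f g z = dlift n z g ?V" if g: "g \<in> O_M_e n" for g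
  proof -
    obtain d where d: "mat_linear n (dlift n z g) d" using mat_linear_dlift[OF zM g] by blast
    have "lifted_bracket n f g z = (\<Sum>p\<in>eig_index (n - 1). b p * dlift n z g (eig_dir_mat n (snd z) w u p))"
      unfolding b[OF g] using bracket_coordinate[OF zM fl idx g] by simp
    also have "\<dots> = dlift n z g ?V" by (rule mat_linear_eig_dir_sum[OF d])
    finally show ?thesis .
  qed
  then have "ham_vec n f z = (\<lambda>\<psi>\<in>O_M_e n. dlift n z \<psi> ?V)"
    unfolding ham_vec_def by (intro restrict_ext) simp
  then have "ham_vec n f z \<in> tangent_space (M_Omega_e n) (O_M_e n) z"
    using dlift_tangent_space[OF zM, of ?V] by simp
  moreover have "ham_vec n f z g = 0" if g: "g \<in> O_M_e n" and 0: "\<forall>w\<in>M_fibre n \<nu>. g w = 0" for g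
    unfolding ham_vec_def using g b[OF g] bracket_coordinate_vanishing[OF zM idx g] 0 M_fibreD(2)[OF z]
    by simp
  ultimately show ?thesis unfolding T_fibre_def sub_tangent_space_def by simp
qed

text \<open>D kills \<nu>_p because \<nu>_p minus its value vanishes on the fibre. It also respects
  the identity det(\<nu>_{k m} - x_m) = 0. As the \<nu> part contributes nothing, what remains is
  the derivative along X of the characteristic polynomial at a frozen eigenvalue, a nonzero multiple
  of u X w.\<close>

lemma tangent_entries_pairing:
  assumes D: "D \<in> T_fibre n \<nu> z" and z: "z \<in> M_fibre n \<nu>"
  defines "X \<equiv> Matrix.mat n n (\<lambda>(i, j). D (\<lambda>z\<in>M_Omega_e n. snd z $$ (i, j)))"
  shows "p \<in> eig_index n \<Longrightarrow> D (\<lambda>z\<in>M_Omega_e n. fst z p) = 0"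
    and "m \<in> {1..n} \<Longrightarrow> k \<in> {1..m} \<Longrightarrow> eig_frame m (snd z) (\<lambda>k. fst z (k, m)) w u \<Longrightarrow>
      eig_pairing m (u k) (w k) (\<lambda>i j. X $$ (i, j)) = 0"
proof -
  let ?M = "M_Omega_e n"
  note zM = M_fibreD(1)[OF z] and zn = M_fibreD(2)[OF z]
  have Dt: "D \<in> tangent_space ?M (O_M_e n) z" and D0: "\<And>f. f \<in> O_M_e n \<Longrightarrow> (\<forall>w\<in>M_fibre n \<nu>. f w = 0) \<Longrightarrow> D f = 0"
    using D unfolding T_fibre_def sub_tangent_space_def by auto
  show Dnu: "D (\<lambda>z\<in>?M. fst z p) = 0" if p: "p \<in> eig_index n" for p
  proof -
    have c: "(\<lambda>z\<in>?M. - \<nu> p) \<in> O_M_e n" unfolding O_M_e_def by (rule regular_funs_const)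
    note r = coordinate_regular[OF coordinate_mem[OF p]]
    have "D (\<lambda>z\<in>?M. fst z p + - \<nu> p) = 0"
      using regular_funs_add[OF r[unfolded O_M_e_def] c[unfolded O_M_e_def]]
      by (intro D0) (auto simp: O_M_e_def M_fibre_def restrict_def cong: if_cong)
    then have "D (\<lambda>z\<in>?M. fst z p) + D (\<lambda>z\<in>?M. - \<nu> p) = 0"
      using tangent_space_add[OF Dt r c] by simp
    moreover have "D (\<lambda>z\<in>?M. - \<nu> p) = 0"
      using tangent_space_const[OF Dt[unfolded O_M_e_def] zM] .
    ultimately show ?thesis by simp
  qed
  have X: "X \<in> carrier_mat n n" by (simp add: X_def)
  show "eig_pairing m (u k) (w k) (\<lambda>i j. X $$ (i, j)) = 0"
    if m: "m \<in> {1..n}" and k: "k \<in> {1..m}" and fr: "eig_frame m (snd z) (\<lambda>k. fst z (k, m)) w u"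
  proof -
    define F where "F = (\<lambda>z :: point. det (Matrix.mat m m (\<lambda>(i, j). (if i = j then fst z (k, m) else 0) - snd z $$ (i, j))))"
    have p: "(k, m) \<in> eig_index n" using m k by (simp add: eig_index_mem)
    have F: "F \<in> polynomial_funs (coords_M_e n)"
    proof -
      have "(\<lambda>z. if i = j then fst z (k, m) else 0) \<in> polynomial_funs (coords_M_e n)" for i j :: nat
        using polynomial_funs.coord[OF coordinate_mem[OF p]] by (cases "i = j") (auto intro: polynomial_funs.const)
      moreover have "(\<lambda>z. snd z $$ (i, j)) \<in> polynomial_funs (coords_M_e n)" if "i < m" "j < m" for i j
        using that m by (intro polynomial_funs.coord entry_coordinate_mem) auto
      ultimately show ?thesis unfolding F_def
        by (intro det_polynomial_funs, unfold prod.case) (intro polynomial_funs_diff)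
    qed
    obtain a where a: "curve_partials (coords_M_e n) UNIV z F a" "derivation_partials (coords_M_e n) ?M z F a"
      using polynomial_partials[OF F finite_coords_M_e zM] by blast
    have "F y = 0" if y: "y \<in> ?M" for y
    proof -
      obtain w u where "eig_frame m (snd y) (\<lambda>k. fst y (k, m)) w u"
        using M_Omega_e_frame[OF y m] by blast
      then show ?thesis unfolding F_def poly_char_poly_det[symmetric] using k by (simp add: eig_frame_root)
    qed
    then have "restrict F ?M = (\<lambda>z\<in>?M. 0)" by (intro restrict_ext)
    then have "D (restrict F ?M) = 0"
      using tangent_space_const[OF Dt[unfolded O_M_e_def] zM, of 0] by simp
    then have sum0: "(\<Sum>q\<in>coords_M_e n. a q * D (restrict q ?M)) = 0"
      using a(2) Dt unfolding derivation_partials_def O_M_e_def by simp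
    \<comment> \<open>This curve may leave the variety, since \<nu> is frozen while x moves. F is a
      polynomial, so its partials over UNIV still apply.\<close>
    let ?g = "\<lambda>t. (fst z, snd z + t \<cdot>\<^sub>m X)"
    have "((\<lambda>t. q (?g t)) has_field_derivative D (restrict q ?M)) (at 0)" if "q \<in> coords_M_e n" for q
      using that
    proof (cases rule: coords_M_e_cases)
      case (eig k m)
      have "(k, m) \<in> eig_index n" using eig by (simp add: eig_index_mem)
      from Dnu[OF this] show ?thesis unfolding eig(3) by simp
    next
      case (entry i j)
      have "(\<lambda>t. q (?g t)) = (\<lambda>t. snd z $$ (i, j) + t * D (restrict q ?M))"
        using entry M_Omega_eD(2)[OF zM] by (intro ext) (simp add: X_def)
      then show ?thesis by (auto intro!: derivative_eq_intros)
    qed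
    moreover have "?g 0 = z" using M_Omega_eD(2)[OF zM] X by (intro prod_eqI eq_matI) auto
    ultimately have "((\<lambda>t. F (?g t)) has_field_derivative 0) (at 0)"
      using a(1)[unfolded curve_partials_def, rule_format, of ?g "\<lambda>q. D (restrict q ?M)"] sum0 by simp
    moreover have "(\<lambda>t. F (?g t)) = (\<lambda>t. poly (char_poly (block m (snd z + t \<cdot>\<^sub>m X))) (fst z (k, m)))"
      unfolding F_def poly_char_poly_det fst_conv snd_conv ..
    ultimately have "((\<lambda>t. poly (char_poly (block m (snd z + t \<cdot>\<^sub>m X))) (fst z (k, m))) has_field_derivative 0) (at 0)"
      by (simp only:)
    moreover have "m \<le> n" using m by simp
    ultimately have "- (\<Prod>j\<in>{1..m} - {k}. fst z (k, m) - fst z (j, m)) * eig_pairing m (u k) (w k) (\<lambda>i j. X $$ (i, j)) = 0"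
      using DERIV_unique[OF char_poly_line_derivative[OF fr M_Omega_eD(2)[OF zM] X _ k]] by blast
    moreover have "(\<Prod>j\<in>{1..m} - {k}. fst z (k, m) - fst z (j, m)) \<noteq> 0"
      using e_Omega_neq[OF M_Omega_eD(1)[OF zM] m k] by auto
    ultimately show ?thesis by simp
  qed
qed

lemma coordinate_basis:
  assumes z: "z \<in> M_fibre n \<nu>" and nu: "\<nu> \<in> e_Omega n" and n: "n \<ge> 1"
  shows "basis_of_functionals (O_M_e n) (T_fibre n \<nu> z) (eig_index (n - 1)) (\<lambda>p. ham_vec n (\<lambda>z\<in>M_Omega_e n. fst z p) z)"
proof -
  let ?M = "M_Omega_e n"
  note zM = M_fibreD(1)[OF z]
  obtain w u where fl: "eig_flag n (snd z) (\<lambda>m k. fst z (k, m)) w u" using M_Omega_e_flag[OF zM] .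
  interpret eig_flag n "snd z" "\<lambda>m k. fst z (k, m)" w u by (rule fl)
  have idx: "p \<in> eig_index n" if "p \<in> eig_index (n - 1)" for p
    using that eig_index_mono[of "n - 1" n] by auto
  have ham: "ham_vec n (\<lambda>z\<in>?M. fst z p) z \<psi> = dlift n z \<psi> (eig_dir_mat n (snd z) w u p)"
    if "p \<in> eig_index (n - 1)" "\<psi> \<in> O_M_e n" for p \<psi>
    using that bracket_coordinate_restrict[OF zM idx] bracket_coordinate[OF zM fl idx] by (simp add: ham_vec_def)
  have range: "{1..<n} = {1..n - 1}" by auto
  have sums: "(\<Sum>m\<in>{1..<n}. \<Sum>k\<in>{1..m}. c (k, m) * dir m k i j) =
      (\<Sum>p\<in>eig_index (n - 1). c p * dir (snd p) (fst p) i j)" for c i j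
    unfolding sum_eig_index range by simp
  show ?thesis
    unfolding basis_of_functionals_def
  proof (intro conjI ballI allI impI)
    fix p assume p: "p \<in> eig_index (n - 1)"
    show "ham_vec n (\<lambda>z\<in>?M. fst z p) z \<in> T_fibre n \<nu> z"
      by (rule ham_vec_J_e_mem[OF J_e_coordinate[OF idx[OF p]] nu z n])
  next
    fix c p assume c: "\<forall>\<psi>\<in>O_M_e n. (\<Sum>p\<in>eig_index (n - 1). c p * ham_vec n (\<lambda>z\<in>?M. fst z p) z \<psi>) = 0"
      and p: "p \<in> eig_index (n - 1)"
    obtain k m where km: "p = (k, m)" "m \<in> {1..n - 1}" "k \<in> {1..m}" using p by (rule eig_indexE)
    have "(\<Sum>m\<in>{1..<n}. \<Sum>k\<in>{1..m}. c (k, m) * dir m k i j) = 0" if ij: "i < n" "j < n" for i j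
    proof -
      \<comment> \<open>Testing on entries turns a relation between functionals into one between
        matrices.\<close>
      let ?\<psi> = "\<lambda>z\<in>?M. snd z $$ (i, j)"
      have \<psi>: "?\<psi> \<in> O_M_e n" by (rule coordinate_regular[OF entry_coordinate_mem[OF ij]])
      have "dlift n z ?\<psi> (eig_dir_mat n (snd z) w u p) = dir (snd p) (fst p) i j" for p
        using dlift_cong[OF zM, of "eig_dir_mat n (snd z) w u p" ?\<psi> "\<lambda>z. snd z $$ (i, j)"]
          dlift_entry[OF zM _ ij, of "eig_dir_mat n (snd z) w u p"] ij
        by (simp add: eig_dir_mat_def)
      then show ?thesis using bspec[OF c \<psi>] unfolding sums by (simp add: ham \<psi>)
    qed
    from dir_independent[OF order_refl this] show "c p = 0" using km by auto
  next
    fix D assume D: "D \<in> T_fibre n \<nu> z"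
    define X where "X = Matrix.mat n n (\<lambda>(i, j). D (\<lambda>z\<in>?M. snd z $$ (i, j)))"
    have X: "X \<in> carrier_mat n n" by (simp add: X_def)
    have pair: "eig_pairing m (u m k) (w m k) (\<lambda>i j. X $$ (i, j)) = 0" if "m \<in> {1..n}" "k \<in> {1..m}" for m k
      unfolding X_def by (rule tangent_entries_pairing(2)[OF D z that frame[OF that(1)]])
    from dir_span[OF order_refl pair] obtain c where
      c: "\<And>i j. i < n \<Longrightarrow> j < n \<Longrightarrow> X $$ (i, j) = (\<Sum>m\<in>{1..<n}. \<Sum>k\<in>{1..m}. c k m * dir m k i j)" by blast
    let ?c = "\<lambda>p. c (fst p) (snd p)"
    have Xeq: "X = Matrix.mat n n (\<lambda>(i, j). \<Sum>p\<in>eig_index (n - 1). ?c p * dir (snd p) (fst p) i j)"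
    proof (rule eq_matI)
      fix i j assume "i < dim_row (Matrix.mat n n (\<lambda>(i, j). \<Sum>p\<in>eig_index (n - 1). ?c p * dir (snd p) (fst p) i j))"
        "j < dim_col (Matrix.mat n n (\<lambda>(i, j). \<Sum>p\<in>eig_index (n - 1). ?c p * dir (snd p) (fst p) i j))"
      then have ij: "i < n" "j < n" by auto
      show "X $$ (i, j) = Matrix.mat n n (\<lambda>(i, j). \<Sum>p\<in>eig_index (n - 1). ?c p * dir (snd p) (fst p) i j) $$ (i, j)"
        using c[OF ij] sums[of ?c i j] ij by simp
    qed (use X in auto)
    \<comment> \<open>D and the differential along X agree on all coordinates: both give X on the
      entries and 0 on the \<nu>.\<close>
    have Dq: "D (restrict q ?M) = dlift n z q X" if "q \<in> coords_M_e n" for q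
      using that
    proof (cases rule: coords_M_e_cases)
      case (eig k m)
      have "(k, m) \<in> eig_index n" using eig by (simp add: eig_index_mem)
      then show ?thesis
        unfolding eig(3) using tangent_entries_pairing(1)[OF D z] dlift_eigenvalue[OF zM X eig(1,2) frame[OF eig(1)]] pair[OF eig(1,2)]
        by simp
    next
      case (entry i j)
      then show ?thesis using dlift_entry[OF zM X entry(1,2)] by (simp add: X_def)
    qed
    have "D \<psi> = (\<Sum>p\<in>eig_index (n - 1). ?c p * ham_vec n (\<lambda>z\<in>?M. fst z p) z \<psi>)" if \<psi>: "\<psi> \<in> O_M_e n" for \<psi>
    proof -
      obtain a where a: "derivation_partials (coords_M_e n) ?M z \<psi> a"
        "\<And>v. v \<in> carrier_mat n n \<Longrightarrow> dlift n z \<psi> v = (\<Sum>q\<in>coords_M_e n. a q * dlift n z q v)"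
        by (rule dlift_regular[OF zM \<psi>]) blast
      have "D \<in> tangent_space ?M (O_M_e n) z" using D unfolding T_fibre_def sub_tangent_space_def by auto
      then have "D (restrict \<psi> ?M) = (\<Sum>q\<in>coords_M_e n. a q * D (restrict q ?M))"
        using a(1) unfolding derivation_partials_def O_M_e_def by blast
      moreover have "restrict \<psi> ?M = \<psi>" by (rule restrict_regular_funs[OF \<psi>[unfolded O_M_e_def]])
      ultimately have "D \<psi> = (\<Sum>q\<in>coords_M_e n. a q * D (restrict q ?M))" by (simp only:)
      also have "\<dots> = dlift n z \<psi> X" unfolding a(2)[OF X] by (simp add: Dq)
      finally have D\<psi>: "D \<psi> = dlift n z \<psi> X" .
      obtain d where d: "mat_linear n (dlift n z \<psi>) d" using mat_linear_dlift[OF zM \<psi>] by blast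
      have "dlift n z \<psi> X = (\<Sum>p\<in>eig_index (n - 1). ?c p * dlift n z \<psi> (eig_dir_mat n (snd z) w u p))"
        unfolding Xeq by (rule mat_linear_eig_dir_sum[OF d, symmetric])
      also have "\<dots> = (\<Sum>p\<in>eig_index (n - 1). ?c p * ham_vec n (\<lambda>z\<in>?M. fst z p) z \<psi>)"
        by (intro sum.cong refl) (simp only: ham[OF _ \<psi>])
      finally show ?thesis unfolding D\<psi> .
    qed
    then show "\<exists>c. \<forall>\<psi>\<in>O_M_e n. D \<psi> = (\<Sum>p\<in>eig_index (n - 1). c p * ham_vec n (\<lambda>z\<in>?M. fst z p) z \<psi>)"
      by (intro exI[of _ ?c]) blast
  qed
qed

subsection \<open>The Hamiltonian fields of the \<open>p\<^sub>i\<close>\<close>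

lemma left_inverse_imp_right_inverse:
  fixes C A :: "nat \<Rightarrow> nat \<Rightarrow> complex"
  assumes "\<And>i j. i \<in> {1..m} \<Longrightarrow> j \<in> {1..m} \<Longrightarrow> (\<Sum>k\<in>{1..m}. C i k * A k j) = (if i = j then 1 else 0)"
    and ij: "i \<in> {1..m}" "j \<in> {1..m}"
  shows "(\<Sum>k\<in>{1..m}. A i k * C k j) = (if i = j then 1 else 0)"
proof -
  define CM where "CM = Matrix.mat m m (\<lambda>(i, j). C (Suc i) (Suc j))"
  define AM where "AM = Matrix.mat m m (\<lambda>(i, j). A (Suc i) (Suc j))"
  have c: "CM \<in> carrier_mat m m" "AM \<in> carrier_mat m m" by (auto simp: CM_def AM_def)
  have "CM * AM = 1\<^sub>m m"
  proof (rule eq_matI)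
    fix i j assume "i < dim_row (1\<^sub>m m)" "j < dim_col (1\<^sub>m m)"
    then have ij: "i < m" "j < m" by auto
    show "(CM * AM) $$ (i, j) = 1\<^sub>m m $$ (i, j)"
      unfolding mult_mat_index_sum[OF c ij] using assms(1)[of "Suc i" "Suc j"] ij
      by (simp add: CM_def AM_def sum.atLeast1_atMost_eq)
  qed (use c in auto)
  from mat_mult_left_right_inverse[OF c this] have *: "AM * CM = 1\<^sub>m m" .
  obtain i' j' where s: "i = Suc i'" "j = Suc j'" "i' < m" "j' < m"
    using ij by (cases i; cases j) auto
  have "(AM * CM) $$ (i', j') = 1\<^sub>m m $$ (i', j')" unfolding * ..
  then show ?thesis
    unfolding mult_mat_index_sum[OF c(2,1) s(3,4)] using s
    by (simp add: CM_def AM_def sum.atLeast1_atMost_eq)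
qed

text \<open>Up to sign the elementary symmetric polynomials of the \<nu>_{j m}: coefficients of the
  characteristic polynomial, expressed through \<nu> alone.\<close>

definition eig_coeff :: "nat \<Rightarrow> nat \<Rightarrow> (nat \<times> nat \<Rightarrow> complex) \<Rightarrow> complex" where
  "eig_coeff m i \<nu> = poly.coeff (\<Prod>j\<in>{1..m}. [:- \<nu> (j, m), 1:]) i"

lemma coeff_prod_polynomial_funs:
  assumes "finite J" "J \<subseteq> K"
  shows "(\<lambda>\<nu>. poly.coeff (\<Prod>j\<in>J. [:- \<nu> (j, m), 1:]) i) \<in> polynomial_funs ((\<lambda>j \<nu>. \<nu> (j, m)) ` K)"
  using assms
proof (induction J arbitrary: i)
  case empty
  then show ?case by (simp add: polynomial_funs.const)
next
  case (insert j J)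
  let ?X = "(\<lambda>j \<nu>. \<nu> (j, m) :: complex) ` K"
  let ?P = "\<lambda>\<nu>. \<Prod>j\<in>J. [:- \<nu> (j, m), 1:]"
  have eq: "poly.coeff (\<Prod>j\<in>insert j J. [:- \<nu> (j, m), 1:]) i =
      - \<nu> (j, m) * poly.coeff (?P \<nu>) i + (if i = 0 then 0 else poly.coeff (?P \<nu>) (i - 1))" for \<nu>
    using insert.hyps by (cases i) simp_all
  have 1: "(\<lambda>\<nu>. - \<nu> (j, m)) \<in> polynomial_funs ?X"
    using insert.prems by (intro polynomial_funs_uminus polynomial_funs.coord) auto
  have 2: "(\<lambda>\<nu>. if i = 0 then 0 else poly.coeff (?P \<nu>) (i - 1)) \<in> polynomial_funs ?X"
    using insert by (cases "i = 0") (auto intro: polynomial_funs.const)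
  show ?case unfolding eq using insert by (intro polynomial_funs.add polynomial_funs.mult 1 2) auto
qed

lemma poly_eig_coeff:
  "(\<Prod>j\<in>{1..m}. t - \<nu> (j, m)) = t ^ m + (\<Sum>k\<in>{1..m}. eig_coeff m (k - 1) \<nu> * t ^ (k - 1))"
proof -
  let ?P = "\<Prod>j\<in>{1..m}. [:- \<nu> (j, m), 1:]"
  have deg: "degree ?P = m" by (subst degree_prod_eq_sum_degree) auto
  have lc: "poly.coeff ?P m = 1"
    using lead_coeff_prod[of "\<lambda>j. [:- \<nu> (j, m), 1:]" "{1..m}"] unfolding deg by simp
  have "(\<Prod>j\<in>{1..m}. t - \<nu> (j, m)) = poly ?P t" by (simp add: poly_prod)
  also have "\<dots> = (\<Sum>i\<le>m. poly.coeff ?P i * t ^ i)" unfolding poly_altdef deg ..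
  also have "\<dots> = t ^ m + (\<Sum>i<m. poly.coeff ?P i * t ^ i)"
    using lc by (simp add: lessThan_Suc_atMost[symmetric])
  finally show ?thesis by (simp add: sum.atLeast1_atMost_eq eig_coeff_def)
qed

lemma coordinate_inj: "inj_on (\<lambda>j \<nu>. \<nu> (j, m) :: complex) K"
proof (rule inj_onI)
  fix i j :: 'a assume "(\<lambda>\<nu>. \<nu> (i, m) :: complex) = (\<lambda>\<nu>. \<nu> (j, m))"
  from fun_cong[OF this, of "\<lambda>r. if r = (i, m) then 1 else 0"] show "i = j" by (auto split: if_splits)
qed

text \<open>Differentiating \<open>\<Prod>\<^sub>j (t - \<nu>\<^sub>j) = t\<^sup>m + \<Sum>\<^sub>k e\<^sub>k t\<^sup>k\<close> at the fixed value \<open>t = \<nu>\<^sub>k\<close> leaves only \<open>d \<nu>\<^sub>k\<close> on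
  the left, which inverts the Jacobian of the coefficients.\<close>

lemma eig_coeff_jacobian:
  assumes inj: "inj_on (\<lambda>k. \<nu> (k, m)) {1..m}"
  obtains A C where
    "\<And>k. k \<in> {1..m} \<Longrightarrow> curve_partials ((\<lambda>j \<nu>. \<nu> (j, m)) ` {1..m}) UNIV \<nu> (eig_coeff m (k - 1)) (A k)"
    and "\<And>k j. k \<in> {1..m} \<Longrightarrow> j \<in> {1..m} \<Longrightarrow>
      (\<Sum>k'\<in>{1..m}. C k k' * A k' (\<lambda>\<nu>. \<nu> (j, m))) = (if k = j then 1 else 0)"
proof -
  let ?X = "(\<lambda>j \<nu>. \<nu> (j, m) :: complex) ` {1..m}"
  have "\<exists>a. curve_partials ?X UNIV \<nu> (eig_coeff m i) a" for i
    using polynomial_partials[of "eig_coeff m i" ?X \<nu> UNIV] coeff_prod_polynomial_funs[of "{1..m}" "{1..m}" m i]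
    unfolding eig_coeff_def[abs_def] by auto
  then obtain a where a: "\<And>i. curve_partials ?X UNIV \<nu> (eig_coeff m i) (a i)" by metis
  define R where "R k = (\<Prod>j\<in>{1..m} - {k}. \<nu> (k, m) - \<nu> (j, m))" for k
  have R: "R k \<noteq> 0" if "k \<in> {1..m}" for k
    using inj that by (auto simp: R_def dest: inj_onD)
  show ?thesis
  \<comment> \<open>Row k of the inverse Jacobian. Evaluation at t = \<nu>_k is a product with the
    powers of \<nu>_k; it leaves - R k for j = k and 0 for the other j.\<close>
  proof (rule that[of "\<lambda>k. a (k - 1)" "\<lambda>k k'. - (\<nu> (k, m) ^ (k' - 1)) / R k"])
    show "curve_partials ?X UNIV \<nu> (eig_coeff m (k - 1)) (a (k - 1))" for k by (rule a)
    fix k j assume k: "k \<in> {1..m}" and j: "j \<in> {1..m}"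
    let ?c = "\<lambda>t. \<nu>((j, m) := \<nu> (j, m) + t)"
    have der: "((\<lambda>t. eig_coeff m i (?c t)) has_field_derivative a i (\<lambda>\<nu>. \<nu> (j, m))) (at 0)" for i
    proof -
      define d where "d q = (if q = (\<lambda>\<nu>. \<nu> (j, m) :: complex) then 1 else 0 :: complex)" for q :: "(nat \<times> nat \<Rightarrow> complex) \<Rightarrow> complex"
      have "((\<lambda>t. q (?c t)) has_field_derivative d q) (at 0)" if q: "q \<in> ?X" for q
      proof -
        obtain i where i: "q = (\<lambda>\<nu>. \<nu> (i, m))" using q by auto
        have "d q = (if i = j then 1 else 0)"
          using inj_on_eq_iff[OF coordinate_inj[of m UNIV], of i j] by (simp add: d_def i)
        then show ?thesis unfolding i by (auto intro!: derivative_eq_intros)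
      qed
      then have "((\<lambda>t. eig_coeff m i (?c t)) has_field_derivative (\<Sum>q\<in>?X. a i q * d q)) (at 0)"
        using a[of i, unfolded curve_partials_def, rule_format, of ?c d] by simp
      also have "(\<Sum>q\<in>?X. a i q * d q) = (\<Sum>q\<in>?X. if q = (\<lambda>\<nu>. \<nu> (j, m)) then a i q else 0)"
        by (intro sum.cong) (auto simp: d_def)
      also have "\<dots> = a i (\<lambda>\<nu>. \<nu> (j, m))" using j by simp
      finally show ?thesis .
    qed
    have "((\<lambda>t. \<nu> (k, m) ^ m + (\<Sum>k'\<in>{1..m}. eig_coeff m (k' - 1) (?c t) * \<nu> (k, m) ^ (k' - 1))) has_field_derivative
        0 + (\<Sum>k'\<in>{1..m}. a (k' - 1) (\<lambda>\<nu>. \<nu> (j, m)) * \<nu> (k, m) ^ (k' - 1))) (at 0)"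
      by (intro DERIV_add DERIV_const DERIV_sum DERIV_cmult_right der)
    then have 1: "((\<lambda>t. \<Prod>i\<in>{1..m}. \<nu> (k, m) - ?c t (i, m)) has_field_derivative
        (\<Sum>k'\<in>{1..m}. a (k' - 1) (\<lambda>\<nu>. \<nu> (j, m)) * \<nu> (k, m) ^ (k' - 1))) (at 0)"
      unfolding poly_eig_coeff by simp
    have "((\<lambda>t. \<Prod>i\<in>{1..m}. \<nu> (k, m) - ?c t (i, m)) has_field_derivative
        (\<Sum>i\<in>{1..m}. (if i = j then -1 else 0) * (\<Prod>l\<in>{1..m} - {i}. \<nu> (k, m) - ?c 0 (l, m)))) (at 0)"
      by (rule has_field_derivative_prod) (auto intro!: derivative_eq_intros)
    also have "(\<Sum>i\<in>{1..m}. (if i = j then -1 else 0) * (\<Prod>l\<in>{1..m} - {i}. \<nu> (k, m) - ?c 0 (l, m)))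
        = (\<Sum>i\<in>{1..m}. if i = j then - (\<Prod>l\<in>{1..m} - {j}. \<nu> (k, m) - \<nu> (l, m)) else 0)"
      by (intro sum.cong refl) (auto intro!: prod.cong)
    also have "\<dots> = - (\<Prod>l\<in>{1..m} - {j}. \<nu> (k, m) - \<nu> (l, m))" using j by simp
    also have "\<dots> = (if k = j then - R k else 0)" using k by (auto simp: R_def intro!: prod_zero)
    finally have "(\<Sum>k'\<in>{1..m}. a (k' - 1) (\<lambda>\<nu>. \<nu> (j, m)) * \<nu> (k, m) ^ (k' - 1)) = (if k = j then - R k else 0)"
      using DERIV_unique[OF 1] by blast
    moreover have "(\<Sum>k'\<in>{1..m}. - (\<nu> (k, m) ^ (k' - 1)) / R k * a (k' - 1) (\<lambda>\<nu>. \<nu> (j, m)))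
        = - (\<Sum>k'\<in>{1..m}. a (k' - 1) (\<lambda>\<nu>. \<nu> (j, m)) * \<nu> (k, m) ^ (k' - 1)) / R k"
      by (simp add: sum_divide_distrib sum_negf[symmetric] mult.commute)
    ultimately show "(\<Sum>k'\<in>{1..m}. - (\<nu> (k, m) ^ (k' - 1)) / R k * a (k' - 1) (\<lambda>\<nu>. \<nu> (j, m))) = (if k = j then 1 else 0)"
      using R[OF k] R[OF j] by (cases "k = j") auto
  qed
qed

lemma gz_p_hat_eq:
  assumes z: "z \<in> M_Omega_e n" and m: "m \<in> {1..n}" and k: "k \<in> {1..m}"
  shows "gz_p_hat n (tri (m - 1) + k) z = (-1) ^ (m - k + 1) * eig_coeff m (k - 1) (fst z)"
proof -
  obtain w u where "eig_frame m (snd z) (\<lambda>k. fst z (k, m)) w u" using M_Omega_e_frame[OF z m] by blast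
  note cp = eig_frame_char_poly[OF this]
  have k': "1 \<le> k" "k \<le> m" using k by auto
  show ?thesis
    using z cp unfolding gz_p_hat_def gz_p_def eig_coeff_def by (simp only: restrict_apply if_True level_position[OF k'])
qed

text \<open>Within a level the differentials of the p and of the \<nu> are related by the Jacobian
  B, which has a left inverse D because the eigenvalues are distinct. Both matrices depend on \<nu>
  only, and the sign in \<open>gz_p\<close> is its own inverse.\<close>

lemma gz_p_hat_bracket:
  assumes nu: "\<nu> \<in> e_Omega n" and m: "m \<in> {1..n}"
  obtains B D where
    "\<And>k j. k \<in> {1..m} \<Longrightarrow> j \<in> {1..m} \<Longrightarrow> (\<Sum>k'\<in>{1..m}. D k k' * B k' j) = (if k = j then 1 else 0)"
    and "\<And>z g k. z \<in> M_fibre n \<nu> \<Longrightarrow> g \<in> O_M_e n \<Longrightarrow> k \<in> {1..m} \<Longrightarrow>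
      lifted_bracket n (gz_p_hat n (tri (m - 1) + k)) g z = (\<Sum>j\<in>{1..m}. B k j * lifted_bracket n (\<lambda>z. fst z (j, m)) g z)"
proof -
  let ?X = "(\<lambda>j \<nu>. \<nu> (j, m) :: complex) ` {1..m}"
  obtain A C where A: "\<And>k. k \<in> {1..m} \<Longrightarrow> curve_partials ?X UNIV \<nu> (eig_coeff m (k - 1)) (A k)"
    and C: "\<And>k j. k \<in> {1..m} \<Longrightarrow> j \<in> {1..m} \<Longrightarrow>
      (\<Sum>k'\<in>{1..m}. C k k' * A k' (\<lambda>\<nu>. \<nu> (j, m))) = (if k = j then 1 else 0)"
    using eig_coeff_jacobian[OF e_Omega_inj[OF nu m]] by blast
  define sg :: "nat \<Rightarrow> complex" where "sg k = (-1) ^ (m - k + 1)" for k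
  have sg: "sg k * sg k = 1" for k by (simp add: sg_def power_mult_distrib[symmetric])
  let ?B = "\<lambda>k j. sg k * A k (\<lambda>\<nu>. \<nu> (j, m))"
  let ?D = "\<lambda>k k'. C k k' * sg k'"
  show ?thesis
  proof (rule that[of ?D ?B])
    fix k j assume kj: "k \<in> {1..m}" "j \<in> {1..m}"
    have "?D k k' * ?B k' j = C k k' * A k' (\<lambda>\<nu>. \<nu> (j, m))" for k'
      using sg[of k'] by (simp add: algebra_simps)
    then show "(\<Sum>k'\<in>{1..m}. ?D k k' * ?B k' j) = (if k = j then 1 else 0)"
      using C[OF kj] by (simp only:)
  next
    fix z g k assume z: "z \<in> M_fibre n \<nu>" and g: "g \<in> O_M_e n" and k: "k \<in> {1..m}"
    note zM = M_fibreD(1)[OF z] and zn = M_fibreD(2)[OF z]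
    have idx: "(j, m) \<in> eig_index n" if "j \<in> {1..m}" for j using that m by (simp add: eig_index_mem)
    obtain d where d: "mat_linear n (dlift n z g) d" using mat_linear_dlift[OF zM g] by blast
    obtain c where c: "\<And>j. j \<in> {1..m} \<Longrightarrow> mat_linear n (dlift n z (\<lambda>z. fst z (j, m))) (c j)"
      using mat_linear_dlift_coord[OF zM coordinate_mem[OF idx]] by metis
    have f: "dlift n z (gz_p_hat n (tri (m - 1) + k)) v = (\<Sum>j\<in>{1..m}. ?B k j * dlift n z (\<lambda>z. fst z (j, m)) v)"
      if v: "v \<in> carrier_mat n n" for v
    proof -
      let ?g = "\<lambda>t. sec n z (snd z + t \<cdot>\<^sub>m v)"
      let ?d = "\<lambda>q. dlift n z (\<lambda>z. q (fst z)) v"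
      have "((\<lambda>t. q (fst (?g t))) has_field_derivative ?d q) (at 0)" if "q \<in> ?X" for q
        using that coord_derivative[OF zM v, of "\<lambda>z. q (fst z)"] by (auto simp: coordinate_mem idx)
      then have "((\<lambda>t. eig_coeff m (k - 1) (fst (?g t))) has_field_derivative (\<Sum>q\<in>?X. A k q * ?d q)) (at 0)"
        using A[OF k, unfolded curve_partials_def, rule_format, of "\<lambda>t. fst (?g t)" ?d] sec_curve(1)[OF zM v] zn by simp
      from DERIV_cmult[OF this, of "sg k"]
      have "dlift n z (\<lambda>z. sg k * eig_coeff m (k - 1) (fst z)) v = sg k * (\<Sum>q\<in>?X. A k q * ?d q)"
        by (rule dlift_eqI)
      moreover have "dlift n z (gz_p_hat n (tri (m - 1) + k)) v = dlift n z (\<lambda>z. sg k * eig_coeff m (k - 1) (fst z)) v"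
        by (rule dlift_cong[OF zM v]) (simp only: gz_p_hat_eq[OF _ m k] sg_def)
      ultimately show ?thesis
        by (simp add: sum.reindex[OF coordinate_inj] sum_distrib_left mult.assoc)
    qed
    show "lifted_bracket n (gz_p_hat n (tri (m - 1) + k)) g z = (\<Sum>j\<in>{1..m}. ?B k j * lifted_bracket n (\<lambda>z. fst z (j, m)) g z)"
      by (rule lifted_bracket_linear[where h = "\<lambda>j z. fst z (j, m)" and I = "{1..m}" and b = "?B k", OF zM d c f])
  qed
qed

section \<open>Single indices i versus pairs (k, m)\<close>

lemma tri_index:
  assumes "i \<in> {1..tri N}"
  obtains k m where "m \<in> {1..N}" "k \<in> {1..m}" "i = tri (m - 1) + k" "level i = m" "position i = k"
proof -
  have le: "i \<le> tri (level i)" unfolding level_def using assms by (intro LeastI[of "\<lambda>m. i \<le> tri m" N]) simp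
  have lN: "level i \<le> N" unfolding level_def using assms by (intro Least_le[of "\<lambda>m. i \<le> tri m" N]) simp
  have l0: "level i \<noteq> 0"
  proof
    assume "level i = 0"
    with le have "i \<le> tri 0" by simp
    then show False using assms by (simp add: tri_def)
  qed
  then obtain l where l: "level i = Suc l" by (cases "level i") auto
  have "\<not> i \<le> tri l" using not_less_Least[of l "\<lambda>m. i \<le> tri m"] l by (simp add: level_def)
  then have "tri l < i" by simp
  then obtain d where d: "d > 0" "i = tri l + d" by (auto dest: less_imp_add_positive)
  have pos: "position i = i - tri l" by (simp add: position_def l)
  have pos': "position i = d" using pos d by simp
  have "d \<le> Suc l" using le[unfolded l tri_Suc] d(2) by linarith
  show ?thesis
  proof (rule that)
    show "level i \<in> {1..N}" using lN l by simp
    show "position i \<in> {1..level i}" unfolding pos' l using d(1) \<open>d \<le> Suc l\<close> by simp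
    show "i = tri (level i - 1) + position i" unfolding pos' l using d(2) by simp
  qed (rule refl)+
qed

lemma tri_index_mem:
  assumes "m \<in> {1..N}" "k \<in> {1..m}"
  shows "tri (m - 1) + k \<in> {1..tri N}"
proof -
  obtain l where l: "m = Suc l" using assms by (cases m) auto
  have "tri (m - 1) + k \<le> tri m" using assms by (simp add: l tri_Suc)
  also have "\<dots> \<le> tri N" using assms by (intro tri_mono) simp
  finally show ?thesis using assms by simp
qed

lemma sum_tri: "(\<Sum>i\<in>{1..tri N}. F i) = (\<Sum>m\<in>{1..N}. \<Sum>k\<in>{1..m}. F (tri (m - 1) + k))"
proof -
  have "(\<Sum>i\<in>{1..tri N}. F i) = (\<Sum>p\<in>eig_index N. F (tri (snd p - 1) + fst p))"
  proof (rule sum.reindex_bij_witness[of _ "\<lambda>p. tri (snd p - 1) + fst p" "\<lambda>i. (position i, level i)"])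
    fix i assume "i \<in> {1..tri N}"
    then obtain k m where "m \<in> {1..N}" "k \<in> {1..m}" "i = tri (m - 1) + k" "level i = m" "position i = k"
      by (rule tri_index)
    then show "tri (snd (position i, level i) - 1) + fst (position i, level i) = i"
      "(position i, level i) \<in> eig_index N"
      "F (tri (snd (position i, level i) - 1) + fst (position i, level i)) = F i"
      by (simp_all only: fst_conv snd_conv eig_index_mem)
  next
    fix p assume "p \<in> eig_index N"
    then obtain k m where p: "p = (k, m)" "m \<in> {1..N}" "k \<in> {1..m}" by (rule eig_indexE)
    then have k: "1 \<le> k" "k \<le> m" by auto
    show "tri (snd p - 1) + fst p \<in> {1..tri N}" using tri_index_mem[OF p(2,3)] by (simp only: p(1) fst_conv snd_conv)
    show "(position (tri (snd p - 1) + fst p), level (tri (snd p - 1) + fst p)) = p"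
      by (simp only: p(1) fst_conv snd_conv level_position[OF k])
  qed
  then show ?thesis by (simp add: sum_eig_index)
qed

lemma basis_of_functionals_independent:
  assumes "basis_of_functionals R T I b" "\<And>\<psi>. \<psi> \<in> R \<Longrightarrow> (\<Sum>i\<in>I. c i * b i \<psi>) = 0" "i \<in> I"
  shows "c i = 0"
  using assms unfolding basis_of_functionals_def by blast

text \<open>The two systems of fields are related by invertible matrices that are constant on the
  fibre, so the coefficients with respect to the p fields are b D, again constant. Any other
  expansion has the same values at each z, since the eigenvalue fields are independent
  there.\<close>

lemma ham_expansion_J_e:
  assumes f: "f \<in> J_e n" and nu: "\<nu> \<in> e_Omega n" and n: "n \<ge> 1"
  shows "\<exists>F. ham_expansion n \<nu> f F"
    and "ham_expansion n \<nu> f F \<Longrightarrow> i \<in> {1..tri (n - 1)} \<Longrightarrow> \<exists>c. \<forall>z\<in>M_fibre n \<nu>. F i z = c"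
proof -
  let ?RB = "\<lambda>p g z. lifted_bracket n (\<lambda>z. fst z p) g z"
  obtain b where b: "\<And>z g. z \<in> M_fibre n \<nu> \<Longrightarrow> g \<in> O_M_e n \<Longrightarrow>
    lifted_bracket n f g z = (\<Sum>p\<in>eig_index (n - 1). b p * ?RB p g z)"
    using J_e_bracket[OF f nu n] by blast
  \<comment> \<open>One predicate for both facts, so that D and B can be chosen for all levels
    together.\<close>
  define Q where "Q m D B \<longleftrightarrow>
     (\<forall>k\<in>{1..m}. \<forall>j\<in>{1..m}. (\<Sum>k'\<in>{1..m}. D k k' * B k' j) = (if k = j then 1 else 0)) \<and>
     (\<forall>z\<in>M_fibre n \<nu>. \<forall>g\<in>O_M_e n. \<forall>k\<in>{1..m}. lifted_bracket n (gz_p_hat n (tri (m - 1) + k)) g z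
        = (\<Sum>j\<in>{1..m}. B k j * ?RB (j, m) g z))" for m D B
  have "\<exists>D B. Q m D B" if m: "m \<in> {1..n}" for m
    by (rule gz_p_hat_bracket[OF nu m]) (unfold Q_def, blast)
  then obtain D B where Q: "\<And>m. m \<in> {1..n} \<Longrightarrow> Q m (D m) (B m)" by metis
  have DB: "(\<Sum>k'\<in>{1..m}. D m k k' * B m k' j) = (if k = j then 1 else 0)"
    if "m \<in> {1..n}" "k \<in> {1..m}" "j \<in> {1..m}" for m k j
    using Q[OF that(1)] that(2,3) unfolding Q_def by blast
  have PB: "lifted_bracket n (gz_p_hat n (tri (m - 1) + k)) g z = (\<Sum>j\<in>{1..m}. B m k j * ?RB (j, m) g z)"
    if "m \<in> {1..n}" "z \<in> M_fibre n \<nu>" "g \<in> O_M_e n" "k \<in> {1..m}" for m k z g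
    using Q[OF that(1)] that(2-4) unfolding Q_def by blast
  have BD: "(\<Sum>k'\<in>{1..m}. B m k k' * D m k' j) = (if k = j then 1 else 0 :: complex)"
    if "m \<in> {1..n}" "k \<in> {1..m}" "j \<in> {1..m}" for m k j
    by (rule left_inverse_imp_right_inverse[of m "D m" "B m", OF DB[OF that(1)] that(2,3)])
  have P_sum: "(\<Sum>i\<in>{1..tri (n - 1)}. F i * ham_vec n (gz_p_hat n i) z g)
      = (\<Sum>p\<in>eig_index (n - 1). (\<Sum>k\<in>{1..snd p}. F (tri (snd p - 1) + k) * B (snd p) k (fst p)) * ?RB p g z)"
    if z: "z \<in> M_fibre n \<nu>" and g: "g \<in> O_M_e n" for F :: "nat \<Rightarrow> complex" and z g
    unfolding sum_tri sum_eig_index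
  proof (rule sum.cong[OF refl])
    fix m assume "m \<in> {1..n - 1}"
    then have m: "m \<in> {1..n}" by auto
    have "(\<Sum>k\<in>{1..m}. F (tri (m - 1) + k) * ham_vec n (gz_p_hat n (tri (m - 1) + k)) z g)
        = (\<Sum>k\<in>{1..m}. \<Sum>j\<in>{1..m}. F (tri (m - 1) + k) * B m k j * ?RB (j, m) g z)"
    proof (rule sum.cong[OF refl])
      fix k assume k: "k \<in> {1..m}"
      show "F (tri (m - 1) + k) * ham_vec n (gz_p_hat n (tri (m - 1) + k)) z g
          = (\<Sum>j\<in>{1..m}. F (tri (m - 1) + k) * B m k j * ?RB (j, m) g z)"
        unfolding ham_vec_def restrict_apply if_P[OF g] PB[OF m z g k] sum_distrib_left by (simp only: mult.assoc)
    qed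
    also have "\<dots> = (\<Sum>j\<in>{1..m}. \<Sum>k\<in>{1..m}. F (tri (m - 1) + k) * B m k j * ?RB (j, m) g z)"
      by (rule sum.swap)
    finally show "(\<Sum>k\<in>{1..m}. F (tri (m - 1) + k) * ham_vec n (gz_p_hat n (tri (m - 1) + k)) z g)
        = (\<Sum>j\<in>{1..m}. (\<Sum>k\<in>{1..snd (j, m)}. F (tri (snd (j, m) - 1) + k) * B (snd (j, m)) k (fst (j, m))) * ?RB (j, m) g z)"
      by (simp add: sum_distrib_right)
  qed
  \<comment> \<open>The row vector b D, level by level; multiplying it by B returns b.\<close>
  define G where "G i = (\<Sum>j\<in>{1..level i}. b (j, level i) * D (level i) j (position i))" for i
  have GB: "(\<Sum>k\<in>{1..m}. G (tri (m - 1) + k) * B m k j) = b (j, m)" if m: "m \<in> {1..n}" and j: "j \<in> {1..m}" for m j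
  proof -
    have "(\<Sum>k\<in>{1..m}. G (tri (m - 1) + k) * B m k j) = (\<Sum>k\<in>{1..m}. \<Sum>j'\<in>{1..m}. b (j', m) * (D m j' k * B m k j))"
    proof (rule sum.cong[OF refl])
      fix k assume "k \<in> {1..m}"
      then have k: "1 \<le> k" "k \<le> m" by auto
      show "G (tri (m - 1) + k) * B m k j = (\<Sum>j'\<in>{1..m}. b (j', m) * (D m j' k * B m k j))"
        unfolding G_def level_position[OF k] sum_distrib_right by (simp only: mult.assoc)
    qed
    also have "\<dots> = (\<Sum>j'\<in>{1..m}. b (j', m) * (\<Sum>k\<in>{1..m}. D m j' k * B m k j))"
      unfolding sum_distrib_left by (rule sum.swap)
    also have "\<dots> = (\<Sum>j'\<in>{1..m}. if j' = j then b (j, m) else 0)"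
      using DB[OF m _ j] by (intro sum.cong) auto
    finally show ?thesis using j by simp
  qed
  show "\<exists>F. ham_expansion n \<nu> f F"
  proof (intro exI[of _ "\<lambda>i. \<lambda>z\<in>M_fibre n \<nu>. G i"], unfold ham_expansion_def, intro conjI ballI)
    show "(\<lambda>z\<in>M_fibre n \<nu>. G i) \<in> O_fibre n \<nu>" for i unfolding O_fibre_def by (rule regular_funs_const)
    fix z \<psi> assume z: "z \<in> M_fibre n \<nu>" and \<psi>: "\<psi> \<in> O_M_e n"
    have "(\<Sum>i\<in>{1..tri (n - 1)}. (\<lambda>z\<in>M_fibre n \<nu>. G i) z * ham_vec n (gz_p_hat n i) z \<psi>) =
       (\<Sum>i\<in>{1..tri (n - 1)}. G i * ham_vec n (gz_p_hat n i) z \<psi>)" using z by simp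
    also have "\<dots> = (\<Sum>p\<in>eig_index (n - 1). b p * ?RB p \<psi> z)"
      unfolding P_sum[OF z \<psi>]
    proof (rule sum.cong[OF refl])
      fix p assume "p \<in> eig_index (n - 1)"
      then obtain k m where p: "p = (k, m)" "m \<in> {1..n - 1}" "k \<in> {1..m}" by (rule eig_indexE)
      then have "m \<in> {1..n}" by auto
      from GB[OF this p(3)] show "(\<Sum>k\<in>{1..snd p}. G (tri (snd p - 1) + k) * B (snd p) k (fst p)) * ?RB p \<psi> z = b p * ?RB p \<psi> z"
        by (simp add: p(1))
    qed
    finally show "ham_vec n f z \<psi> = (\<Sum>i\<in>{1..tri (n - 1)}. (\<lambda>z\<in>M_fibre n \<nu>. G i) z * ham_vec n (gz_p_hat n i) z \<psi>)"
      using b[OF z \<psi>] \<psi> by (simp add: ham_vec_def)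
  qed
  show "\<exists>c. \<forall>z\<in>M_fibre n \<nu>. F i z = c" if F: "ham_expansion n \<nu> f F" and i: "i \<in> {1..tri (n - 1)}"
  proof (intro exI[of _ "G i"] ballI)
    fix z assume z: "z \<in> M_fibre n \<nu>"
    note zM = M_fibreD(1)[OF z]
    obtain k m where km: "m \<in> {1..n - 1}" "k \<in> {1..m}" "i = tri (m - 1) + k" "level i = m" "position i = k"
      using i by (rule tri_index)
    then have m: "m \<in> {1..n}" by auto
    have idx: "p \<in> eig_index n" if "p \<in> eig_index (n - 1)" for p
      using that eig_index_mono[of "n - 1" n] by (meson diff_le_self subsetD)
    \<comment> \<open>The given expansion minus that by \<open>b\<close>, both rewritten in the
      eigenvalue fields; independence forces it to be 0.\<close>
    let ?c = "\<lambda>p. (\<Sum>k\<in>{1..snd p}. F (tri (snd p - 1) + k) z * B (snd p) k (fst p)) - b p"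
    have "(\<Sum>p\<in>eig_index (n - 1). ?c p * ham_vec n (\<lambda>z\<in>M_Omega_e n. fst z p) z \<psi>) = 0" if \<psi>: "\<psi> \<in> O_M_e n" for \<psi>
    proof -
      have "(\<Sum>p\<in>eig_index (n - 1). ?c p * ham_vec n (\<lambda>z\<in>M_Omega_e n. fst z p) z \<psi>) = (\<Sum>p\<in>eig_index (n - 1). ?c p * ?RB p \<psi> z)"
        by (intro sum.cong refl) (simp add: ham_vec_def \<psi> bracket_coordinate_restrict[OF zM idx \<psi>])
      also have "\<dots> = (\<Sum>i\<in>{1..tri (n - 1)}. F i z * ham_vec n (gz_p_hat n i) z \<psi>) - lifted_bracket n f \<psi> z"
        unfolding P_sum[OF z \<psi>] b[OF z \<psi>] by (simp add: left_diff_distrib sum_subtractf)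
      also have "\<dots> = ham_vec n f z \<psi> - lifted_bracket n f \<psi> z"
        using F z \<psi> unfolding ham_expansion_def by simp
      finally show ?thesis using \<psi> by (simp add: ham_vec_def)
    qed
    then have c0: "?c p = 0" if "p \<in> eig_index (n - 1)" for p
      by (rule basis_of_functionals_independent[OF coordinate_basis[OF z nu n], where c = ?c, OF _ that])
    have FB: "(\<Sum>k'\<in>{1..m}. F (tri (m - 1) + k') z * B m k' j) = b (j, m)" if j: "j \<in> {1..m}" for j
      using c0[of "(j, m)"] j km(1) by (simp add: eig_index_mem)
    \<comment> \<open>D is also a right inverse of B, so b = F B can be solved for F.\<close>
    have "G i = (\<Sum>j\<in>{1..m}. (\<Sum>k'\<in>{1..m}. F (tri (m - 1) + k') z * B m k' j) * D m j k)"
      unfolding G_def km(4,5) using FB by (intro sum.cong) auto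
    also have "\<dots> = (\<Sum>k'\<in>{1..m}. F (tri (m - 1) + k') z * (\<Sum>j\<in>{1..m}. B m k' j * D m j k))"
      unfolding sum_distrib_left sum_distrib_right by (subst sum.swap) (simp add: mult.assoc)
    also have "\<dots> = (\<Sum>k'\<in>{1..m}. if k' = k then F (tri (m - 1) + k) z else 0)"
      using BD[OF m _ km(2)] by (intro sum.cong) auto
    finally show "F i z = G i" using km(2,3) by simp
  qed
qed

subsection \<open>Maximality\<close>

lemma eig_frame_right_eigenvector:
  assumes fr: "eig_frame m x l w u" and ev: "\<And>i. i < m \<Longrightarrow> (\<Sum>j<m. x $$ (i, j) * v j) = c * v i"
    and c: "c \<notin> l ` {1..m}" and i: "i < m"
  shows "v i = 0"
proof -
  have 0: "(\<Sum>j<m. u k j * v j) = 0" if k: "k \<in> {1..m}" for k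
  proof -
    have "c * (\<Sum>i<m. u k i * v i) = (\<Sum>i<m. u k i * (\<Sum>j<m. x $$ (i, j) * v j))"
      unfolding sum_distrib_left[of c] by (intro sum.cong refl) (simp add: ev mult.left_commute)
    also have "\<dots> = (\<Sum>j<m. (\<Sum>i<m. u k i * x $$ (i, j)) * v j)"
      unfolding sum_distrib_left sum_distrib_right by (subst sum.swap) (simp add: mult.assoc)
    also have "\<dots> = l k * (\<Sum>i<m. u k i * v i)"
      unfolding sum_distrib_left by (intro sum.cong refl) (simp add: eig_frameD(2)[OF fr k])
    finally show ?thesis using c k by auto
  qed
  have "v i = (\<Sum>k\<in>{1..m}. w k i * (\<Sum>j<m. u k j * v j))"
    by (rule eig_frame_expand_column[OF fr i, symmetric])
  also have "\<dots> = 0" by (intro sum.neutral ballI) (simp only: 0 mult_zero_right)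
  finally show ?thesis .
qed

text \<open>Eigenvectors of the two (m + 1)-blocks for one eigenvalue can be scaled to a common last
  entry. A nonzero difference would be an eigenvector of x_m for an eigenvalue that x_m does not
  have. So they coincide, and the two last rows agree on a basis.\<close>

lemma last_row_unique:
  assumes fr: "eig_frame m x l w u" and fr': "eig_frame (Suc m) x l' w' u'" and fr'': "eig_frame (Suc m) y l' w'' u''"
    and disj: "l ` {1..m} \<inter> l' ` {1..Suc m} = {}"
    and eq: "\<And>i j. i < m \<Longrightarrow> j < Suc m \<Longrightarrow> x $$ (i, j) = y $$ (i, j)" and j: "j < Suc m"
  shows "x $$ (m, j) = y $$ (m, j)"
proof -
  have fry: "eig_frame m y l w u"
    using fr eq by (subst eig_frame_cong[of m y x l l]) auto
  have nz: "w k m \<noteq> 0" if z: "eig_frame m z l w0 u0" "eig_frame (Suc m) z l' w u" and k: "k \<in> {1..Suc m}" for z w u w0 u0 k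
  proof
    assume w0: "w k m = 0"
    have "(\<Sum>j<m. z $$ (i, j) * w k j) = l' k * w k i" if "i < m" for i
      using eig_frameD(1)[OF z(2) k, of i] that w0 by simp
    moreover have "l' k \<notin> l ` {1..m}" using disj k by blast
    ultimately have "w k i = 0" if "i < m" for i
      using eig_frame_right_eigenvector[OF z(1), of "w k" "l' k"] that by blast
    then have "w k i = 0" if "i < Suc m" for i using that w0 by (cases "i = m") auto
    then show False using eig_frameD(3)[OF z(2) k k] by simp
  qed
  have row: "(\<Sum>j<Suc m. (x $$ (m, j) - y $$ (m, j)) * w' k j) = 0" if k: "k \<in> {1..Suc m}" for k
  proof -
    \<comment> \<open>Scaling to equal last entries; the denominator is nonzero by
      \<open>nz\<close>.\<close>
    define a where "a = w' k m / w'' k m"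
    have am: "w' k m = a * w'' k m" using nz[OF fry fr'' k] by (simp add: a_def)
    have "(\<Sum>j<m. x $$ (i, j) * (w' k j - a * w'' k j)) = l' k * (w' k i - a * w'' k i)" if i: "i < m" for i
    proof -
      have "(\<Sum>j<Suc m. x $$ (i, j) * w'' k j) = l' k * w'' k i"
        using eig_frameD(1)[OF fr'' k, of i] i eq[OF i] by simp
      moreover have "(\<Sum>j<Suc m. x $$ (i, j) * w' k j) = l' k * w' k i"
        using eig_frameD(1)[OF fr' k, of i] i by simp
      ultimately have "(\<Sum>j<Suc m. x $$ (i, j) * w' k j) - a * (\<Sum>j<Suc m. x $$ (i, j) * w'' k j) = l' k * (w' k i - a * w'' k i)"
        by (simp only: right_diff_distrib mult.left_commute)
      then show ?thesis
        by (simp add: am sum_distrib_left sum_subtractf right_diff_distrib distrib_left mult.left_commute)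
    qed
    moreover have "l' k \<notin> l ` {1..m}" using disj k by blast
    ultimately have "w' k j - a * w'' k j = 0" if "j < m" for j
      using eig_frame_right_eigenvector[OF fr, of "\<lambda>j. w' k j - a * w'' k j" "l' k"] that by blast
    then have w: "w' k j = a * w'' k j" if "j < Suc m" for j using that am by (cases "j = m") auto
    have "(\<Sum>j<Suc m. y $$ (m, j) * w' k j) = a * (\<Sum>j<Suc m. y $$ (m, j) * w'' k j)"
      unfolding sum_distrib_left by (intro sum.cong refl) (simp add: w)
    also have "\<dots> = l' k * w' k m" using eig_frameD(1)[OF fr'' k, of m] by (simp add: am)
    also have "\<dots> = (\<Sum>j<Suc m. x $$ (m, j) * w' k j)" using eig_frameD(1)[OF fr' k, of m] by simp
    finally show ?thesis by (simp add: left_diff_distrib sum_subtractf)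
  qed
  have "x $$ (m, j) - y $$ (m, j) = (\<Sum>k\<in>{1..Suc m}. (\<Sum>j<Suc m. (x $$ (m, j) - y $$ (m, j)) * w' k j) * u' k j)"
    by (rule eig_frame_expand_row[OF fr' j, symmetric])
  also have "\<dots> = 0" by (intro sum.neutral ballI) (simp only: row mult_zero_left)
  finally show ?thesis by simp
qed

lemma flow_invariant:
  assumes f: "f \<in> O_M_e n" and comm: "\<And>p y. p \<in> eig_index n \<Longrightarrow> y \<in> M_Omega_e n \<Longrightarrow> lifted_bracket n (\<lambda>z. fst z p) f y = 0"
    and z: "z \<in> M_Omega_e n" and m: "m \<in> {1..n}" and k: "k \<in> {1..m}"
    and fr: "eig_frame m (snd z) (\<lambda>k. fst z (k, m)) w u"
  shows "f (fst z, eig_flow n m (snd z) (fst z (k, m)) (w k) (u k) s) = f z"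
proof -
  let ?y = "\<lambda>s. (fst z, eig_flow n m (snd z) (fst z (k, m)) (w k) (u k) s)"
  have p: "(k, m) \<in> eig_index n" using m k by (simp add: eig_index_mem)
  have "((\<lambda>s. f (?y s)) has_field_derivative 0) (at s)" for s
    using flow_function_derivative[OF z m k fr f, of s] comm[OF p eig_flow_mem[OF z m k fr]] by simp
  then have "\<exists>c. \<forall>s\<in>UNIV. f (?y s) = c"
    by (intro has_field_derivative_zero_constant) auto
  then obtain c where "\<And>s. f (?y s) = c" by blast
  then have "f (?y s) = f (?y 0)" by simp
  then show ?thesis using M_Omega_eD(2)[OF z] by (simp add: eig_flow_0)
qed

text \<open>Transitivity of the flows, one block at a time. Once the N-th blocks agree, flows of
  level N fix that block and rescale the components of the next column along the eigenvectors
  independently of each other; the next row then agrees by \<open>last_row_unique\<close>. All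
  intermediate points stay in the fibre and keep the value of f.\<close>

lemma fibre_invariant:
  assumes f: "f \<in> O_M_e n" and comm: "\<And>p y. p \<in> eig_index n \<Longrightarrow> y \<in> M_Omega_e n \<Longrightarrow> lifted_bracket n (\<lambda>z. fst z p) f y = 0"
    and z: "z \<in> M_fibre n \<nu>" and z': "z' \<in> M_fibre n \<nu>"
  shows "f z = f z'"
proof -
  let ?x' = "snd z'"
  note zM' = M_fibreD(1)[OF z'] and zn' = M_fibreD(2)[OF z']
  \<comment> \<open>Size 0 has the empty frame, so passing from size 0 to 1 is no special
    case.\<close>
  have frame: "\<exists>w u. eig_frame m (snd y) (\<lambda>k. \<nu> (k, m)) w u" if "y \<in> M_fibre n \<nu>" "m \<le> n" for y m
    using M_Omega_e_frame[OF M_fibreD(1)[OF that(1)], of m] M_fibreD(2)[OF that(1)] that(2)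
    by (cases "m = 0") (auto simp: eig_frame_def)
  have "\<exists>y\<in>M_fibre n \<nu>. f y = f z \<and> (\<forall>i<N. \<forall>j<N. snd y $$ (i, j) = ?x' $$ (i, j))" if "N \<le> n" for N
    using that
  proof (induction N)
    case 0
    then show ?case using z by auto
  next
    case (Suc N)
    then obtain y where y: "y \<in> M_fibre n \<nu>" "f y = f z" and yx: "\<forall>i<N. \<forall>j<N. snd y $$ (i, j) = ?x' $$ (i, j)"
      by auto
    have nu: "\<nu> \<in> e_Omega n" using M_Omega_eD(1)[OF zM'] zn' by simp
    have Nn: "N < n" using Suc.prems by simp
    obtain w u where fr: "eig_frame N ?x' (\<lambda>k. \<nu> (k, N)) w u" using frame[OF z'] Nn by force
    obtain w' u' where fr': "eig_frame (Suc N) ?x' (\<lambda>k. \<nu> (k, Suc N)) w' u'" using frame[OF z' Suc.prems] by blast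
    have disj: "(\<lambda>k. \<nu> (k, N)) ` {1..N} \<inter> (\<lambda>k. \<nu> (k, Suc N)) ` {1..Suc N} = {}"
      using e_Omega_disj[OF nu, of N] Nn by (cases "N = 0") auto
    have step: "\<exists>y'\<in>M_fibre n \<nu>. f y' = f z \<and> (\<forall>i<N. \<forall>j<N. snd y' $$ (i, j) = ?x' $$ (i, j)) \<and>
        (\<forall>k\<in>K. (\<Sum>i<N. u k i * snd y' $$ (i, N)) = (\<Sum>i<N. u k i * ?x' $$ (i, N)))"
      if "finite K" "K \<subseteq> {1..N}" for K
      using that
    proof (induction K)
      case empty
      then show ?case using y yx by auto
    next
      case (insert k K)
      then obtain y' where y': "y' \<in> M_fibre n \<nu>" "f y' = f z" and yx': "\<forall>i<N. \<forall>j<N. snd y' $$ (i, j) = ?x' $$ (i, j)"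
        and K: "\<forall>k\<in>K. (\<Sum>i<N. u k i * snd y' $$ (i, N)) = (\<Sum>i<N. u k i * ?x' $$ (i, N))" by auto
      have k: "k \<in> {1..N}" using insert.prems by auto
      have N: "N \<in> {1..n}" using k Nn by auto
      note yM = M_fibreD(1)[OF y'(1)] and yn = M_fibreD(2)[OF y'(1)]
      \<comment> \<open>The frame of x' at level N serves y' too, as the N-th blocks agree; hence
        the components compared below refer to one basis.\<close>
      have fry: "eig_frame N (snd y') (\<lambda>k. \<nu> (k, N)) w u"
        using fr yx' by (subst eig_frame_cong[of N "snd y'" ?x']) auto
      obtain wy uy where fry': "eig_frame (Suc N) (snd y') (\<lambda>k. \<nu> (k, Suc N)) wy uy" using frame[OF y'(1) Suc.prems] by blast
      define b where "b = (\<Sum>i<N. u k i * snd y' $$ (i, N))"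
      define b' where "b' = (\<Sum>i<N. u k i * ?x' $$ (i, N))"
      have b0: "b \<noteq> 0" "b' \<noteq> 0"
        unfolding b_def b'_def using last_column_nonzero[OF fry fry' disj k] last_column_nonzero[OF fr fr' disj k] by auto
      \<comment> \<open>The flow multiplies the k-th component b by exp s. Both b and b' are
        nonzero, so a logarithm of their ratio is the required time.\<close>
      define s where "s = Ln (b' / b)"
      have es: "exp s = b' / b" unfolding s_def using b0 by (intro exp_Ln) auto
      let ?y = "(fst y', eig_flow n N (snd y') (fst y' (k, N)) (w k) (u k) s)"
      note fl = fry[folded yn]
      have mem: "?y \<in> M_fibre n \<nu>"
        using eig_flow_mem[OF yM N k fl] yn by (simp add: M_fibre_def)
      have inv: "f ?y = f z" using flow_invariant[OF f comm yM N k fl, of s] y'(2) by simp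
      have blk: "snd ?y $$ (i, j) = ?x' $$ (i, j)" if "i < N" "j < N" for i j
        using eig_flow_block[OF fl k _ that, of n s] Nn yx' that by simp
      have col: "(\<Sum>i<N. u k' i * snd ?y $$ (i, N)) = (\<Sum>i<N. u k' i * snd y' $$ (i, N)) + (exp s - 1) * (if k' = k then 1 else 0) * b"
        if k': "k' \<in> {1..N}" for k'
      proof -
        have "(\<Sum>i<N. u k' i * snd ?y $$ (i, N)) = (\<Sum>i<N. u k' i * snd y' $$ (i, N) + (exp s - 1) * b * (u k' i * w k i))"
        proof (rule sum.cong[OF refl])
          fix i assume "i \<in> {..<N}"
          then have i: "i < N" by simp
          show "u k' i * snd ?y $$ (i, N) = u k' i * snd y' $$ (i, N) + (exp s - 1) * b * (u k' i * w k i)"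
            unfolding snd_conv eig_flow_column[OF fl k less_imp_le[OF Nn] i order_refl Nn] b_def
            by (simp only: distrib_left mult_ac)
        qed
        also have "\<dots> = (\<Sum>i<N. u k' i * snd y' $$ (i, N)) + (exp s - 1) * b * (\<Sum>i<N. u k' i * w k i)"
          by (simp add: sum.distrib sum_distrib_left)
        also have "(\<Sum>i<N. u k' i * w k i) = (if k' = k then 1 else 0)" by (rule eig_frameD(3)[OF fr k' k])
        finally show ?thesis by simp
      qed
      have "(\<Sum>i<N. u k' i * snd ?y $$ (i, N)) = (\<Sum>i<N. u k' i * ?x' $$ (i, N))" if k': "k' \<in> insert k K" for k'
      proof (cases "k' = k")
        case True
        have "(\<Sum>i<N. u k i * snd ?y $$ (i, N)) = exp s * b"
          unfolding col[OF k] b_def[symmetric] by (simp add: algebra_simps)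
        also have "\<dots> = b'" using b0 by (simp add: es)
        finally show ?thesis using True by (simp only: b'_def)
      next
        case False
        then have "k' \<in> K" using k' by simp
        moreover have "k' \<in> {1..N}" using \<open>k' \<in> K\<close> insert.prems by auto
        ultimately show ?thesis using col[of k'] K False by simp
      qed
      then show ?case using mem inv blk by blast
    qed
    obtain y' where y': "y' \<in> M_fibre n \<nu>" "f y' = f z" and yx': "\<forall>i<N. \<forall>j<N. snd y' $$ (i, j) = ?x' $$ (i, j)"
      and K: "\<forall>k\<in>{1..N}. (\<Sum>i<N. u k i * snd y' $$ (i, N)) = (\<Sum>i<N. u k i * ?x' $$ (i, N))"
      using step[of "{1..N}"] by auto
    have col: "snd y' $$ (i, N) = ?x' $$ (i, N)" if i: "i < N" for i
    proof -
      have "snd y' $$ (i, N) = (\<Sum>k\<in>{1..N}. w k i * (\<Sum>j<N. u k j * snd y' $$ (j, N)))"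
        by (rule eig_frame_expand_column[OF fr i, symmetric])
      also have "\<dots> = (\<Sum>k\<in>{1..N}. w k i * (\<Sum>j<N. u k j * ?x' $$ (j, N)))"
        using K by (intro sum.cong refl) simp
      also have "\<dots> = ?x' $$ (i, N)" by (rule eig_frame_expand_column[OF fr i])
      finally show ?thesis .
    qed
    obtain wy uy where fry': "eig_frame (Suc N) (snd y') (\<lambda>k. \<nu> (k, Suc N)) wy uy" using frame[OF y'(1) Suc.prems] by blast
    have upper: "?x' $$ (i, j) = snd y' $$ (i, j)" if "i < N" "j < Suc N" for i j
      using that yx' col by (cases "j = N") auto
    have "?x' $$ (N, j) = snd y' $$ (N, j)" if "j < Suc N" for j
      by (rule last_row_unique[OF fr fr' fry' disj upper that])
    then have "snd y' $$ (i, j) = ?x' $$ (i, j)" if "i < Suc N" "j < Suc N" for i j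
      using that upper by (cases "i = N") auto
    then show ?case using y' by blast
  qed
  from this[OF order_refl] obtain y where y: "y \<in> M_fibre n \<nu>" "f y = f z"
    and eq: "\<forall>i<n. \<forall>j<n. snd y $$ (i, j) = ?x' $$ (i, j)" by blast
  have "snd y = ?x'"
    by (rule eq_matI) (use eq M_Omega_eD(2)[OF M_fibreD(1)[OF y(1)]] M_Omega_eD(2)[OF zM'] in auto)
  then have "y = z'" using M_fibreD(2)[OF y(1)] zn' by (simp add: prod_eq_iff)
  with y(2) show ?thesis by simp
qed

section \<open>A polynomial section of \<kappa>_n\<close>

lemma left_eigenvalueI:
  assumes "\<And>j. j < m \<Longrightarrow> (\<Sum>i<m. v i * y $$ (i, j)) = c * v j" and "\<exists>i<m. v i \<noteq> 0"
  shows "eigenvalue (block m y) c"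
proof -
  let ?t = "Matrix.mat m m (\<lambda>(i, j). y $$ (j, i))"
  have "eigenvalue (block m ?t) c"
    by (rule eigenvalueI[of m ?t v c]) (use assms in \<open>simp_all add: mult.commute\<close>)
  moreover have "block m ?t = transpose_mat (block m y)" by (intro eq_matI) auto
  ultimately show ?thesis
    by (simp add: eigenvalue_root_char_poly[of _ m] char_poly_transpose_mat[of _ m])
qed

text \<open>The \<phi>_i are monic of degree i, so the change of basis from the powers of t is
  unitriangular: subtracting a_d \<phi>_d removes the top power without any division, and the
  coefficients stay polynomial.\<close>

lemma monic_basis_expansion:
  assumes c: "\<And>i j. i < d \<Longrightarrow> j < i \<Longrightarrow> c i j \<in> polynomial_funs X"
    and \<phi>: "\<And>i \<nu> t. i < d \<Longrightarrow> \<phi> i \<nu> t = t ^ i + (\<Sum>j<i. c i j \<nu> * t ^ j)"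
    and a: "\<And>i. i < d \<Longrightarrow> a i \<in> polynomial_funs X"
  shows "\<exists>h. (\<forall>i<d. h i \<in> polynomial_funs X) \<and> (\<forall>\<nu> t. (\<Sum>i<d. a i \<nu> * t ^ i) = (\<Sum>i<d. h i \<nu> * \<phi> i \<nu> t))"
  using assms
proof (induction d arbitrary: a)
  case (Suc d)
  have "\<exists>h. (\<forall>i<d. h i \<in> polynomial_funs X) \<and>
      (\<forall>\<nu> t. (\<Sum>i<d. (a i \<nu> - a d \<nu> * c d i \<nu>) * t ^ i) = (\<Sum>i<d. h i \<nu> * \<phi> i \<nu> t))"
  proof (rule Suc.IH)
    show "(\<lambda>\<nu>. a i \<nu> - a d \<nu> * c d i \<nu>) \<in> polynomial_funs X" if "i < d" for i
      by (intro polynomial_funs_diff polynomial_funs.mult) (use that Suc.prems in auto)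
  qed (use Suc.prems in auto)
  then obtain h where h: "\<And>i. i < d \<Longrightarrow> h i \<in> polynomial_funs X"
    "\<And>\<nu> t. (\<Sum>i<d. (a i \<nu> - a d \<nu> * c d i \<nu>) * t ^ i) = (\<Sum>i<d. h i \<nu> * \<phi> i \<nu> t)" by blast
  have "(\<Sum>i<Suc d. a i \<nu> * t ^ i) = (\<Sum>i<Suc d. (h(d := a d)) i \<nu> * \<phi> i \<nu> t)" for \<nu> t
  proof -
    have "(\<Sum>i<Suc d. (h(d := a d)) i \<nu> * \<phi> i \<nu> t) = (\<Sum>i<d. h i \<nu> * \<phi> i \<nu> t) + a d \<nu> * \<phi> d \<nu> t"
      by simp
    also have "\<dots> = (\<Sum>i<Suc d. a i \<nu> * t ^ i)"
      unfolding h(2)[symmetric] Suc.prems(2)[OF lessI]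
      by (simp add: algebra_simps sum_distrib_left sum_subtractf)
    finally show ?thesis ..
  qed
  then show ?case using h(1) Suc.prems(3) by (intro exI[of _ "h(d := a d)"]) (auto simp: less_Suc_eq)
qed simp

lemma eig_coeff_polynomial_funs:
  assumes "m \<le> n" shows "eig_coeff m i \<in> polynomial_funs (coords_e n)"
proof (rule polynomial_funs_mono)
  show "eig_coeff m i \<in> polynomial_funs ((\<lambda>j \<nu>. \<nu> (j, m)) ` {1..m})"
    using coeff_prod_polynomial_funs[of "{1..m}" "{1..m}" m i] by (simp add: eig_coeff_def[abs_def])
  show "(\<lambda>j \<nu>. \<nu> (j, m) :: complex) ` {1..m} \<subseteq> coords_e n"
    using assms by (auto simp: coords_e_def eig_index_def)
qed

text \<open>A polynomial section of \<open>\<kappa>\<^sub>n\<close>: with \<open>\<phi>\<^sub>m(t) = \<Prod>\<^sub>j (t - \<nu>\<^sub>j\<^sub>m)\<close>, the Hessenberg matrix defined by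
  \<open>t \<phi>\<^sub>j = \<phi>\<^sub>j\<^sub>+\<^sub>1 + \<Sum>\<^sub>i\<^sub>\<le>\<^sub>j h\<^sub>i\<^sub>j \<phi>\<^sub>i\<close> has at each root \<open>t\<close> of \<open>\<phi>\<^sub>m\<close> the left eigenvector
  \<open>(\<phi>\<^sub>0(t), \<dots>, \<phi>\<^sub>m\<^sub>-\<^sub>1(t))\<close> of its \<open>m\<close>-th block.\<close>

lemma hessenberg_section:
  obtains \<sigma> where "\<And>\<nu>. \<nu> \<in> e_Omega n \<Longrightarrow> (\<nu>, \<sigma> \<nu>) \<in> M_Omega_e n"
    and "\<And>i j. i < n \<Longrightarrow> j < n \<Longrightarrow> (\<lambda>\<nu>. \<sigma> \<nu> $$ (i, j)) \<in> polynomial_funs (coords_e n)"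
proof -
  define \<phi> where "\<phi> m \<nu> t = (\<Prod>j\<in>{1..m}. t - \<nu> (j, m))" for m and \<nu> :: "nat \<times> nat \<Rightarrow> complex" and t
  have \<phi>: "\<phi> m \<nu> t = t ^ m + (\<Sum>i<m. eig_coeff m i \<nu> * t ^ i)" for m \<nu> t
    unfolding \<phi>_def poly_eig_coeff by (simp add: sum.atLeast1_atMost_eq)
  define expands where "expands j h \<longleftrightarrow> (\<forall>i<Suc j. h i \<in> polynomial_funs (coords_e n)) \<and>
      (\<forall>\<nu> t. t * \<phi> j \<nu> t - \<phi> (Suc j) \<nu> t = (\<Sum>i<Suc j. h i \<nu> * \<phi> i \<nu> t))" for j h
  have "\<exists>h. expands j h" if j: "j < n" for j
  proof -
    \<comment> \<open>Coefficients of t \<phi>_j - \<phi>_{j+1}: the leading terms cancel, so the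
      degree is at most j.\<close>
    define a where "a i \<nu> = (if i = 0 then 0 else eig_coeff j (i - 1) \<nu>) - eig_coeff (Suc j) i \<nu>" for i \<nu>
    have a: "a i \<in> polynomial_funs (coords_e n)" for i
    proof -
      have "(\<lambda>\<nu>. if i = 0 then 0 else eig_coeff j (i - 1) \<nu>) \<in> polynomial_funs (coords_e n)"
        using eig_coeff_polynomial_funs[of j n] j by (cases "i = 0") (auto intro: polynomial_funs.const)
      then show ?thesis unfolding a_def[abs_def] using eig_coeff_polynomial_funs[of "Suc j" n] j
        by (intro polynomial_funs_diff) auto
    qed
    have eq: "t * \<phi> j \<nu> t - \<phi> (Suc j) \<nu> t = (\<Sum>i<Suc j. a i \<nu> * t ^ i)" for \<nu> t
    proof -
      have "(\<Sum>i<Suc j. a i \<nu> * t ^ i) = (\<Sum>i<Suc j. (if i = 0 then 0 else eig_coeff j (i - 1) \<nu>) * t ^ i)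
          - (\<Sum>i<Suc j. eig_coeff (Suc j) i \<nu> * t ^ i)"
        unfolding a_def left_diff_distrib sum_subtractf ..
      also have "(\<Sum>i<Suc j. (if i = 0 then 0 else eig_coeff j (i - 1) \<nu>) * t ^ i) = t * (\<Sum>i<j. eig_coeff j i \<nu> * t ^ i)"
        unfolding sum.lessThan_Suc_shift by (simp add: sum_distrib_left mult.left_commute)
      finally show ?thesis unfolding \<phi> by (simp add: algebra_simps)
    qed
    show ?thesis unfolding expands_def eq
      by (rule monic_basis_expansion[of "Suc j" eig_coeff]) (use \<phi> a eig_coeff_polynomial_funs j in auto)
  qed
  then obtain h where "\<And>j. j < n \<Longrightarrow> expands j (h j)" by metis
  then have h: "\<And>i j. j < n \<Longrightarrow> i \<le> j \<Longrightarrow> h j i \<in> polynomial_funs (coords_e n)"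
    and rec: "\<And>j \<nu> t. j < n \<Longrightarrow> t * \<phi> j \<nu> t - \<phi> (Suc j) \<nu> t = (\<Sum>i<Suc j. h j i \<nu> * \<phi> i \<nu> t)"
    unfolding expands_def by simp_all
  define \<sigma> where "\<sigma> \<nu> = Matrix.mat n n (\<lambda>(i, j). if i \<le> j then h j i \<nu> else if i = Suc j then 1 else 0)" for \<nu>
  show ?thesis
  proof (rule that[of \<sigma>])
    fix i j assume ij: "i < n" "j < n"
    then show "(\<lambda>\<nu>. \<sigma> \<nu> $$ (i, j)) \<in> polynomial_funs (coords_e n)"
      using h by (cases "i \<le> j") (auto simp: \<sigma>_def intro: polynomial_funs.const)
  next
    fix \<nu> assume nu: "\<nu> \<in> e_Omega n"
    have "eigenvalue (block m (\<sigma> \<nu>)) (\<nu> (k, m))" if m: "m \<in> {1..n}" and k: "k \<in> {1..m}" for m k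
    proof (rule left_eigenvalueI)
      let ?t = "\<nu> (k, m)"
      have root: "\<phi> m \<nu> ?t = 0" using k by (auto simp: \<phi>_def)
      show "(\<Sum>i<m. \<phi> i \<nu> ?t * \<sigma> \<nu> $$ (i, j)) = ?t * \<phi> j \<nu> ?t" if j: "j < m" for j
      proof -
        have jn: "j < n" using j m by simp
        have "(\<Sum>i<m. \<phi> i \<nu> ?t * \<sigma> \<nu> $$ (i, j)) = (\<Sum>i<m. if i < Suc j then h j i \<nu> * \<phi> i \<nu> ?t else if i = Suc j then \<phi> i \<nu> ?t else 0)"
          using m jn by (intro sum.cong refl) (auto simp: \<sigma>_def)
        \<comment> \<open>For j = m - 1 the subdiagonal term i = m lies outside the block; it may be
          added because \<phi>_m vanishes at this t.\<close>
        also have "\<dots> = (\<Sum>i<Suc m. if i < Suc j then h j i \<nu> * \<phi> i \<nu> ?t else if i = Suc j then \<phi> i \<nu> ?t else 0)"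
          using j root by auto
        also have "\<dots> = (\<Sum>i<Suc (Suc j). if i < Suc j then h j i \<nu> * \<phi> i \<nu> ?t else if i = Suc j then \<phi> i \<nu> ?t else 0)"
          using j by (intro sum.mono_neutral_right) auto
        also have "\<dots> = (\<Sum>i<Suc j. h j i \<nu> * \<phi> i \<nu> ?t) + \<phi> (Suc j) \<nu> ?t"
          unfolding sum.lessThan_Suc[of _ "Suc j"] by simp
        also have "\<dots> = ?t * \<phi> j \<nu> ?t" unfolding rec[OF jn, symmetric] by simp
        finally show ?thesis .
      qed
      \<comment> \<open>The entry with index 0 is the empty product 1.\<close>
      show "\<exists>i<m. \<phi> i \<nu> ?t \<noteq> 0" using m by (intro exI[of _ 0]) (simp add: \<phi>_def)
    qed
    then have "\<exists>w u. eig_frame m (\<sigma> \<nu>) (\<lambda>k. \<nu> (k, m)) w u" if "m \<in> {1..n}" for m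
      using that by (intro eigenvalues_imp_eig_frame e_Omega_inj[OF nu])
    then show "(\<nu>, \<sigma> \<nu>) \<in> M_Omega_e n" using nu by (simp add: M_Omega_e_iff \<sigma>_def)
  qed
qed

text \<open>Constancy on fibres alone gives only a set-theoretic factorization through \<kappa>_n;
  the polynomial section makes q = f \<circ> (id, \<sigma>) regular.\<close>

lemma J_e_maximal:
  assumes f: "f \<in> O_M_e n" and comm: "\<And>p y. p \<in> eig_index n \<Longrightarrow> y \<in> M_Omega_e n \<Longrightarrow> lifted_bracket n (\<lambda>z. fst z p) f y = 0"
  shows "f \<in> J_e n"
proof -
  obtain \<sigma> where \<sigma>: "\<And>\<nu>. \<nu> \<in> e_Omega n \<Longrightarrow> (\<nu>, \<sigma> \<nu>) \<in> M_Omega_e n"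
    and pol: "\<And>i j. i < n \<Longrightarrow> j < n \<Longrightarrow> (\<lambda>\<nu>. \<sigma> \<nu> $$ (i, j)) \<in> polynomial_funs (coords_e n)"
    using hessenberg_section[of n] by blast
  let ?q = "\<lambda>\<nu>\<in>e_Omega n. f (\<nu>, \<sigma> \<nu>)"
  have "?q \<in> O_e n"
    unfolding O_e_def
  proof (rule regular_funs_pullback[OF f[unfolded O_M_e_def] \<sigma>])
    fix q assume "q \<in> coords_M_e n"
    then show "(\<lambda>\<nu>. q (\<nu>, \<sigma> \<nu>)) \<in> polynomial_funs (coords_e n)"
    proof (cases rule: coords_M_e_cases)
      case (eig k m)
      then show ?thesis by (auto simp: coords_e_def eig_index_mem intro!: polynomial_funs.coord)
    next
      case (entry i j)
      then show ?thesis using pol by simp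
    qed
  qed
  moreover have "f = (\<lambda>z\<in>M_Omega_e n. ?q (fst z))"
  proof (rule extensionalityI[of _ "M_Omega_e n"])
    show "f \<in> extensional (M_Omega_e n)" using f unfolding O_M_e_def by (rule regular_funs_extensional)
    fix z assume z: "z \<in> M_Omega_e n"
    note nu = M_Omega_eD(1)[OF z]
    have "f z = f (fst z, \<sigma> (fst z))"
      by (rule fibre_invariant[OF f comm M_fibreI[OF z]]) (use \<sigma>[OF nu] in \<open>auto simp: M_fibre_def\<close>)
    then show "f z = (\<lambda>z\<in>M_Omega_e n. ?q (fst z)) z" using z nu by simp
  qed simp
  ultimately show ?thesis unfolding J_e_def by blast
qed

lemma basis_of_functionals_reindex:
  assumes B: "basis_of_functionals R T A b" and h: "bij_betw h I A"
  shows "basis_of_functionals R T I (\<lambda>i. b (h i))"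
  unfolding basis_of_functionals_def
proof (intro conjI ballI allI impI)
  show "b (h i) \<in> T" if "i \<in> I" for i
    using B that h unfolding basis_of_functionals_def bij_betw_def by auto
next
  fix c i assume c: "\<forall>\<psi>\<in>R. (\<Sum>i\<in>I. c i * b (h i) \<psi>) = 0" and i: "i \<in> I"
  define c' where "c' a = c (the_inv_into I h a)" for a
  have c'h: "c' (h i) = c i" if "i \<in> I" for i
    using h that by (simp add: c'_def the_inv_into_f_f bij_betw_def)
  have "(\<Sum>a\<in>A. c' a * b a \<psi>) = 0" if "\<psi> \<in> R" for \<psi>
    using c that unfolding sum.reindex_bij_betw[OF h, symmetric] by (simp add: c'h)
  then have "c' (h i) = 0"
    by (rule basis_of_functionals_independent[OF B]) (use h i in \<open>auto simp: bij_betw_def\<close>)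
  then show "c i = 0" using c'h[OF i] by simp
next
  fix D assume "D \<in> T"
  then obtain c where "\<forall>\<psi>\<in>R. D \<psi> = (\<Sum>a\<in>A. c a * b a \<psi>)" using B unfolding basis_of_functionals_def by blast
  then show "\<exists>c. \<forall>\<psi>\<in>R. D \<psi> = (\<Sum>i\<in>I. c i * b (h i) \<psi>)"
    unfolding sum.reindex_bij_betw[OF h, symmetric] by (intro exI[of _ "\<lambda>i. c (h i)"])
qed

lemma tri_level_position:
  assumes "i \<in> {1..tri N}" shows "tri (level i - 1) + position i = i"
  using assms by (rule tri_index) (simp only:)

lemma index_bij_betw: "bij_betw (\<lambda>i. (position i, level i)) {1..tri N} (eig_index N)"
proof (rule bij_betwI')
  fix i j assume ij: "i \<in> {1..tri N}" "j \<in> {1..tri N}"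
  show "((position i, level i) = (position j, level j)) = (i = j)"
  proof
    assume "(position i, level i) = (position j, level j)"
    then have "tri (level i - 1) + position i = tri (level j - 1) + position j" by simp
    then show "i = j" unfolding tri_level_position[OF ij(1)] tri_level_position[OF ij(2)] .
  qed simp
next
  fix i assume "i \<in> {1..tri N}"
  then show "(position i, level i) \<in> eig_index N"
    by (rule tri_index) (simp only: eig_index_mem)
next
  fix p assume "p \<in> eig_index N"
  then obtain k m where p: "p = (k, m)" "m \<in> {1..N}" "k \<in> {1..m}" by (rule eig_indexE)
  then have k: "1 \<le> k" "k \<le> m" by auto
  show "\<exists>i\<in>{1..tri N}. p = (position i, level i)"
    by (rule bexI[OF _ tri_index_mem[OF p(2,3)]]) (simp only: p(1) level_position[OF k])
qed

lemma gz_r_J_e: "i \<in> {1..tri n} \<Longrightarrow> gz_r n i \<in> J_e n"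
  unfolding gz_r_def using index_bij_betw[of n] by (intro J_e_coordinate) (auto simp: bij_betw_def)

theorem theorem4p22:
  fixes n :: nat
  assumes "n \<ge> 1"
  shows "maximal_poisson_commutative_subalgebra n (J_e n)
    \<and> (\<forall>i\<in>{1..tri n}. \<forall>j\<in>{1..tri n}. \<forall>z\<in>M_Omega_e n.
         lifted_bracket n (gz_r n i) (gz_r n j) z = 0)
    \<and> (\<forall>f\<in>J_e n. \<forall>\<nu>\<in>e_Omega n.
         (\<exists>c. \<forall>z\<in>M_fibre n \<nu>. f z = c)
       \<and> (\<forall>z\<in>M_fibre n \<nu>. ham_vec n f z \<in> T_fibre n \<nu> z)
       \<and> (\<exists>F. ham_expansion n \<nu> f F)
       \<and> (\<forall>F. ham_expansion n \<nu> f F \<longrightarrow>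
            (\<forall>i\<in>{1..tri (n - 1)}. \<exists>c. \<forall>z\<in>M_fibre n \<nu>. F i z = c)))
    \<and> (\<forall>\<nu>\<in>e_Omega n. \<forall>z\<in>M_fibre n \<nu>.
         basis_of_functionals (O_M_e n) (T_fibre n \<nu> z) {1..tri (n - 1)}
           (\<lambda>i. ham_vec n (gz_r n i) z)
       \<and> (\<forall>i\<in>{1..tri n} - {1..tri (n - 1)}. \<forall>\<psi>\<in>O_M_e n. ham_vec n (gz_r n i) z \<psi> = 0))"
proof (intro conjI ballI allI impI)
  have comm: "poisson_commutative_subalgebra n (J_e n)"
    unfolding poisson_commutative_subalgebra_def using J_e_subalgebra J_e_commutative assms by blast
  show "maximal_poisson_commutative_subalgebra n (J_e n)"
    unfolding maximal_poisson_commutative_subalgebra_def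
  proof (intro conjI allI impI comm)
    fix B assume B: "poisson_commutative_subalgebra n B \<and> J_e n \<subseteq> B"
    show "B = J_e n"
    proof
      show "B \<subseteq> J_e n"
      proof
        fix f assume f: "f \<in> B"
        then have fO: "f \<in> O_M_e n" using B unfolding poisson_commutative_subalgebra_def subalgebra_of_def by blast
        show "f \<in> J_e n"
        proof (rule J_e_maximal[OF fO])
          fix p y assume p: "p \<in> eig_index n" and y: "y \<in> M_Omega_e n"
          \<comment> \<open>B contains all eigenvalue coordinates, so f commutes with each of
            them.\<close>
          have "(\<lambda>z\<in>M_Omega_e n. fst z p) \<in> B" using B J_e_coordinate[OF p] by blast
          then have "lifted_bracket n (\<lambda>z\<in>M_Omega_e n. fst z p) f y = 0"
            using B f y unfolding poisson_commutative_subalgebra_def by blast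
          then show "lifted_bracket n (\<lambda>z. fst z p) f y = 0"
            by (simp only: bracket_coordinate_restrict[OF y p fO])
        qed
      qed
    qed (use B in blast)
  qed
next
  fix i j z assume "i \<in> {1..tri n}" "j \<in> {1..tri n}" "z \<in> M_Omega_e n"
  then show "lifted_bracket n (gz_r n i) (gz_r n j) z = 0"
    using J_e_commutative gz_r_J_e assms by blast
next
  fix f \<nu> assume "f \<in> J_e n" "\<nu> \<in> e_Omega n"
  then show "\<exists>c. \<forall>z\<in>M_fibre n \<nu>. f z = c"
    unfolding J_e_def M_fibre_def by auto
next
  fix f \<nu> z assume "f \<in> J_e n" "\<nu> \<in> e_Omega n" "z \<in> M_fibre n \<nu>"
  then show "ham_vec n f z \<in> T_fibre n \<nu> z" using ham_vec_J_e_mem assms by blast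
next
  fix f \<nu> assume "f \<in> J_e n" "\<nu> \<in> e_Omega n"
  then show "\<exists>F. ham_expansion n \<nu> f F" using ham_expansion_J_e(1) assms by blast
next
  fix f \<nu> F i assume "f \<in> J_e n" "\<nu> \<in> e_Omega n" "ham_expansion n \<nu> f F" "i \<in> {1..tri (n - 1)}"
  then show "\<exists>c. \<forall>z\<in>M_fibre n \<nu>. F i z = c" using ham_expansion_J_e(2) assms by blast
next
  fix \<nu> z assume "\<nu> \<in> e_Omega n" "z \<in> M_fibre n \<nu>"
  from basis_of_functionals_reindex[OF coordinate_basis[OF this(2,1) assms] index_bij_betw]
  show "basis_of_functionals (O_M_e n) (T_fibre n \<nu> z) {1..tri (n - 1)} (\<lambda>i. ham_vec n (gz_r n i) z)"
    unfolding gz_r_def .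
next
  fix \<nu> z i \<psi> assume z: "z \<in> M_fibre n \<nu>" and i: "i \<in> {1..tri n} - {1..tri (n - 1)}" and \<psi>: "\<psi> \<in> O_M_e n"
  note zM = M_fibreD(1)[OF z]
  obtain k m where km: "m \<in> {1..n}" "k \<in> {1..m}" "i = tri (m - 1) + k" "level i = m" "position i = k"
    using tri_index[of i n] i by blast
  \<comment> \<open>Indices of levels up to n - 1 do not exceed d(n - 1).\<close>
  have "\<not> m \<le> n - 1"
    using i tri_index_mem[of m "n - 1" k] km(1-3) by auto
  then have m: "m = n" using km(1) by auto
  have p: "(k, n) \<in> eig_index n" using km by (simp add: eig_index_mem m)
  have "ham_vec n (gz_r n i) z \<psi> = lifted_bracket n (\<lambda>z\<in>M_Omega_e n. fst z (k, n)) \<psi> z"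
    using \<psi> by (simp add: ham_vec_def gz_r_def km(4,5) m)
  also have "\<dots> = 0"
    unfolding bracket_coordinate_restrict[OF zM p \<psi>]
    using bracket_top_coordinate[OF zM assms _ \<psi>] km(2) m by simp
  finally show "ham_vec n (gz_r n i) z \<psi> = 0" .
qed

end
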